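(* Let $G$ be a connected Lie group, $\mathfrak a$ a sequentially complete locally convex smooth $G$-module, $\omega\in Z^2_c(\mathfrak g,\mathfrak a)$ a continuous $2$-cocycle, and $\omega^{\rm eq}\in\Omega^2(G,\mathfrak a)$ the corresponding equivariant $2$-form on $G$ with $\omega^{\rm eq}_{\mathbf 1}=\omega$. Assume that (1) $\omega^{\rm eq}=d\theta$ for some $\theta\in\Omega^1(G,\mathfrak a)$, and (2) for each $g\in G$ the closed $1$-form $\lambda_g^*\theta-\rho_{\mathfrak a}(g)\circ\theta$ is exact. Then the product manifold $\hat G:=\mathfrak a\times G$ carries a Lie group structure which is given by a smooth $2$-cocycle $f\in Z^2_s(G,\mathfrak a)$ (smooth on all of $G\times G$) with $D[f]=[\omega]$ via $$(a,g)(a',g'):=(a+g.a'+f(g,g'),gg').$$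
   Context: A Lie group is a group that is a smooth manifold modeled on a locally convex space with smooth group operations (smooth = all iterated directional derivatives exist and are continuous). $\mathfrak g=T_{\mathbf 1}(G)$. A locally convex smooth $G$-module is a locally convex space $\mathfrak a$ with a smooth linear action $G\times\mathfrak a\to\mathfrak a$, $(g,a)\mapsto g.a=\rho_{\mathfrak a}(g)(a)$; it is a topological $\mathfrak g$-module by the derived action. $\lambda_g(x)=gx$. $\Omega^p(G,\mathfrak a)$ is the space of smooth $\mathfrak a$-valued $p$-forms. $Z^2_c(\mathfrak g,\mathfrak a),H^2_c(\mathfrak g,\mathfrak a)$: continuous Chevalley–Eilenberg $2$-cocycles and cohomology. $\omega^{\rm eq}_g(g.x,g.y)=g.\omega(x,y)$ for $g\in G$, $x,y\in\mathfrak g$. $Z^2_s(G,\mathfrak a)$: functions $f:G\times G\to\mathfrak a$, smooth in an identity neighborhood, with $f(g,\mathbf 1)=f(\mathbf 1,g)=0$ and $g.f(g',g'')-f(gg',g'')+f(g,g'g'')-f(g,g')=0$. $H^2_s(G,\mathfrak a)$ is the quotient by coboundaries $(g,g')\mapsto g.h(g')-h(gg')+h(g)$, $h:G\to\mathfrak a$ smooth near $\mathbf 1$ with $h(\mathbf 1)=0$. $D[f]=[Df]$ with $(Df)(x,y)=d^2f(\mathbf 1,\mathbf 1)(x,y)-d^2f(\mathbf 1,\mathbf 1)(y,x)$, where $d^2f(\mathbf 1,\mathbf 1)(x,y)=\frac{\partial^2}{\partial s\partial t}|_0f(\gamma_x(s),\gamma_y(t))$ for smooth curves $\gamma_x,\gamma_y$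 through $\mathbf 1$ with velocities $x,y$. *)

theory Defs
  imports "HOL-Analysis.Analysis" "HOL-Algebra.Group"
begin

section \<open>Locally convex spaces\<close>

text \<open>Locally convex spaces are real and Hausdorff.\<close>

class locally_convex = real_vector + t2_space + topological_ab_group_add +
  assumes tendsto_scaleR_Pair:
      "((\<lambda>p. fst p *\<^sub>R snd p) \<longlongrightarrow> r *\<^sub>R a) (nhds (r::real) \<times>\<^sub>F nhds a)"
    and locally_convex_at_zero:
      "open U \<Longrightarrow> 0 \<in> U \<Longrightarrow> \<exists>V. open V \<and>
         (\<forall>x\<in>V. \<forall>y\<in>V. \<forall>u\<ge>0. \<forall>v\<ge>0. u + v = 1 \<longrightarrow> scaleR u x + scaleR v y \<in> V) \<and>
         0 \<in> V \<and> V \<subseteq> U"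

lemma convex_neighbourhood_zero:
  "open U \<Longrightarrow> 0 \<in> U \<Longrightarrow> \<exists>V. open V \<and> convex V \<and> 0 \<in> V \<and> V \<subseteq> U"
  for U :: "'a::locally_convex set"
  unfolding convex_def using locally_convex_at_zero .

instance real :: locally_convex
proof
  show "((\<lambda>p. fst p *\<^sub>R snd p) \<longlongrightarrow> r *\<^sub>R a) (nhds r \<times>\<^sub>F nhds a)" for r a :: real
    using tendsto_mult_Pair by simp
  show "\<exists>V. open V \<and>
      (\<forall>x\<in>V. \<forall>y\<in>V. \<forall>u\<ge>0. \<forall>v\<ge>0. u + v = 1 \<longrightarrow> u *\<^sub>R x + v *\<^sub>R y \<in> V) \<and> 0 \<in> V \<and> V \<subseteq> U"
    if "open U" "0 \<in> U" for U :: "real set"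
    unfolding convex_def[symmetric] using that
    by (meson centre_in_ball convex_ball open_ball open_contains_ball)
qed

instance prod :: (topological_monoid_add, topological_monoid_add) topological_monoid_add
proof
  fix a b :: "'a \<times> 'b"
  have "(fst \<longlongrightarrow> a) (nhds (a, b))" "(snd \<longlongrightarrow> b) (nhds (a, b))"
    using tendsto_fst[OF filterlim_ident, of "(a, b)"] tendsto_snd[OF filterlim_ident, of "(a, b)"]
    by (simp_all add: id_def)
  then show "((\<lambda>x. fst x + snd x) \<longlongrightarrow> a + b) (nhds a \<times>\<^sub>F nhds b)"
    unfolding nhds_prod[symmetric] plus_prod_def
    by (intro tendsto_Pair tendsto_add tendsto_fst tendsto_snd)
qed

instance prod :: (topological_comm_monoid_add, topological_comm_monoid_add)
  topological_comm_monoid_add ..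

instance prod :: (topological_group_add, topological_group_add) topological_group_add
proof
  fix a :: "'a \<times> 'b"
  show "(uminus \<longlongrightarrow> - a) (nhds a)"
    unfolding uminus_prod_def
    by (intro tendsto_Pair tendsto_minus tendsto_fst tendsto_snd filterlim_ident)
qed

instance prod :: (topological_ab_group_add, topological_ab_group_add) topological_ab_group_add ..

instance prod :: (locally_convex, locally_convex) locally_convex
proof
  fix r :: real and a :: "'a \<times> 'b"
  have *: "((\<lambda>p. fst p *\<^sub>R snd p) \<longlongrightarrow> r *\<^sub>R c) (nhds (r, c))" for c :: "'c::locally_convex"
    using tendsto_scaleR_Pair[of r c] by (simp add: nhds_prod)
  have 1: "((\<lambda>p. (fst p, fst (snd p))) \<longlongrightarrow> (r, fst a)) (nhds (r, a))"
    and 2: "((\<lambda>p. (fst p, snd (snd p))) \<longlongrightarrow> (r, snd a)) (nhds (r, a))"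
    using tendsto_Pair[OF tendsto_fst tendsto_fst[OF tendsto_snd], OF filterlim_ident filterlim_ident, of "(r, a)"]
      tendsto_Pair[OF tendsto_fst tendsto_snd[OF tendsto_snd], OF filterlim_ident filterlim_ident, of "(r, a)"]
    by simp_all
  show "((\<lambda>p. fst p *\<^sub>R snd p) \<longlongrightarrow> r *\<^sub>R a) (nhds r \<times>\<^sub>F nhds a)"
    unfolding nhds_prod[symmetric] scaleR_prod_def
    using tendsto_Pair[OF filterlim_compose[OF * 1] filterlim_compose[OF * 2]] by simp
next
  fix U :: "('a \<times> 'b) set"
  assume "open U" "0 \<in> U"
  then obtain A B where AB: "open A" "open B" "0 \<in> A \<times> B" "A \<times> B \<subseteq> U"
    by (rule open_prod_elim)
  from AB obtain V where V: "open V" "convex V" "0 \<in> V" "V \<subseteq> A"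
    using convex_neighbourhood_zero[of A] by (metis mem_Times_iff fst_zero)
  from AB obtain W where W: "open W" "convex W" "0 \<in> W" "W \<subseteq> B"
    using convex_neighbourhood_zero[of B] by (metis mem_Times_iff snd_zero)
  have "open (V \<times> W) \<and> convex (V \<times> W) \<and> 0 \<in> V \<times> W \<and> V \<times> W \<subseteq> U"
    using V W subset_trans[OF Sigma_mono AB(4)]
    by (intro conjI open_Times convex_Times) (simp_all add: mem_Times_iff)
  then show "\<exists>V. open V \<and>
      (\<forall>x\<in>V. \<forall>y\<in>V. \<forall>u\<ge>0. \<forall>v\<ge>0. u + v = 1 \<longrightarrow> u *\<^sub>R x + v *\<^sub>R y \<in> V) \<and> 0 \<in> V \<and> V \<subseteq> U"
    unfolding convex_def[symmetric] by (rule exI)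
qed

definition sequentially_complete :: "'a::locally_convex set \<Rightarrow> bool" where
  "sequentially_complete S \<longleftrightarrow>
     (\<forall>X::nat \<Rightarrow> 'a. (\<forall>n. X n \<in> S) \<longrightarrow>
        (\<forall>U. open U \<and> 0 \<in> U \<longrightarrow> (\<exists>N. \<forall>m\<ge>N. \<forall>n\<ge>N. X m - X n \<in> U)) \<longrightarrow>
        (\<exists>L\<in>S. X \<longlonglongrightarrow> L))"


section \<open>Smooth maps between locally convex spaces\<close>

definition dir_differentiable ::
  "('e::locally_convex \<Rightarrow> 'f::locally_convex) \<Rightarrow> 'e \<Rightarrow> 'e \<Rightarrow> bool" where
  "dir_differentiable f x v \<longleftrightarrow> (\<exists>l. ((\<lambda>t::real. (f (x + t *\<^sub>R v) - f x) /\<^sub>R t) \<longlongrightarrow> l) (at 0))"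

definition dir_deriv ::
  "('e::locally_convex \<Rightarrow> 'f::locally_convex) \<Rightarrow> 'e \<Rightarrow> 'e \<Rightarrow> 'f" where
  "dir_deriv f x v = Lim (at 0) (\<lambda>t::real. (f (x + t *\<^sub>R v) - f x) /\<^sub>R t)"

text \<open>The \<open>n\<close>-th iterated derivative at \<open>x\<close> in the directions \<open>h 0, \<dots>, h (n - 1)\<close>.\<close>

primrec iter_deriv ::
  "nat \<Rightarrow> ('e::locally_convex \<Rightarrow> 'f::locally_convex) \<Rightarrow> 'e \<Rightarrow> (nat \<Rightarrow> 'e) \<Rightarrow> 'f" where
  "iter_deriv 0 f x h = f x"
| "iter_deriv (Suc n) f x h = dir_deriv (\<lambda>y. iter_deriv n f y h) x (h n)"

text \<open>
  Since \<open>iter_deriv n f x h\<close> only depends on \<open>h 0, \<dots>, h (n - 1)\<close>, its continuity in \<open>(x, h)\<close> for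
  the product topology on sequences is continuity on \<open>U \<times> E\<^sup>n\<close>. Only used for open \<open>U\<close>.
\<close>

definition smooth_on ::
  "'e::locally_convex set \<Rightarrow> ('e \<Rightarrow> 'f::locally_convex) \<Rightarrow> bool" where
  "smooth_on U f \<longleftrightarrow>
     (\<forall>n. (\<forall>x\<in>U. \<forall>h. dir_differentiable (\<lambda>y. iter_deriv n f y h) x (h n)) \<and>
          continuous_on (U \<times> UNIV) (\<lambda>(x, h). iter_deriv n f x h))"


section \<open>Manifolds modeled on a locally convex space\<close>

text \<open>
  The underlying space of a manifold is a Hausdorff topological type. A chart is a pair of its
  domain and the coordinate map; values of the coordinate map off the domain are irrelevant. A
  manifold structure is given by an atlas, which need not be maximal.
\<close>

type_synonym ('m, 'e) chart = "'m set \<times> ('m \<Rightarrow> 'e)"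

definition chart_inv :: "('m, 'e) chart \<Rightarrow> 'e \<Rightarrow> 'm" where
  "chart_inv c = inv_into (fst c) (snd c)"

definition smooth_atlas :: "('m::t2_space, 'e::locally_convex) chart set \<Rightarrow> bool" where
  "smooth_atlas A \<longleftrightarrow>
     (\<forall>c\<in>A. open (fst c) \<and> open (snd c ` fst c) \<and>
        homeomorphism (fst c) (snd c ` fst c) (snd c) (chart_inv c)) \<and>
     (\<Union>c\<in>A. fst c) = UNIV \<and>
     (\<forall>c\<in>A. \<forall>d\<in>A. smooth_on (snd c ` (fst c \<inter> fst d)) (snd d \<circ> chart_inv c))"

definition vec_atlas :: "('a::locally_convex, 'a) chart set" where
  "vec_atlas = {(UNIV, id)}"

definition prod_atlas ::
  "('m, 'e) chart set \<Rightarrow> ('n, 'f) chart set \<Rightarrow> ('m \<times> 'n, 'e \<times> 'f) chart set" where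
  "prod_atlas A B = {(fst c \<times> fst d, map_prod (snd c) (snd d)) | c d. c \<in> A \<and> d \<in> B}"

definition mfd_smooth_on ::
  "('m::t2_space, 'e::locally_convex) chart set \<Rightarrow> ('n::t2_space, 'f::locally_convex) chart set \<Rightarrow>
   'm set \<Rightarrow> ('m \<Rightarrow> 'n) \<Rightarrow> bool" where
  "mfd_smooth_on A B W f \<longleftrightarrow>
     open W \<and> continuous_on W f \<and>
     (\<forall>c\<in>A. \<forall>d\<in>B. smooth_on (snd c ` {p \<in> W \<inter> fst c. f p \<in> fst d}) (snd d \<circ> f \<circ> chart_inv c))"

definition charts_at :: "('m, 'e) chart set \<Rightarrow> 'm \<Rightarrow> ('m, 'e) chart set" where
  "charts_at A p = {c \<in> A. p \<in> fst c}"

definition chart_at :: "('m, 'e) chart set \<Rightarrow> 'm \<Rightarrow> ('m, 'e) chart" where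
  "chart_at A p = (SOME c. c \<in> charts_at A p)"


section \<open>Tangent vectors\<close>

text \<open>
  A tangent vector at \<open>p\<close> is the family of its coordinates in all charts at \<open>p\<close>, related by the
  derivatives of the chart changes (and extended by \<open>0\<close> to all other charts). Vector space
  operations are pointwise. The topology inherited from the product topology on functions agrees
  with that of the model space, because each coordinate depends continuously on any other one.
\<close>

type_synonym ('m, 'e) tangent = "('m, 'e) chart \<Rightarrow> 'e"

definition tangent_space ::
  "('m, 'e::locally_convex) chart set \<Rightarrow> 'm \<Rightarrow> ('m, 'e) tangent set" where
  "tangent_space A p =
     {v. (\<forall>c\<in>charts_at A p. \<forall>d\<in>charts_at A p.
            v d = dir_deriv (snd d \<circ> chart_inv c) (snd c p) (v c)) \<and>
         (\<forall>c. c \<notin> charts_at A p \<longrightarrow> v c = 0)}"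

text \<open>The tangent vector at \<open>p\<close> with coordinate \<open>x\<close> in the chart \<open>c\<close>.\<close>

definition tangent_of ::
  "('m, 'e::locally_convex) chart set \<Rightarrow> ('m, 'e) chart \<Rightarrow> 'm \<Rightarrow> 'e \<Rightarrow> ('m, 'e) tangent" where
  "tangent_of A c p x =
     (\<lambda>d. if d \<in> charts_at A p then dir_deriv (snd d \<circ> chart_inv c) (snd c p) x else 0)"

definition tangent_map ::
  "('m, 'e::locally_convex) chart set \<Rightarrow> ('n, 'f::locally_convex) chart set \<Rightarrow> ('m \<Rightarrow> 'n) \<Rightarrow>
   'm \<Rightarrow> ('m, 'e) tangent \<Rightarrow> ('n, 'f) tangent" where
  "tangent_map A B f p v =
     (\<lambda>d. if d \<in> charts_at B (f p)
          then let c = chart_at A p in dir_deriv (snd d \<circ> f \<circ> chart_inv c) (snd c p) (v c)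
          else 0)"

text \<open>A smooth curve through \<open>p\<close> with velocity \<open>v\<close> there.\<close>

definition curve_through ::
  "('m::t2_space, 'e::locally_convex) chart set \<Rightarrow> 'm \<Rightarrow> ('m, 'e) tangent \<Rightarrow> (real \<Rightarrow> 'm) \<Rightarrow> bool" where
  "curve_through A p v \<gamma> \<longleftrightarrow>
     (\<exists>\<epsilon>>0. mfd_smooth_on vec_atlas A {-\<epsilon><..<\<epsilon>} \<gamma>) \<and> \<gamma> 0 = p \<and>
     (\<forall>c\<in>charts_at A p. dir_deriv (snd c \<circ> \<gamma>) 0 1 = v c)"

definition linear_on_space :: "('c \<Rightarrow> 'e::locally_convex) set \<Rightarrow> (('c \<Rightarrow> 'e) \<Rightarrow> 'a::locally_convex) \<Rightarrow> bool" where
  "linear_on_space T l \<longleftrightarrow>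
     (\<forall>v\<in>T. \<forall>w\<in>T. l (\<lambda>c. v c + w c) = l v + l w) \<and>
     (\<forall>r. \<forall>v\<in>T. l (\<lambda>c. r *\<^sub>R v c) = r *\<^sub>R l v)"

definition alternating_on_space ::
  "('c \<Rightarrow> 'e::locally_convex) set \<Rightarrow> (('c \<Rightarrow> 'e) \<Rightarrow> ('c \<Rightarrow> 'e) \<Rightarrow> 'a::locally_convex) \<Rightarrow> bool" where
  "alternating_on_space T b \<longleftrightarrow>
     (\<forall>v\<in>T. linear_on_space T (b v)) \<and> (\<forall>w\<in>T. linear_on_space T (\<lambda>v. b v w)) \<and>
     (\<forall>v\<in>T. b v v = 0)"


section \<open>Differential forms of degree 1 and 2\<close>

definition one_forms ::
  "('m, 'e::locally_convex) chart set \<Rightarrow> ('m \<Rightarrow> ('m, 'e) tangent \<Rightarrow> 'a::locally_convex) set" where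
  "one_forms A =
     {\<theta>. (\<forall>p. linear_on_space (tangent_space A p) (\<theta> p)) \<and>
         (\<forall>c\<in>A. smooth_on ((snd c ` fst c) \<times> UNIV)
            (\<lambda>(x, v). let p = chart_inv c x in \<theta> p (tangent_of A c p v)))}"

definition two_forms ::
  "('m, 'e::locally_convex) chart set \<Rightarrow>
   ('m \<Rightarrow> ('m, 'e) tangent \<Rightarrow> ('m, 'e) tangent \<Rightarrow> 'a::locally_convex) set" where
  "two_forms A =
     {\<eta>. (\<forall>p. alternating_on_space (tangent_space A p) (\<eta> p)) \<and>
         (\<forall>c\<in>A. smooth_on ((snd c ` fst c) \<times> UNIV \<times> UNIV)
            (\<lambda>(x, v, w). let p = chart_inv c x in
               \<eta> p (tangent_of A c p v) (tangent_of A c p w)))}"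

text \<open>The differential of a function \<open>h\<close> with values in a locally convex space.\<close>

definition differential ::
  "('m, 'e::locally_convex) chart set \<Rightarrow> ('m \<Rightarrow> 'a::locally_convex) \<Rightarrow>
   'm \<Rightarrow> ('m, 'e) tangent \<Rightarrow> 'a" where
  "differential A h p v = (let c = chart_at A p in dir_deriv (h \<circ> chart_inv c) (snd c p) (v c))"

text \<open>
  \<open>(d\<theta>)(V, W) = V.\<theta>(W) - W.\<theta>(V) - \<theta>([V, W])\<close>, evaluated on vector fields that are constant in a
  chart, so that the bracket vanishes.
\<close>

definition ext_deriv ::
  "('m, 'e::locally_convex) chart set \<Rightarrow> ('m \<Rightarrow> ('m, 'e) tangent \<Rightarrow> 'a::locally_convex) \<Rightarrow>
   'm \<Rightarrow> ('m, 'e) tangent \<Rightarrow> ('m, 'e) tangent \<Rightarrow> 'a" where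
  "ext_deriv A \<theta> p v w =
     (let c = chart_at A p;
          \<theta>c = (\<lambda>x u. \<theta> (chart_inv c x) (tangent_of A c (chart_inv c x) u))
      in dir_deriv (\<lambda>x. \<theta>c x (w c)) (snd c p) (v c) - dir_deriv (\<lambda>x. \<theta>c x (v c)) (snd c p) (w c))"

definition pullback ::
  "('m, 'e::locally_convex) chart set \<Rightarrow> ('n, 'f::locally_convex) chart set \<Rightarrow> ('m \<Rightarrow> 'n) \<Rightarrow>
   ('n \<Rightarrow> ('n, 'f) tangent \<Rightarrow> 'a) \<Rightarrow> 'm \<Rightarrow> ('m, 'e) tangent \<Rightarrow> 'a" where
  "pullback A B f \<theta> p v = \<theta> (f p) (tangent_map A B f p v)"

definition exact_form ::
  "('m::t2_space, 'e::locally_convex) chart set \<Rightarrow> ('m \<Rightarrow> ('m, 'e) tangent \<Rightarrow> 'a::locally_convex) \<Rightarrow>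
   bool" where
  "exact_form A \<alpha> \<longleftrightarrow>
     (\<exists>h. mfd_smooth_on A vec_atlas UNIV h \<and>
          (\<forall>p. \<forall>v\<in>tangent_space A p. \<alpha> p v = differential A h p v))"


section \<open>Lie groups, smooth modules and Lie algebra cohomology\<close>

definition lie_group ::
  "('g::t2_space, 'e::locally_convex) chart set \<Rightarrow> ('g, 'x) monoid_scheme \<Rightarrow> bool" where
  "lie_group A G \<longleftrightarrow>
     group G \<and> carrier G = UNIV \<and> smooth_atlas A \<and>
     mfd_smooth_on (prod_atlas A A) A UNIV (\<lambda>(g, h). g \<otimes>\<^bsub>G\<^esub> h) \<and>
     mfd_smooth_on A A UNIV (\<lambda>g. inv\<^bsub>G\<^esub> g)"

definition smooth_module ::
  "('g::t2_space, 'e::locally_convex) chart set \<Rightarrow> ('g, 'x) monoid_scheme \<Rightarrow>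
   ('g \<Rightarrow> 'a::locally_convex \<Rightarrow> 'a) \<Rightarrow> bool" where
  "smooth_module A G \<rho> \<longleftrightarrow>
     (\<forall>g. linear (\<rho> g)) \<and> \<rho> \<one>\<^bsub>G\<^esub> = id \<and> (\<forall>g h. \<rho> (g \<otimes>\<^bsub>G\<^esub> h) = \<rho> g \<circ> \<rho> h) \<and>
     mfd_smooth_on (prod_atlas A vec_atlas) vec_atlas UNIV (\<lambda>(g, a). \<rho> g a)"

definition left_translate ::
  "('g, 'e::locally_convex) chart set \<Rightarrow> ('g, 'x) monoid_scheme \<Rightarrow>
   'g \<Rightarrow> ('g, 'e) tangent \<Rightarrow> ('g, 'e) tangent" where
  "left_translate A G g x = tangent_map A A (\<lambda>h. g \<otimes>\<^bsub>G\<^esub> h) \<one>\<^bsub>G\<^esub> x"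

text \<open>The convention is \<open>[X, Y].f = X.(Y.f) - Y.(X.f)\<close>, that is, \<open>[X, Y] = dY(X) - dX(Y)\<close> in charts.\<close>

definition vf_bracket ::
  "('m, 'e::locally_convex) chart set \<Rightarrow> ('m \<Rightarrow> ('m, 'e) tangent) \<Rightarrow> ('m \<Rightarrow> ('m, 'e) tangent) \<Rightarrow>
   'm \<Rightarrow> ('m, 'e) tangent" where
  "vf_bracket A X Y p =
     (\<lambda>c. if c \<in> charts_at A p
          then dir_deriv (\<lambda>y. Y (chart_inv c y) c) (snd c p) (X p c)
             - dir_deriv (\<lambda>y. X (chart_inv c y) c) (snd c p) (Y p c)
          else 0)"

text \<open>The Lie algebra of \<open>G\<close> is the tangent space at the identity, with the bracket coming from the
  left invariant vector fields.\<close>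

abbreviation lie_algebra ::
  "('g, 'e::locally_convex) chart set \<Rightarrow> ('g, 'x) monoid_scheme \<Rightarrow> ('g, 'e) tangent set" where
  "lie_algebra A G \<equiv> tangent_space A \<one>\<^bsub>G\<^esub>"

definition lie_bracket ::
  "('g, 'e::locally_convex) chart set \<Rightarrow> ('g, 'x) monoid_scheme \<Rightarrow>
   ('g, 'e) tangent \<Rightarrow> ('g, 'e) tangent \<Rightarrow> ('g, 'e) tangent" where
  "lie_bracket A G x y =
     vf_bracket A (\<lambda>g. left_translate A G g x) (\<lambda>g. left_translate A G g y) \<one>\<^bsub>G\<^esub>"

definition derived_action ::
  "('g, 'e::locally_convex) chart set \<Rightarrow> ('g, 'x) monoid_scheme \<Rightarrow>
   ('g \<Rightarrow> 'a::locally_convex \<Rightarrow> 'a) \<Rightarrow> ('g, 'e) tangent \<Rightarrow> 'a \<Rightarrow> 'a" where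
  "derived_action A G \<rho> x a = differential A (\<lambda>g. \<rho> g a) \<one>\<^bsub>G\<^esub> x"

definition lie_cochains1 ::
  "('g, 'e::locally_convex) chart set \<Rightarrow> ('g, 'x) monoid_scheme \<Rightarrow>
   (('g, 'e) tangent \<Rightarrow> 'a::locally_convex) set" where
  "lie_cochains1 A G =
     {l. linear_on_space (lie_algebra A G) l \<and> continuous_on (lie_algebra A G) l}"

definition lie_cocycles2 ::
  "('g, 'e::locally_convex) chart set \<Rightarrow> ('g, 'x) monoid_scheme \<Rightarrow>
   ('g \<Rightarrow> 'a::locally_convex \<Rightarrow> 'a) \<Rightarrow> (('g, 'e) tangent \<Rightarrow> ('g, 'e) tangent \<Rightarrow> 'a) set" where
  "lie_cocycles2 A G \<rho> =
     (let \<gg> = lie_algebra A G; br = lie_bracket A G; act = derived_action A G \<rho> in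
      {\<omega>. alternating_on_space \<gg> \<omega> \<and> continuous_on (\<gg> \<times> \<gg>) (\<lambda>(x, y). \<omega> x y) \<and>
          (\<forall>x\<in>\<gg>. \<forall>y\<in>\<gg>. \<forall>z\<in>\<gg>.
             act x (\<omega> y z) + act y (\<omega> z x) + act z (\<omega> x y)
             - \<omega> (br x y) z - \<omega> (br y z) x - \<omega> (br z x) y = 0)})"

definition lie_coboundary1 ::
  "('g, 'e::locally_convex) chart set \<Rightarrow> ('g, 'x) monoid_scheme \<Rightarrow>
   ('g \<Rightarrow> 'a::locally_convex \<Rightarrow> 'a) \<Rightarrow> (('g, 'e) tangent \<Rightarrow> 'a) \<Rightarrow>
   ('g, 'e) tangent \<Rightarrow> ('g, 'e) tangent \<Rightarrow> 'a" where
  "lie_coboundary1 A G \<rho> l x y =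
     derived_action A G \<rho> x (l y) - derived_action A G \<rho> y (l x) - l (lie_bracket A G x y)"

text \<open>Cochains are only compared on the Lie algebra; off it their values are irrelevant.\<close>

definition lie_cohomologous ::
  "('g, 'e::locally_convex) chart set \<Rightarrow> ('g, 'x) monoid_scheme \<Rightarrow>
   ('g \<Rightarrow> 'a::locally_convex \<Rightarrow> 'a) \<Rightarrow>
   ((('g, 'e) tangent \<Rightarrow> ('g, 'e) tangent \<Rightarrow> 'a) \<times> (('g, 'e) tangent \<Rightarrow> ('g, 'e) tangent \<Rightarrow> 'a)) set" where
  "lie_cohomologous A G \<rho> =
     {(\<omega>, \<omega>'). \<omega> \<in> lie_cocycles2 A G \<rho> \<and> \<omega>' \<in> lie_cocycles2 A G \<rho> \<and>
        (\<exists>l\<in>lie_cochains1 A G. \<forall>x\<in>lie_algebra A G. \<forall>y\<in>lie_algebra A G.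
           \<omega>' x y - \<omega> x y = lie_coboundary1 A G \<rho> l x y)}"

definition lie_class ::
  "('g, 'e::locally_convex) chart set \<Rightarrow> ('g, 'x) monoid_scheme \<Rightarrow>
   ('g \<Rightarrow> 'a::locally_convex \<Rightarrow> 'a) \<Rightarrow> (('g, 'e) tangent \<Rightarrow> ('g, 'e) tangent \<Rightarrow> 'a) \<Rightarrow>
   (('g, 'e) tangent \<Rightarrow> ('g, 'e) tangent \<Rightarrow> 'a) set" where
  "lie_class A G \<rho> \<omega> = lie_cohomologous A G \<rho> `` {\<omega>}"

definition equivariant_form ::
  "('g, 'e::locally_convex) chart set \<Rightarrow> ('g, 'x) monoid_scheme \<Rightarrow>
   ('g \<Rightarrow> 'a::locally_convex \<Rightarrow> 'a) \<Rightarrow> (('g, 'e) tangent \<Rightarrow> ('g, 'e) tangent \<Rightarrow> 'a) \<Rightarrow>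
   ('g \<Rightarrow> ('g, 'e) tangent \<Rightarrow> ('g, 'e) tangent \<Rightarrow> 'a) \<Rightarrow> bool" where
  "equivariant_form A G \<rho> \<omega> \<eta> \<longleftrightarrow>
     \<eta> \<in> two_forms A \<and>
     (\<forall>g. \<forall>x\<in>lie_algebra A G. \<forall>y\<in>lie_algebra A G.
        \<eta> g (left_translate A G g x) (left_translate A G g y) = \<rho> g (\<omega> x y))"


section \<open>Group cocycles\<close>

definition smooth_cocycles2 ::
  "('g::t2_space, 'e::locally_convex) chart set \<Rightarrow> ('g, 'x) monoid_scheme \<Rightarrow>
   ('g \<Rightarrow> 'a::locally_convex \<Rightarrow> 'a) \<Rightarrow> ('g \<Rightarrow> 'g \<Rightarrow> 'a) set" where
  "smooth_cocycles2 A G \<rho> =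
     {f. (\<exists>W. (\<one>\<^bsub>G\<^esub>, \<one>\<^bsub>G\<^esub>) \<in> W \<and>
            mfd_smooth_on (prod_atlas A A) vec_atlas W (\<lambda>(g, h). f g h)) \<and>
         (\<forall>g. f g \<one>\<^bsub>G\<^esub> = 0 \<and> f \<one>\<^bsub>G\<^esub> g = 0) \<and>
         (\<forall>g g' g''. \<rho> g (f g' g'') - f (g \<otimes>\<^bsub>G\<^esub> g') g'' + f g (g' \<otimes>\<^bsub>G\<^esub> g'') - f g g' = 0)}"

definition second_deriv_one ::
  "('g::t2_space, 'e::locally_convex) chart set \<Rightarrow> ('g, 'x) monoid_scheme \<Rightarrow>
   ('g \<Rightarrow> 'g \<Rightarrow> 'a::locally_convex) \<Rightarrow> ('g, 'e) tangent \<Rightarrow> ('g, 'e) tangent \<Rightarrow> 'a" where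
  "second_deriv_one A G f x y =
     (THE z. \<forall>\<gamma>x \<gamma>y. curve_through A \<one>\<^bsub>G\<^esub> x \<gamma>x \<and> curve_through A \<one>\<^bsub>G\<^esub> y \<gamma>y \<longrightarrow>
        z = dir_deriv (\<lambda>s::real. dir_deriv (\<lambda>t::real. f (\<gamma>x s) (\<gamma>y t)) 0 1) 0 1)"

definition cocycle_deriv ::
  "('g::t2_space, 'e::locally_convex) chart set \<Rightarrow> ('g, 'x) monoid_scheme \<Rightarrow>
   ('g \<Rightarrow> 'g \<Rightarrow> 'a::locally_convex) \<Rightarrow> ('g, 'e) tangent \<Rightarrow> ('g, 'e) tangent \<Rightarrow> 'a" where
  "cocycle_deriv A G f x y = second_deriv_one A G f x y - second_deriv_one A G f y x"

definition extension_group ::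
  "('g, 'x) monoid_scheme \<Rightarrow> ('g \<Rightarrow> 'a::locally_convex \<Rightarrow> 'a) \<Rightarrow> ('g \<Rightarrow> 'g \<Rightarrow> 'a) \<Rightarrow> ('a \<times> 'g) monoid" where
  "extension_group G \<rho> f =
     \<lparr>carrier = UNIV,
      mult = (\<lambda>(a, g) (a', g'). (a + \<rho> g a' + f g g', g \<otimes>\<^bsub>G\<^esub> g')),
      one = (0, \<one>\<^bsub>G\<^esub>)\<rparr>"

end

(*
  For each g let h_g be the primitive of the exact form (pullback of theta along left translation
  by g) - rho(g) o theta with h_g(1) = 0, and put f(g, g') = h_g(g'). The cocycle identity holds
  since both sides have the same differential in the last variable and G is connected.

  Smoothness of f near (1, 1): the partial derivative of f in the second variable is smooth, and
  f(g, 1) = 0. Existence of primitives passes to uniform limits in a sequentially complete space, so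
  one can differentiate under the integral sign without ever defining the integral. The cocycle
  identity then carries smoothness from a neighbourhood of (1, 1) to G x {x} for x near 1, and the
  set of all x such that f is smooth along G x {x} is closed under products, hence all of G.

  Since the derivative of f(g, -) at 1 in direction y is theta(g.y) - g.theta(y), the cocycle D f
  differs from omega by the coboundary of theta at 1. That D f is itself a cocycle requires the
  Jacobi identity and the derived representation; both are read off in a chart at 1 from the left
  invariance of the left invariant fields and the symmetry of second derivatives.
*)

theory Submission
  imports Defs
begin

section \<open>Directional derivatives and the mean value theorem\<close>

text \<open>Exactness is assumed for each g on its own and the primitive is merely chosen, so no
  regularity of f in its first argument comes for free; this is what the smoothness argument has to
  overcome. Near (1, 1) the normalization f(g, 1) = 0 helps: in a convex chart domain f(g, x) is the
  integral of its partial derivative over the segment from 1 to x, and that derivative is smooth in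
  g, being built from the multiplication, the action and \<theta>. For g near an arbitrary g0 one
  has f(g0 k, x) = g0.f(k, x) + f(g0, k x) - f(g0, k), whose last two terms involve only the single
  smooth function h_g0. The second obstacle is the generality of the spaces. There is no norm, so
  estimates become membership in open convex sets, for which a mean value theorem is proved by
  interval induction. Smoothness is shown by exhibiting a family of functions that contains the
  given one and is stable, up to sums, under differentiation.\<close>

lemma tendsto_scaleR_lc [tendsto_intros]:
  fixes a :: "'a::locally_convex"
  assumes "(f \<longlongrightarrow> r) F" "(g \<longlongrightarrow> a) F"
  shows "((\<lambda>x. f x *\<^sub>R g x) \<longlongrightarrow> r *\<^sub>R a) F"
  using filterlim_compose[OF tendsto_scaleR_Pair filterlim_Pair[OF assms]] by simp

lemma continuous_on_scaleR_lc [continuous_intros]: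
  fixes g :: "'b::topological_space \<Rightarrow> 'a::locally_convex"
  assumes "continuous_on S f" "continuous_on S g"
  shows "continuous_on S (\<lambda>x. f x *\<^sub>R g x)"
  using assms by (auto simp: continuous_on_def intro!: tendsto_scaleR_lc)

lemma open_vimage_minus_lc:
  fixes V :: "'a::locally_convex set"
  assumes "open V"
  shows "open ((\<lambda>x. x - a) -` V)"
  by (intro open_vimage assms continuous_intros)

lemma convex_neighbourhood:
  fixes C :: "'a::locally_convex set"
  assumes "open C" "l \<in> C"
  obtains V where "open V" "convex V" "l \<in> V" "V \<subseteq> C"
proof -
  have "open ((\<lambda>x. x - (-l)) -` C)" "0 \<in> ((\<lambda>x. x - (-l)) -` C)"
    using assms open_vimage_minus_lc[of C "- l"] by auto
  then obtain V where V: "open V" "convex V" "0 \<in> V" "V \<subseteq> (\<lambda>x. x - (-l)) -` C"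
    using convex_neighbourhood_zero by metis
  have eq: "(\<lambda>x. x - l) -` V = (+) l ` V"
  proof safe
    fix x assume "x - l \<in> V"
    then have "l + (x - l) \<in> (+) l ` V" by blast
    then show "x \<in> (+) l ` V" by simp
  qed simp
  show ?thesis
  proof
    show "open ((+) l ` V)" using open_vimage_minus_lc[OF V(1)] eq by metis
    show "convex ((+) l ` V)" using V(2) by (rule convex_translation)
    show "l \<in> (+) l ` V" using V(3) by force
    show "(+) l ` V \<subseteq> C" using V(4) by (auto simp: add.commute)
  qed
qed

text \<open>Limits are tested on convex neighbourhoods only, because these are the sets to which the
  mean value theorem below applies.\<close>

lemma tendsto_convexI:
  fixes l :: "'a::locally_convex"
  assumes "\<And>C. open C \<Longrightarrow> convex C \<Longrightarrow> l \<in> C \<Longrightarrow> eventually (\<lambda>x. f x \<in> C) F"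
  shows "(f \<longlongrightarrow> l) F"
proof (rule topological_tendstoI)
  fix S assume "open S" "l \<in> S"
  then obtain V where V: "open V" "convex V" "l \<in> V" "V \<subseteq> S" by (rule convex_neighbourhood)
  show "eventually (\<lambda>x. f x \<in> S) F"
    using assms[OF V(1-3)] by eventually_elim (use V(4) in auto)
qed

text \<open>The set \<open>S\<close> allows one-sided derivatives at the ends of an interval, as
  required for primitives on [0, 1]. The value \<open>l\<close> is an argument because
  \<open>dir_deriv\<close> is total and says nothing about existence.\<close>

definition has_curve_deriv :: "(real \<Rightarrow> 'f::locally_convex) \<Rightarrow> 'f \<Rightarrow> real \<Rightarrow> real set \<Rightarrow> bool" where
  "has_curve_deriv c l t S \<longleftrightarrow> ((\<lambda>s. (c s - c t) /\<^sub>R (s - t)) \<longlongrightarrow> l) (at t within S)"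

definition has_dir_deriv ::
  "('e::locally_convex \<Rightarrow> 'f::locally_convex) \<Rightarrow> 'e \<Rightarrow> 'e \<Rightarrow> 'f \<Rightarrow> bool" where
  "has_dir_deriv f x v l \<longleftrightarrow> has_curve_deriv (\<lambda>t. f (x + t *\<^sub>R v)) l 0 UNIV"

lemma has_dir_deriv_tendsto:
  "has_dir_deriv f x v l \<longleftrightarrow> ((\<lambda>t::real. (f (x + t *\<^sub>R v) - f x) /\<^sub>R t) \<longlongrightarrow> l) (at 0)"
  by (simp add: has_dir_deriv_def has_curve_deriv_def)

lemma dir_differentiable_iff: "dir_differentiable f x v \<longleftrightarrow> (\<exists>l. has_dir_deriv f x v l)"
  by (simp add: dir_differentiable_def has_dir_deriv_tendsto)

lemma has_dir_deriv_unique: "has_dir_deriv f x v l \<Longrightarrow> has_dir_deriv f x v l' \<Longrightarrow> l = l'"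
  unfolding has_dir_deriv_tendsto by (rule tendsto_unique[OF trivial_limit_at])

lemma dir_deriv_eq: "has_dir_deriv f x v l \<Longrightarrow> dir_deriv f x v = l"
  unfolding has_dir_deriv_tendsto dir_deriv_def by (rule tendsto_Lim[OF trivial_limit_at])

lemma has_dir_deriv_dir_deriv: "dir_differentiable f x v \<Longrightarrow> has_dir_deriv f x v (dir_deriv f x v)"
  using dir_differentiable_iff dir_deriv_eq by metis

lemma has_curve_deriv_cong:
  assumes "has_curve_deriv c l t S" "eventually (\<lambda>s. c s = d s) (at t within S)" "c t = d t"
  shows "has_curve_deriv d l t S"
  using assms(1) unfolding has_curve_deriv_def
  by (rule Lim_transform_eventually) (use assms(2,3) in \<open>auto elim: eventually_mono\<close>)

lemma eventually_add_scaleR_in: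
  fixes x v :: "'e::locally_convex"
  assumes "open U" "x \<in> U"
  shows "eventually (\<lambda>t. x + t *\<^sub>R v \<in> U) (nhds (0::real))"
proof -
  have "((\<lambda>t. x + t *\<^sub>R v) \<longlongrightarrow> x + 0 *\<^sub>R v) (nhds 0)"
    by (intro tendsto_intros filterlim_ident)
  then show ?thesis using assms by (auto dest: topological_tendstoD)
qed

lemma has_dir_deriv_cong:
  assumes "has_dir_deriv f x v l" "open U" "x \<in> U" "\<And>y. y \<in> U \<Longrightarrow> f y = g y"
  shows "has_dir_deriv g x v l"
  using assms(1) unfolding has_dir_deriv_def
proof (rule has_curve_deriv_cong)
  show "eventually (\<lambda>s. f (x + s *\<^sub>R v) = g (x + s *\<^sub>R v)) (at 0)"
    using eventually_add_scaleR_in[OF assms(2,3), of v] unfolding eventually_at_filter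
    by (auto elim!: eventually_mono intro: assms(4))
qed (use assms in auto)

text \<open>No differentiability is assumed: \<open>Lim\<close> is a definite description, and the
  difference quotients of the two functions have the same limits.\<close>

lemma dir_deriv_cong:
  assumes "open U" "x \<in> U" "\<And>y. y \<in> U \<Longrightarrow> f y = g y"
  shows "dir_deriv f x v = dir_deriv g x v"
proof -
  have "has_dir_deriv f x v l = has_dir_deriv g x v l" for l
  proof
    show "has_dir_deriv f x v l \<Longrightarrow> has_dir_deriv g x v l"
      by (erule has_dir_deriv_cong[OF _ assms(1,2)]) (simp add: assms(3))
    show "has_dir_deriv g x v l \<Longrightarrow> has_dir_deriv f x v l"
      by (erule has_dir_deriv_cong[OF _ assms(1,2)]) (simp add: assms(3))
  qed
  then show ?thesis unfolding dir_deriv_def t2_space_class.Lim_def has_dir_deriv_tendsto by simp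
qed

lemma has_curve_deriv_add:
  assumes "has_curve_deriv c l t S" "has_curve_deriv d m t S"
  shows "has_curve_deriv (\<lambda>s. c s + d s) (l + m) t S"
  using tendsto_add[OF assms[unfolded has_curve_deriv_def]]
  unfolding has_curve_deriv_def by (simp add: algebra_simps)

lemma has_curve_deriv_diff:
  assumes "has_curve_deriv c l t S" "has_curve_deriv d m t S"
  shows "has_curve_deriv (\<lambda>s. c s - d s) (l - m) t S"
  using tendsto_diff[OF assms[unfolded has_curve_deriv_def]]
  unfolding has_curve_deriv_def by (simp add: algebra_simps)

lemma has_curve_deriv_scaleR:
  assumes "has_curve_deriv c l t S"
  shows "has_curve_deriv (\<lambda>s. r *\<^sub>R c s) (r *\<^sub>R l) t S"
  using tendsto_scaleR_lc[OF tendsto_const[of r] assms[unfolded has_curve_deriv_def]]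
  unfolding has_curve_deriv_def by (simp add: algebra_simps)

lemma has_curve_deriv_const: "has_curve_deriv (\<lambda>s. a) 0 t S"
  by (simp add: has_curve_deriv_def)

lemma has_dir_deriv_add:
  "has_dir_deriv f x v l \<Longrightarrow> has_dir_deriv g x v m \<Longrightarrow> has_dir_deriv (\<lambda>y. f y + g y) x v (l + m)"
  unfolding has_dir_deriv_def by (rule has_curve_deriv_add)

lemma has_dir_deriv_diff:
  "has_dir_deriv f x v l \<Longrightarrow> has_dir_deriv g x v m \<Longrightarrow> has_dir_deriv (\<lambda>y. f y - g y) x v (l - m)"
  unfolding has_dir_deriv_def by (rule has_curve_deriv_diff)

lemma has_dir_deriv_scaleR:
  "has_dir_deriv f x v l \<Longrightarrow> has_dir_deriv (\<lambda>y. r *\<^sub>R f y) x v (r *\<^sub>R l)"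
  unfolding has_dir_deriv_def by (rule has_curve_deriv_scaleR)

lemma has_dir_deriv_const: "has_dir_deriv (\<lambda>y. a) x v 0"
  unfolding has_dir_deriv_def by (rule has_curve_deriv_const)

lemma has_dir_deriv_scale_dir:
  assumes "has_dir_deriv f x v l"
  shows "has_dir_deriv f x (r *\<^sub>R v) (r *\<^sub>R l)"
proof (cases "r = 0")
  case False
  have "filterlim (\<lambda>t. t * r) (at 0) (at (0::real))"
    using False by (auto simp: filterlim_at eventually_at_filter intro!: tendsto_eq_intros)
  from filterlim_compose[OF assms[unfolded has_dir_deriv_tendsto] this]
  have "((\<lambda>t. r *\<^sub>R ((f (x + (t * r) *\<^sub>R v) - f x) /\<^sub>R (t * r))) \<longlongrightarrow> r *\<^sub>R l) (at 0)"
    by (intro tendsto_intros)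
  then show ?thesis using False unfolding has_dir_deriv_tendsto by (simp add: divide_simps)
qed (simp add: has_dir_deriv_const has_dir_deriv_tendsto)

lemma has_curve_deriv_along_line:
  assumes "has_dir_deriv f (x + t *\<^sub>R v) v l"
  shows "has_curve_deriv (\<lambda>s. f (x + s *\<^sub>R v)) l t S"
proof -
  have "filterlim (\<lambda>s. s - t) (at 0) (at t within S)"
    by (auto simp: filterlim_at eventually_at_filter intro!: tendsto_eq_intros)
  from filterlim_compose[OF assms[unfolded has_dir_deriv_tendsto] this]
  have "((\<lambda>s. (f (x + t *\<^sub>R v + (s - t) *\<^sub>R v) - f (x + t *\<^sub>R v)) /\<^sub>R (s - t)) \<longlongrightarrow> l) (at t within S)" .
  then show ?thesis unfolding has_curve_deriv_def
    by (simp add: scaleR_diff_left)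
qed

section \<open>The mean value theorem for open convex sets\<close>

lemma convex_quotient_combine:
  fixes c :: "real \<Rightarrow> 'f::real_vector"
  assumes "u < v" "v < w" "convex C" "(c v - c u) /\<^sub>R (v - u) \<in> C" "(c w - c v) /\<^sub>R (w - v) \<in> C"
  shows "(c w - c u) /\<^sub>R (w - u) \<in> C"
proof -
  let ?a = "(v - u) / (w - u)" and ?b = "(w - v) / (w - u)"
  have ab: "0 \<le> ?a" "0 \<le> ?b" "?a + ?b = 1"
    using assms(1,2) by (simp_all add: add_divide_distrib[symmetric])
  have eq: "?a * inverse (v - u) = inverse (w - u)" "?b * inverse (w - v) = inverse (w - u)"
    using assms(1,2) by (simp_all add: field_simps)
  have "?a *\<^sub>R ((c v - c u) /\<^sub>R (v - u)) + ?b *\<^sub>R ((c w - c v) /\<^sub>R (w - v)) \<in> C"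
    by (rule convexD[OF assms(3-5) ab])
  then show ?thesis
    unfolding scaleR_scaleR eq by (simp add: scaleR_add_right[symmetric])
qed

text \<open>This replaces the reduction to real functions by continuous functionals. Near each point
  x the slopes with one end at x lie in the open set \<open>C\<close> by differentiability. The
  slope over a union of two adjacent intervals is a convex combination of their slopes, so the
  property spreads to [a, b] by interval induction.\<close>

lemma mean_value_quotient:
  fixes c :: "real \<Rightarrow> 'f::locally_convex"
  assumes "a < b" and d: "\<And>t. a \<le> t \<Longrightarrow> t \<le> b \<Longrightarrow> has_curve_deriv c (c' t) t {a..b}"
    and C: "\<And>t. a \<le> t \<Longrightarrow> t \<le> b \<Longrightarrow> c' t \<in> C" "open C" "convex C"
  shows "(c b - c a) /\<^sub>R (b - a) \<in> C"
proof -
  define q where "q u v = (c v - c u) /\<^sub>R (v - u)" for u v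
  have q_trans: "q u w \<in> C" if "u < v" "v < w" "q u v \<in> C" "q v w \<in> C" for u v w
    unfolding q_def by (rule convex_quotient_combine[OF that(1,2) C(3) that(3,4)[unfolded q_def]])
  have q_sym: "q u v = q v u" for u v
  proof -
    have "inverse (v - u) = - inverse (u - v)" by (metis inverse_minus_eq minus_diff_eq)
    then show ?thesis by (simp add: q_def scaleR_diff_right)
  qed
  \<comment> \<open>Degenerate intervals and intervals leaving [a, b] satisfy \<open>P\<close>
    vacuously, since the induction rule also supplies such pairs.\<close>
  define P where "P u v \<longleftrightarrow> (a \<le> u \<and> u < v \<and> v \<le> b \<longrightarrow> q u v \<in> C)" for u v
  have "a \<le> b" using assms(1) by simp
  then have "P a b"
  proof (rule Bolzano)
    fix u v w assume *: "P u v" "P v w" "u \<le> v" "v \<le> w"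
    show "P u w" unfolding P_def
    proof (intro impI)
      assume uw: "a \<le> u \<and> u < w \<and> w \<le> b"
      show "q u w \<in> C"
      proof (cases "u = v \<or> v = w")
        case True
        then show ?thesis using * uw unfolding P_def by auto
      next
        case False
        then have "u < v" "v < w" using * by auto
        then show ?thesis using * uw unfolding P_def by (intro q_trans[of u v w]) auto
      qed
    qed
  next
    fix x assume x: "a \<le> x" "x \<le> b"
    have "eventually (\<lambda>s. q x s \<in> C) (at x within {a..b})"
      using topological_tendstoD[OF d[OF x, unfolded has_curve_deriv_def] C(2) C(1)[OF x]]
      by (simp only: q_def)
    then obtain \<delta> where \<delta>: "\<delta> > 0"
      "\<And>s. a \<le> s \<Longrightarrow> s \<le> b \<Longrightarrow> s \<noteq> x \<Longrightarrow> dist s x < \<delta> \<Longrightarrow> q x s \<in> C"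
      unfolding eventually_at by auto
    have "P u v" if *: "u \<le> x" "x \<le> v" "v - u < \<delta>" for u v
      unfolding P_def
    proof (intro impI)
      assume uv: "a \<le> u \<and> u < v \<and> v \<le> b"
      have 1: "q x v \<in> C" if "x < v"
        using \<delta>(2)[of v] uv * that by (auto simp: dist_real_def)
      have 2: "q u x \<in> C" if "u < x"
        using \<delta>(2)[of u] uv * that q_sym[of u x] by (auto simp: dist_real_def)
      show "q u v \<in> C"
      proof (cases "u = x \<or> x = v")
        case True
        then show ?thesis using 1 2 uv by auto
      next
        case False
        then show ?thesis using 1 2 * by (intro q_trans[of u x v]) auto
      qed
    qed
    then show "\<exists>d>0. \<forall>u v. u \<le> x \<and> x \<le> v \<and> v - u < d \<longrightarrow> P u v"
      using \<delta>(1) by blast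
  qed
  then show ?thesis unfolding P_def q_def using assms(1) by simp
qed

text \<open>The form needed for difference quotients: for c(s) = f(x + s (r v)) the derivative
  carries a factor r, which may be negative and tends to 0, and dividing by it leaves a mean of
  derivatives of f.\<close>

lemma mean_value_scaled:
  fixes c :: "real \<Rightarrow> 'f::locally_convex"
  assumes "r \<noteq> 0" and d: "\<And>t. 0 \<le> t \<Longrightarrow> t \<le> 1 \<Longrightarrow> has_curve_deriv c (r *\<^sub>R k t) t {0..1}"
    and C: "\<And>t. 0 \<le> t \<Longrightarrow> t \<le> 1 \<Longrightarrow> k t \<in> C" "open C" "convex C"
  shows "(c 1 - c 0) /\<^sub>R r \<in> C"
proof -
  have "((\<lambda>s. inverse r *\<^sub>R c s) 1 - (\<lambda>s. inverse r *\<^sub>R c s) 0) /\<^sub>R (1 - 0) \<in> C"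
  proof (rule mean_value_quotient)
    show "has_curve_deriv (\<lambda>s. inverse r *\<^sub>R c s) (k t) t {0..1}" if "0 \<le> t" "t \<le> 1" for t
      using has_curve_deriv_scaleR[OF d[OF that], of "inverse r"] assms(1) by simp
  qed (use C in auto)
  then show ?thesis by (simp add: scaleR_diff_right)
qed

lemma open_pair_elim:
  assumes "open S" "(a, b) \<in> S"
  obtains A B where "open A" "open B" "a \<in> A" "b \<in> B"
    "\<forall>x\<in>A. \<forall>y\<in>B. (x, y) \<in> S"
proof -
  from assms obtain A B where "open A" "open B" "(a, b) \<in> A \<times> B" "A \<times> B \<subseteq> S"
    by (rule open_prod_elim)
  then show ?thesis by (intro that[of A B]) auto
qed

text \<open>Continuity of (y, w, s) -> y + s w at (x, v, 0). It keeps whole short segments inside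
  \<open>N\<close> even though base point and direction vary.\<close>

lemma segment_neighbourhood:
  fixes x v :: "'e::locally_convex"
  assumes "open N" "x \<in> N"
  obtains X V e where "open X" "x \<in> X" "open V" "v \<in> V" "e > 0"
    "\<And>y w s. y \<in> X \<Longrightarrow> w \<in> V \<Longrightarrow> \<bar>s\<bar> < e \<Longrightarrow> y + s *\<^sub>R w \<in> N"
proof -
  let ?f = "\<lambda>(y, w, s::real). y + s *\<^sub>R (w::'e)"
  have "continuous_on UNIV ?f"
    unfolding case_prod_beta by (intro continuous_intros)
  then have "open (?f -` N)" using assms by (intro open_vimage) auto
  moreover have "(x, v, 0) \<in> ?f -` N" using assms by simp
  ultimately obtain X Z where XZ: "open X" "open Z" "x \<in> X" "(v, 0) \<in> Z"
    "\<forall>y\<in>X. \<forall>z\<in>Z. (y, z) \<in> ?f -` N"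
    by (rule open_pair_elim)
  from XZ(2,4) obtain V T where VT: "open V" "open T" "v \<in> V" "0 \<in> T"
    "\<forall>w\<in>V. \<forall>s\<in>T. (w, s) \<in> Z"
    by (rule open_pair_elim)
  then obtain e where e: "e > 0" "ball 0 e \<subseteq> T"
    using open_contains_ball by metis
  show ?thesis
  proof
    fix y w and s :: real assume *: "y \<in> X" "w \<in> V" "\<bar>s\<bar> < e"
    then have "s \<in> T" using e(2) by auto
    then have "(y, w, s) \<in> ?f -` N" using XZ(5) VT(5) * by blast
    then show "y + s *\<^sub>R w \<in> N" by simp
  qed (use XZ VT e in auto)
qed

text \<open>Base point, parameter, direction and step all move at once. Additivity of the
  derivative, the chain rule and differentiation under the integral sign are instances. The quotient
  is a mean slope over a short segment, along which joint continuity keeps all derivatives in a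
  given convex neighbourhood of the limit.\<close>

lemma difference_quotient_tendsto:
  fixes \<phi> :: "'e::locally_convex \<Rightarrow> 'p::topological_space \<Rightarrow> 'f::locally_convex"
  assumes U: "open U" "x0 \<in> U" and p0: "p0 \<in> Q"
    and D: "\<And>x p v. x \<in> U \<Longrightarrow> p \<in> Q \<Longrightarrow> has_dir_deriv (\<lambda>y. \<phi> y p) x v (\<phi>' x p v)"
    and cont: "continuous_on (U \<times> Q \<times> UNIV) (\<lambda>(x, p, v). \<phi>' x p v)"
    and lims: "(x \<longlongrightarrow> x0) F" "(p \<longlongrightarrow> p0) F" "eventually (\<lambda>i. p i \<in> Q) F" "(v \<longlongrightarrow> v0) F"
      "(t \<longlongrightarrow> 0) F" "eventually (\<lambda>i. t i \<noteq> 0) F"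
  shows "((\<lambda>i. (\<phi> (x i + t i *\<^sub>R v i) (p i) - \<phi> (x i) (p i)) /\<^sub>R t i) \<longlongrightarrow> \<phi>' x0 p0 v0) F"
proof (rule tendsto_convexI)
  fix C assume C: "open C" "convex C" "\<phi>' x0 p0 v0 \<in> C"
  have "(x0, p0, v0) \<in> U \<times> Q \<times> UNIV" using U p0 by simp
  with cont C obtain A where A: "open A" "(x0, p0, v0) \<in> A"
    "\<And>x p v. (x, p, v) \<in> A \<Longrightarrow> x \<in> U \<Longrightarrow> p \<in> Q \<Longrightarrow> \<phi>' x p v \<in> C"
    unfolding continuous_on_topological
    by (smt (verit) UNIV_I case_prod_conv mem_Sigma_iff)
  from A(1,2) obtain A1 A2 where A12: "open A1" "open A2" "x0 \<in> A1" "(p0, v0) \<in> A2"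
    "\<forall>x\<in>A1. \<forall>q\<in>A2. (x, q) \<in> A"
    by (rule open_pair_elim)
  from A12(2,4) obtain P V where PV: "open P" "open V" "p0 \<in> P" "v0 \<in> V"
    "\<forall>p\<in>P. \<forall>v\<in>V. (p, v) \<in> A2"
    by (rule open_pair_elim)
  obtain X V' e where S: "open X" "x0 \<in> X" "open V'" "v0 \<in> V'" "e > 0"
    "\<And>y w s. y \<in> X \<Longrightarrow> w \<in> V' \<Longrightarrow> \<bar>s\<bar> < e \<Longrightarrow> y + s *\<^sub>R w \<in> A1 \<inter> U"
    using segment_neighbourhood[of "A1 \<inter> U" x0 v0] A12 U by (auto simp: open_Int)
  have "v0 \<in> V \<inter> V'" "open (V \<inter> V')" using S PV by auto
  then have "eventually (\<lambda>i. x i \<in> X) F" "eventually (\<lambda>i. p i \<in> P) F"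
    "eventually (\<lambda>i. v i \<in> V \<inter> V') F" "eventually (\<lambda>i. \<bar>t i\<bar> < e) F"
    using topological_tendstoD[OF lims(1) S(1,2)] topological_tendstoD[OF lims(2) PV(1,3)]
      topological_tendstoD[OF lims(4)] order_tendstoD(2)[OF tendsto_rabs_zero[OF lims(5)] S(5)]
    by blast+
  then show "eventually (\<lambda>i. (\<phi> (x i + t i *\<^sub>R v i) (p i) - \<phi> (x i) (p i)) /\<^sub>R t i \<in> C) F"
    using lims(3,6)
  proof eventually_elim
    case (elim i)
    let ?c = "\<lambda>s. \<phi> (x i + s *\<^sub>R (t i *\<^sub>R v i)) (p i)"
    have in1: "x i + s *\<^sub>R (t i *\<^sub>R v i) \<in> A1 \<inter> U" if "0 \<le> s" "s \<le> 1" for s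
    proof -
      have "\<bar>s * t i\<bar> \<le> \<bar>t i\<bar>" using that by (simp add: abs_mult mult_left_le_one_le)
      then show ?thesis using S(6)[of "x i" "v i" "s * t i"] elim by simp
    qed
    have "(?c 1 - ?c 0) /\<^sub>R t i \<in> C"
    proof (rule mean_value_scaled)
      fix s :: real assume s: "0 \<le> s" "s \<le> 1"
      show "\<phi>' (x i + s *\<^sub>R (t i *\<^sub>R v i)) (p i) (v i) \<in> C"
        using A(3) A12 PV in1[OF s] elim by blast
      show "has_curve_deriv ?c (t i *\<^sub>R \<phi>' (x i + s *\<^sub>R (t i *\<^sub>R v i)) (p i) (v i)) s {0..1}"
        using in1[OF s] elim
        by (intro has_curve_deriv_along_line has_dir_deriv_scale_dir D) auto
    qed (use elim C in auto)
    then show ?case by simp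
  qed
qed

section \<open>Calculus of smooth maps\<close>

lemma tendsto_funI:
  fixes l :: "'i \<Rightarrow> 'b::topological_space"
  assumes "\<And>i. ((\<lambda>s. w s i) \<longlongrightarrow> l i) F"
  shows "(w \<longlongrightarrow> l) F"
  using assms unfolding limitin_canonical_iff[symmetric] euclidean_product_topology[symmetric]
  by (simp add: limitin_componentwise)

lemma has_curve_deriv_tendsto:
  assumes "has_curve_deriv c l t S"
  shows "(c \<longlongrightarrow> c t) (at t within S)"
proof -
  have "((\<lambda>s. (s - t) *\<^sub>R ((c s - c t) /\<^sub>R (s - t)) + c t) \<longlongrightarrow> (t - t) *\<^sub>R l + c t) (at t within S)"
    using assms unfolding has_curve_deriv_def by (intro tendsto_intros)
  then have "((\<lambda>s. (s - t) *\<^sub>R ((c s - c t) /\<^sub>R (s - t)) + c t) \<longlongrightarrow> c t) (at t within S)" by simp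
  then show ?thesis
    by (rule Lim_transform_eventually) (auto simp: eventually_at_filter)
qed

lemma C1_difference_quotient_tendsto:
  fixes f :: "'e::locally_convex \<Rightarrow> 'f::locally_convex"
  assumes "open U" "x0 \<in> U"
    and D: "\<And>x v. x \<in> U \<Longrightarrow> has_dir_deriv f x v (f' x v)"
    and cont: "continuous_on (U \<times> UNIV) (\<lambda>(x, v). f' x v)"
    and lims: "(x \<longlongrightarrow> x0) F" "(v \<longlongrightarrow> v0) F" "(t \<longlongrightarrow> 0) F" "eventually (\<lambda>i. t i \<noteq> 0) F"
  shows "((\<lambda>i. (f (x i + t i *\<^sub>R v i) - f (x i)) /\<^sub>R t i) \<longlongrightarrow> f' x0 v0) F"
proof (rule difference_quotient_tendsto[where Q = "UNIV :: real set" and p = "\<lambda>_. 0" and ?p0.0 = 0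
      and \<phi> = "\<lambda>x p. f x" and \<phi>' = "\<lambda>x p v. f' x v"])
  have "continuous_on (U \<times> UNIV \<times> UNIV) (\<lambda>z. (\<lambda>(x, v). f' x v) (fst z, snd (snd z)))"
    by (rule continuous_on_compose2[OF cont]) (auto intro!: continuous_intros)
  then show "continuous_on (U \<times> (UNIV :: real set) \<times> UNIV) (\<lambda>(x, p, v). f' x v)"
    by (simp add: case_prod_beta)
qed (use assms in auto)

text \<open>The increment along v + w is the increment along v followed by one along w from the
  moving base point x + t v, whose quotient still converges to the derivative at x.\<close>

lemma C1_deriv_add:
  fixes f :: "'e::locally_convex \<Rightarrow> 'f::locally_convex"
  assumes "open U" "x \<in> U"
    and D: "\<And>x v. x \<in> U \<Longrightarrow> has_dir_deriv f x v (f' x v)"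
    and cont: "continuous_on (U \<times> UNIV) (\<lambda>(x, v). f' x v)"
  shows "f' x (v + w) = f' x v + f' x w"
proof -
  have 1: "((\<lambda>t. (f (x + t *\<^sub>R v + t *\<^sub>R w) - f (x + t *\<^sub>R v)) /\<^sub>R t) \<longlongrightarrow> f' x w) (at 0)"
  proof (rule C1_difference_quotient_tendsto[OF assms(1,2) D cont])
    have "((\<lambda>t. x + t *\<^sub>R v) \<longlongrightarrow> x + 0 *\<^sub>R v) (at 0)" by (intro tendsto_intros)
    then show "((\<lambda>t. x + t *\<^sub>R v) \<longlongrightarrow> x) (at 0)" by simp
    show "eventually (\<lambda>t::real. t \<noteq> 0) (at 0)" by (simp add: eventually_at_filter)
  qed (auto intro: tendsto_intros)
  have 2: "((\<lambda>t. (f (x + t *\<^sub>R v) - f x) /\<^sub>R t) \<longlongrightarrow> f' x v) (at 0)"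
    using D[OF assms(2)] by (simp add: has_dir_deriv_tendsto)
  have "((\<lambda>t. (f (x + t *\<^sub>R (v + w)) - f x) /\<^sub>R t) \<longlongrightarrow> f' x v + f' x w) (at 0)"
    using tendsto_add[OF 2 1] by (simp add: scaleR_add_right[symmetric] add.assoc)
  then show ?thesis
    using D[OF assms(2), of "v + w"] by (auto simp: has_dir_deriv_tendsto intro: tendsto_unique[OF trivial_limit_at])
qed

text \<open>Writing \<gamma>(s) as \<gamma>(t) + (s - t) q(s), with q(s) the slope of the curve,
  turns the quotient of the composite into one with a convergent direction; no remainder term
  appears.\<close>

lemma C1_curve_compose:
  fixes f :: "'e::locally_convex \<Rightarrow> 'f::locally_convex"
  assumes "open U" "\<gamma> t \<in> U"
    and D: "\<And>x v. x \<in> U \<Longrightarrow> has_dir_deriv f x v (f' x v)"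
    and cont: "continuous_on (U \<times> UNIV) (\<lambda>(x, v). f' x v)"
    and \<gamma>: "has_curve_deriv \<gamma> l t S"
  shows "has_curve_deriv (\<lambda>s. f (\<gamma> s)) (f' (\<gamma> t) l) t S"
proof -
  have "((\<lambda>s. (f (\<gamma> t + (s - t) *\<^sub>R ((\<gamma> s - \<gamma> t) /\<^sub>R (s - t))) - f (\<gamma> t)) /\<^sub>R (s - t)) \<longlongrightarrow> f' (\<gamma> t) l)
     (at t within S)"
  proof (rule C1_difference_quotient_tendsto[OF assms(1,2) D cont])
    have "((\<lambda>s. s - t) \<longlongrightarrow> t - t) (at t within S)" by (intro tendsto_intros)
    then show "((\<lambda>s. s - t) \<longlongrightarrow> 0) (at t within S)" by simp
    show "eventually (\<lambda>s. s - t \<noteq> 0) (at t within S)" by (simp add: eventually_at_filter)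
  qed (use \<gamma> in \<open>auto simp: has_curve_deriv_def\<close>)
  then show ?thesis unfolding has_curve_deriv_def
    by (rule Lim_transform_eventually) (auto simp: eventually_at_filter)
qed

subsection \<open>Iterated derivatives\<close>

lemma iter_deriv_cong_dirs:
  "(\<And>i. i < n \<Longrightarrow> h i = k i) \<Longrightarrow> iter_deriv n f x h = iter_deriv n f x k"
proof (induction n arbitrary: x)
  case (Suc n)
  have "iter_deriv n f y h = iter_deriv n f y k" for y
    by (rule Suc.IH) (simp add: Suc.prems)
  then show ?case using Suc.prems[of n] by simp
qed simp

lemma smooth_on_iter_deriv:
  "smooth_on U f \<Longrightarrow> x \<in> U \<Longrightarrow>
    has_dir_deriv (\<lambda>y. iter_deriv n f y h) x (h n) (iter_deriv (Suc n) f x h)"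
  unfolding smooth_on_def by (auto intro: has_dir_deriv_dir_deriv)

lemma smooth_on_iter_deriv_upd:
  assumes "smooth_on U f" "x \<in> U"
  shows "has_dir_deriv (\<lambda>y. iter_deriv n f y h) x v (iter_deriv (Suc n) f x (h(n := v)))"
proof -
  have "iter_deriv n f y (h(n := v)) = iter_deriv n f y h" for y
    by (rule iter_deriv_cong_dirs) simp
  then show ?thesis using smooth_on_iter_deriv[OF assms, of n "h(n := v)"] by simp
qed

lemma smooth_on_continuous_iter_deriv:
  "smooth_on U f \<Longrightarrow> continuous_on (U \<times> UNIV) (\<lambda>(x, h). iter_deriv n f x h)"
  unfolding smooth_on_def by blast

lemma continuous_on_iter_deriv:
  assumes "smooth_on U f" "continuous_on S y" "y ` S \<subseteq> U" "\<And>i. continuous_on S (\<lambda>s. w s i)"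
  shows "continuous_on S (\<lambda>s. iter_deriv n f (y s) (w s))"
proof -
  have "continuous_on S (\<lambda>s. (\<lambda>(x, h). iter_deriv n f x h) (y s, w s))"
    by (rule continuous_on_compose2[OF smooth_on_continuous_iter_deriv[OF assms(1)]])
      (use assms in \<open>auto intro!: continuous_on_Pair continuous_on_coordinatewise_then_product\<close>)
  then show ?thesis by simp
qed

lemma tendsto_iter_deriv:
  assumes "open U" "smooth_on U f" "y0 \<in> U" "(y \<longlongrightarrow> y0) F" "\<And>i. ((\<lambda>s. w s i) \<longlongrightarrow> w0 i) F"
  shows "((\<lambda>s. iter_deriv n f (y s) (w s)) \<longlongrightarrow> iter_deriv n f y0 w0) F"
proof -
  have "eventually (\<lambda>s. (y s, w s) \<in> U \<times> UNIV) F"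
    using topological_tendstoD[OF assms(4,1,3)] by simp
  from continuous_on_tendsto_compose[OF smooth_on_continuous_iter_deriv[OF assms(2)]
      tendsto_Pair[OF assms(4) tendsto_funI[OF assms(5)]] _ this] assms(3)
  show ?thesis by simp
qed

lemma smooth_on_imp_continuous_on: "smooth_on U f \<Longrightarrow> continuous_on U f"
  using continuous_on_iter_deriv[of U f U id "\<lambda>_ _. 0" 0] by (simp add: continuous_on_const)

lemma smooth_on_has_dir_deriv:
  "smooth_on U f \<Longrightarrow> x \<in> U \<Longrightarrow> has_dir_deriv f x v (dir_deriv f x v)"
  using smooth_on_iter_deriv[of U f x 0 "\<lambda>_. v"] by simp

lemma continuous_on_dir_deriv:
  assumes "smooth_on U f"
  shows "continuous_on (U \<times> UNIV) (\<lambda>(x, v). dir_deriv f x v)"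
proof -
  have "continuous_on (U \<times> UNIV) (\<lambda>z. iter_deriv 1 f (fst z) (\<lambda>_. snd z))"
    by (rule continuous_on_iter_deriv[OF assms]) (auto intro!: continuous_intros)
  then show ?thesis by (simp add: case_prod_beta)
qed

text \<open>For the direction used last this is additivity of a C^1 derivative. For earlier
  directions the identity already holds at lower order on the open set \<open>U\<close>, so it may
  be differentiated.\<close>

lemma iter_deriv_upd_linear:
  assumes "open U" "smooth_on U f" "x \<in> U" "i < n"
  shows "iter_deriv n f x (h(i := a *\<^sub>R v + b *\<^sub>R w)) =
    a *\<^sub>R iter_deriv n f x (h(i := v)) + b *\<^sub>R iter_deriv n f x (h(i := w))"
  using assms(3,4)
proof (induction n arbitrary: x)
  case (Suc n)
  let ?F = "\<lambda>h y. iter_deriv n f y h"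
  show ?case
  proof (cases "i = n")
    case True
    let ?f' = "\<lambda>x v. iter_deriv (Suc n) f x (h(n := v))"
    have D: "has_dir_deriv (?F h) y v (?f' y v)" if "y \<in> U" for y v
      using smooth_on_iter_deriv_upd[OF assms(2) that] .
    have cont: "continuous_on (U \<times> UNIV) (\<lambda>(x, v). ?f' x v)"
      unfolding case_prod_beta
    proof (rule continuous_on_iter_deriv[OF assms(2)])
      show "continuous_on (U \<times> UNIV) (\<lambda>z. (h(n := snd z)) j)" for j
        by (cases "j = n") (auto intro!: continuous_intros)
    qed (auto intro!: continuous_intros)
    have scale: "?f' x (r *\<^sub>R v) = r *\<^sub>R ?f' x v" for r v
      using has_dir_deriv_scale_dir[OF D[OF Suc.prems(1), of v], of r] D[OF Suc.prems(1), of "r *\<^sub>R v"]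
      by (rule has_dir_deriv_unique[symmetric])
    have "?f' x (a *\<^sub>R v + b *\<^sub>R w) = ?f' x (a *\<^sub>R v) + ?f' x (b *\<^sub>R w)"
      by (rule C1_deriv_add[OF assms(1) Suc.prems(1) D cont])
    then show ?thesis using True scale by presburger
  next
    case False
    then have i: "i < n" using Suc.prems by simp
    have *: "has_dir_deriv (?F (h(i := u))) x (h n) (iter_deriv (Suc n) f x (h(i := u)))" for u
      using smooth_on_iter_deriv[OF assms(2) Suc.prems(1), of n "h(i := u)"] i by simp
    have "has_dir_deriv (?F (h(i := a *\<^sub>R v + b *\<^sub>R w))) x (h n)
      (a *\<^sub>R iter_deriv (Suc n) f x (h(i := v)) + b *\<^sub>R iter_deriv (Suc n) f x (h(i := w)))"
      by (rule has_dir_deriv_cong[OF has_dir_deriv_add[OF has_dir_deriv_scaleR[OF *[of v]] has_dir_deriv_scaleR[OF *[of w]]] assms(1) Suc.prems(1)])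
        (simp only: Suc.IH[OF _ i])
    then show ?thesis by (rule has_dir_deriv_unique[OF *])
  qed
qed simp

text \<open>The product rule for a base point and directions that all move: one term of order k + 1
  from the base point and one term for each direction. The increment is split into moving the base
  point with directions w(s), and then changing the directions at the fixed base point.\<close>

lemma has_curve_deriv_iter_deriv:
  assumes "open V" "smooth_on V g" "y t \<in> V" and y: "has_curve_deriv y y' t S"
    and w: "\<And>i. has_curve_deriv (\<lambda>s. w s i) (w' i) t S"
  shows "has_curve_deriv (\<lambda>s. iter_deriv k g (y s) (w s))
    (iter_deriv (Suc k) g (y t) ((w t)(k := y')) + (\<Sum>i<k. iter_deriv k g (y t) ((w t)(i := w' i)))) t S"
proof -
  let ?\<phi> = "\<lambda>y w. iter_deriv k g y w"
  let ?F = "at t within S"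
  have ne: "eventually (\<lambda>s. s - t \<noteq> 0) ?F" by (simp add: eventually_at_filter)
  have wt: "((\<lambda>s. w s i) \<longlongrightarrow> w t i) ?F" for i using has_curve_deriv_tendsto[OF w] .
  have "((\<lambda>s. (?\<phi> (y t + (s - t) *\<^sub>R ((y s - y t) /\<^sub>R (s - t))) (w s) - ?\<phi> (y t) (w s)) /\<^sub>R (s - t))
    \<longlongrightarrow> iter_deriv (Suc k) g (y t) ((w t)(k := y'))) ?F"
  proof (rule difference_quotient_tendsto[OF assms(1,3), where Q = UNIV
        and \<phi>' = "\<lambda>x w v. iter_deriv (Suc k) g x (w(k := v))"])
    show "has_dir_deriv (\<lambda>y. ?\<phi> y p) x v (iter_deriv (Suc k) g x (p(k := v)))" if "x \<in> V" for x p v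
      by (rule smooth_on_iter_deriv_upd[OF assms(2) that])
    have "continuous_on (V \<times> UNIV \<times> UNIV)
      (\<lambda>z. iter_deriv (Suc k) g (fst z) ((fst (snd z))(k := snd (snd z))))"
    proof (rule continuous_on_iter_deriv[OF assms(2)])
      have "continuous_on (V \<times> UNIV \<times> UNIV) (\<lambda>s. fst (snd s) i)" for i
        by (rule continuous_on_product_then_coordinatewise) (intro continuous_intros)
      then show "continuous_on (V \<times> UNIV \<times> UNIV) (\<lambda>s. ((fst (snd s))(k := snd (snd s))) i)" for i
        by (cases "i = k") (auto intro!: continuous_intros)
    qed (auto intro!: continuous_intros)
    then show "continuous_on (V \<times> UNIV \<times> UNIV) (\<lambda>(x, p, v). iter_deriv (Suc k) g x (p(k := v)))"
      unfolding case_prod_beta .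
    have "((\<lambda>s. s - t) \<longlongrightarrow> t - t) (at t within S)" by (intro tendsto_intros)
    then show "((\<lambda>s. s - t) \<longlongrightarrow> 0) (at t within S)" by simp
  qed (use ne wt y in \<open>auto simp: has_curve_deriv_def intro: tendsto_funI\<close>)
  then have 1: "((\<lambda>s. (?\<phi> (y s) (w s) - ?\<phi> (y t) (w s)) /\<^sub>R (s - t))
    \<longlongrightarrow> iter_deriv (Suc k) g (y t) ((w t)(k := y'))) ?F"
    by (rule Lim_transform_eventually) (use ne in \<open>auto elim!: eventually_mono\<close>)
  \<comment> \<open>Directions below j are taken at time s, the others at time t. Consecutive
    hybrids differ in one slot, so by multilinearity each summand of the telescoping sum, divided by
    s - t, is again an iterated derivative.\<close>
  define hyb where "hyb j s i = (if i < j then w s i else w t i)" for j s i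
  have telescope: "?\<phi> (y t) (w s) - ?\<phi> (y t) (w t) =
    (\<Sum>j<k. ?\<phi> (y t) (hyb (Suc j) s) - ?\<phi> (y t) (hyb j s))" for s
  proof -
    have "?\<phi> (y t) (hyb k s) = ?\<phi> (y t) (w s)"
      by (rule iter_deriv_cong_dirs) (simp add: hyb_def)
    moreover have "hyb 0 s = w t" by (simp add: hyb_def fun_eq_iff)
    ultimately show ?thesis
      using sum_lessThan_telescope[of "\<lambda>j. ?\<phi> (y t) (hyb j s)" k] by simp
  qed
  have step: "(?\<phi> (y t) (hyb (Suc j) s) - ?\<phi> (y t) (hyb j s)) /\<^sub>R (s - t) =
    ?\<phi> (y t) ((hyb j s)(j := (w s j - w t j) /\<^sub>R (s - t)))" if "j < k" for j s
  proof -
    have a: "hyb (Suc j) s = (hyb j s)(j := w s j)" and b: "hyb j s = (hyb j s)(j := w t j)"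
      by (auto simp: hyb_def fun_eq_iff)
    have c: "(w s j - w t j) /\<^sub>R (s - t) = inverse (s - t) *\<^sub>R w s j + (- inverse (s - t)) *\<^sub>R w t j"
      by (simp add: scaleR_diff_right)
    have "?\<phi> (y t) ((hyb j s)(j := (w s j - w t j) /\<^sub>R (s - t))) =
      inverse (s - t) *\<^sub>R ?\<phi> (y t) (hyb (Suc j) s) + (- inverse (s - t)) *\<^sub>R ?\<phi> (y t) (hyb j s)"
      unfolding c iter_deriv_upd_linear[OF assms(1,2,3) that] a[symmetric] b[symmetric] ..
    then show ?thesis by (simp add: scaleR_diff_right)
  qed
  have "((\<lambda>s. \<Sum>j<k. ?\<phi> (y t) ((hyb j s)(j := (w s j - w t j) /\<^sub>R (s - t)))) \<longlongrightarrow>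
    (\<Sum>j<k. ?\<phi> (y t) ((w t)(j := w' j)))) ?F"
  proof (intro tendsto_sum tendsto_iter_deriv[OF assms(1,2,3)] tendsto_const)
    fix j i
    show "((\<lambda>s. ((hyb j s)(j := (w s j - w t j) /\<^sub>R (s - t))) i) \<longlongrightarrow> ((w t)(j := w' j)) i) ?F"
      using w[of j] wt[of i] by (cases "i = j"; cases "i < j") (simp_all add: hyb_def has_curve_deriv_def)
  qed
  then have 2: "((\<lambda>s. (?\<phi> (y t) (w s) - ?\<phi> (y t) (w t)) /\<^sub>R (s - t)) \<longlongrightarrow>
    (\<Sum>j<k. ?\<phi> (y t) ((w t)(j := w' j)))) ?F"
    unfolding telescope scaleR_sum_right by (simp add: step)
  show ?thesis
    using tendsto_add[OF 1 2] unfolding has_curve_deriv_def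
    by (simp add: scaleR_add_right[symmetric])
qed

subsection \<open>Smooth maps form a category\<close>

lemma has_dir_deriv_iter_deriv:
  assumes "open V" "smooth_on V g" "y x \<in> V" "has_dir_deriv y x v y'"
    and "\<And>i. has_dir_deriv (\<lambda>z. w z i) x v (w' i)"
  shows "has_dir_deriv (\<lambda>z. iter_deriv k g (y z) (w z)) x v
    (iter_deriv (Suc k) g (y x) ((w x)(k := y')) + (\<Sum>i<k. iter_deriv k g (y x) ((w x)(i := w' i))))"
  using has_curve_deriv_iter_deriv[OF assms(1,2), of "\<lambda>s. y (x + s *\<^sub>R v)" 0 y' UNIV
      "\<lambda>s. w (x + s *\<^sub>R v)" w' k] assms(3-5)
  by (simp add: has_dir_deriv_def)

text \<open>Product and chain rules return sums of terms of the family rather than members of it.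
  Nonempty finite sums are enough, since every derivative computed below has at least one
  term.\<close>

inductive_set add_closure :: "('e \<Rightarrow> 'h \<Rightarrow> 'f::plus) set \<Rightarrow> ('e \<Rightarrow> 'h \<Rightarrow> 'f) set" for T where
  base: "\<phi> \<in> T \<Longrightarrow> \<phi> \<in> add_closure T"
| add: "\<phi> \<in> add_closure T \<Longrightarrow> \<psi> \<in> add_closure T \<Longrightarrow> (\<lambda>x h. \<phi> x h + \<psi> x h) \<in> add_closure T"

lemma add_closure_sum:
  fixes \<phi> :: "'e \<Rightarrow> 'h \<Rightarrow> 'f::comm_monoid_add" and k :: nat
  assumes "\<phi> \<in> T" "\<And>i. i < k \<Longrightarrow> \<tau> i \<in> T"
  shows "(\<lambda>x h. \<phi> x h + (\<Sum>i<k. \<tau> i x h)) \<in> add_closure T"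
  using assms(2)
proof (induction k)
  case 0
  then show ?case using assms(1) by (simp add: add_closure.base)
next
  case (Suc k)
  then have "(\<lambda>x h. \<phi> x h + (\<Sum>i<k. \<tau> i x h)) \<in> add_closure T" "\<tau> k \<in> add_closure T"
    by (auto intro: add_closure.base)
  from add_closure.add[OF this] show ?case by (simp add: add.assoc)
qed

text \<open>
  Coinduction replaces an induction over iterated tangent maps, whose types change at every step.
\<close>

lemma smooth_onI_add_closure:
  fixes f :: "'e::locally_convex \<Rightarrow> 'f::locally_convex" and T :: "('e \<Rightarrow> (nat \<Rightarrow> 'e) \<Rightarrow> 'f) set"
  assumes U: "open U" and f0: "\<phi>0 \<in> T" "\<And>x h. x \<in> U \<Longrightarrow> \<phi>0 x h = f x"
    and cont: "\<And>\<phi>. \<phi> \<in> T \<Longrightarrow> continuous_on (U \<times> UNIV) (\<lambda>(x, h). \<phi> x h)"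
    and deriv: "\<And>\<phi> n. \<phi> \<in> T \<Longrightarrow>
      \<exists>\<psi>\<in>add_closure T. \<forall>x\<in>U. \<forall>h. has_dir_deriv (\<lambda>y. \<phi> y h) x (h n) (\<psi> x h)"
  shows "smooth_on U f"
proof -
  have cont': "continuous_on (U \<times> UNIV) (\<lambda>(x, h). \<phi> x h)" if "\<phi> \<in> add_closure T" for \<phi>
    using that
  proof induction
    case (add \<phi> \<psi>)
    then show ?case unfolding case_prod_beta by (intro continuous_intros)
  qed (rule cont)
  have deriv': "\<exists>\<psi>\<in>add_closure T. \<forall>x\<in>U. \<forall>h. has_dir_deriv (\<lambda>y. \<phi> y h) x (h n) (\<psi> x h)"
    if "\<phi> \<in> add_closure T" for \<phi> n
    using that
  proof induction
    case (add \<phi> \<phi>')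
    then obtain \<psi> \<psi>' where *: "\<psi> \<in> add_closure T" "\<psi>' \<in> add_closure T"
      "\<forall>x\<in>U. \<forall>h. has_dir_deriv (\<lambda>y. \<phi> y h) x (h n) (\<psi> x h)"
      "\<forall>x\<in>U. \<forall>h. has_dir_deriv (\<lambda>y. \<phi>' y h) x (h n) (\<psi>' x h)" by blast
    show ?case
      by (rule bexI[OF _ add_closure.add[OF *(1,2)]]) (use *(3,4) in \<open>auto intro!: has_dir_deriv_add\<close>)
  qed (rule deriv)
  have ex: "\<exists>\<phi>\<in>add_closure T. \<forall>x\<in>U. \<forall>h. iter_deriv n f x h = \<phi> x h" for n
  proof (induction n)
    case 0
    then show ?case using f0 by (auto intro!: bexI[OF _ add_closure.base[OF f0(1)]])
  next
    case (Suc n)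
    then obtain \<phi> where \<phi>: "\<phi> \<in> add_closure T" "\<And>x h. x \<in> U \<Longrightarrow> iter_deriv n f x h = \<phi> x h" by blast
    then obtain \<psi> where \<psi>: "\<psi> \<in> add_closure T" "\<forall>x\<in>U. \<forall>h. has_dir_deriv (\<lambda>y. \<phi> y h) x (h n) (\<psi> x h)"
      using deriv' by blast
    have "iter_deriv (Suc n) f x h = \<psi> x h" if "x \<in> U" for x h
    proof -
      have "dir_deriv (\<lambda>y. iter_deriv n f y h) x (h n) = dir_deriv (\<lambda>y. \<phi> y h) x (h n)"
        by (rule dir_deriv_cong[OF U that]) (simp add: \<phi>(2))
      then show ?thesis using \<psi>(2) that by (simp add: dir_deriv_eq)
    qed
    then show ?case using \<psi>(1) by blast
  qed
  show ?thesis unfolding smooth_on_def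
  proof (intro allI conjI ballI)
    fix n h x assume x: "x \<in> U"
    obtain \<phi> where \<phi>: "\<phi> \<in> add_closure T" "\<And>x h. x \<in> U \<Longrightarrow> iter_deriv n f x h = \<phi> x h"
      using ex by blast
    then obtain \<psi> where "has_dir_deriv (\<lambda>y. \<phi> y h) x (h n) (\<psi> x h)" using deriv' x by blast
    then have "has_dir_deriv (\<lambda>y. iter_deriv n f y h) x (h n) (\<psi> x h)"
      by (rule has_dir_deriv_cong[OF _ U x]) (simp add: \<phi>(2))
    then show "dir_differentiable (\<lambda>y. iter_deriv n f y h) x (h n)"
      unfolding dir_differentiable_iff by blast
  next
    fix n
    obtain \<phi> where \<phi>: "\<phi> \<in> add_closure T" "\<And>x h. x \<in> U \<Longrightarrow> iter_deriv n f x h = \<phi> x h"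
      using ex by blast
    have "continuous_on (U \<times> UNIV) (\<lambda>(x, h). iter_deriv n f x h) =
      continuous_on (U \<times> UNIV) (\<lambda>(x, h). \<phi> x h)"
      by (rule continuous_on_cong) (auto simp: \<phi>(2))
    then show "continuous_on (U \<times> UNIV) (\<lambda>(x, h). iter_deriv n f x h)" using cont'[OF \<phi>(1)] by simp
  qed
qed

lemma smooth_onI_coinduct:
  fixes f :: "'e::locally_convex \<Rightarrow> 'f::locally_convex" and T :: "('e \<Rightarrow> (nat \<Rightarrow> 'e) \<Rightarrow> 'f) set"
  assumes "open U" "\<phi>0 \<in> T" "\<And>x h. x \<in> U \<Longrightarrow> \<phi>0 x h = f x"
    and "\<And>\<phi>. \<phi> \<in> T \<Longrightarrow> continuous_on (U \<times> UNIV) (\<lambda>(x, h). \<phi> x h)"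
    and "\<And>\<phi> n. \<phi> \<in> T \<Longrightarrow> \<exists>\<psi>\<in>T. \<forall>x\<in>U. \<forall>h. has_dir_deriv (\<lambda>y. \<phi> y h) x (h n) (\<psi> x h)"
  shows "smooth_on U f"
  by (rule smooth_onI_add_closure[OF assms(1-4)]) (use assms(5) add_closure.base in blast)+

lemma continuous_on_snd_apply [continuous_intros]:
  "continuous_on (S :: ('a::topological_space \<times> ('i \<Rightarrow> 'b::topological_space)) set) (\<lambda>z. snd z i)"
  by (rule continuous_on_product_then_coordinatewise) (intro continuous_intros)

lemma smooth_on_const: "open U \<Longrightarrow> smooth_on U (\<lambda>x. a)"
proof (rule smooth_onI_coinduct[where T = "{\<lambda>x h. a, \<lambda>x h. 0}" and ?\<phi>0.0 = "\<lambda>x h. a"])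
  fix \<phi> :: "'a \<Rightarrow> (nat \<Rightarrow> 'a) \<Rightarrow> 'b" and n assume "\<phi> \<in> {\<lambda>x h. a, \<lambda>x h. 0}"
  then show "\<exists>\<psi>\<in>{\<lambda>x h. a, \<lambda>x h. 0}. \<forall>x\<in>U. \<forall>h. has_dir_deriv (\<lambda>y. \<phi> y h) x (h n) (\<psi> x h)"
    by (intro bexI[of _ "\<lambda>x h. 0"]) (auto intro: has_dir_deriv_const)
qed (auto simp: continuous_on_const)

lemma has_dir_deriv_linear:
  assumes "linear l"
  shows "has_dir_deriv l x v (l v)"
  unfolding has_dir_deriv_tendsto
proof (rule Lim_transform_eventually[OF tendsto_const])
  show "eventually (\<lambda>t. l v = (l (x + t *\<^sub>R v) - l x) /\<^sub>R t) (at 0)"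
    using assms by (auto simp: eventually_at_filter linear_add linear_scale)
qed

lemma smooth_on_linear:
  assumes "open U" "linear l" "continuous_on UNIV l"
  shows "smooth_on U l"
proof (rule smooth_onI_coinduct[OF assms(1)])
  let ?T = "{\<lambda>x h. l x, \<lambda>x h. 0} \<union> range (\<lambda>n x h. l (h n))"
  show "(\<lambda>x h. l x) \<in> ?T" by simp
  have [continuous_intros]: "continuous_on S (\<lambda>x. l (g x))" if "continuous_on S g"
    for S and g :: "'c::topological_space \<Rightarrow> 'a"
    by (rule continuous_on_compose2[OF assms(3) that]) simp
  show "continuous_on (U \<times> UNIV) (\<lambda>(x, h). \<phi> x h)" if "\<phi> \<in> ?T" for \<phi>
    using that by (auto simp: case_prod_beta intro!: continuous_intros)
  show "\<exists>\<psi>\<in>?T. \<forall>x\<in>U. \<forall>h. has_dir_deriv (\<lambda>y. \<phi> y h) x (h n) (\<psi> x h)" if "\<phi> \<in> ?T" for \<phi> n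
  proof (cases "\<phi> = (\<lambda>x h. l x)")
    case True
    then show ?thesis
      by (intro bexI[of _ "\<lambda>x h. l (h n)"]) (auto intro: has_dir_deriv_linear[OF assms(2)])
  next
    case False
    then show ?thesis using that
      by (intro bexI[of _ "\<lambda>x h. 0"]) (auto intro: has_dir_deriv_const)
  qed
qed simp

text \<open>The coinduction rule asks for a derivative in direction \<open>h n\<close> for every n,
  whatever the order m of the function at hand. The map \<sigma> records which entry of h fills each
  slot, so that n need not equal m.\<close>

lemma smooth_on_iter_deriv_shift:
  assumes "smooth_on U f" "x \<in> U"
  shows "has_dir_deriv (\<lambda>y. iter_deriv m f y (\<lambda>i. h (\<sigma> i))) x (h n)
    (iter_deriv (Suc m) f x (\<lambda>i. h ((\<sigma>(m := n)) i)))"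
proof -
  have "(\<lambda>i. h ((\<sigma>(m := n)) i)) = (\<lambda>i. h (\<sigma> i))(m := h n)" by auto
  then show ?thesis using smooth_on_iter_deriv_upd[OF assms, of m "\<lambda>i. h (\<sigma> i)" "h n"] by simp
qed

lemma continuous_on_iter_deriv_shift:
  "smooth_on U f \<Longrightarrow> continuous_on (U \<times> UNIV) (\<lambda>(x, h). iter_deriv m f x (\<lambda>i. h (\<sigma> i)))"
  unfolding case_prod_beta by (rule continuous_on_iter_deriv) (auto intro!: continuous_intros)

lemma smooth_on_Pair:
  assumes "open U" "smooth_on U f" "smooth_on U g"
  shows "smooth_on U (\<lambda>x. (f x, g x))"
proof (rule smooth_onI_coinduct[OF assms(1)])
  let ?t = "\<lambda>m \<sigma> x (h :: nat \<Rightarrow> 'a). (iter_deriv m f x (\<lambda>i. h (\<sigma> i)), iter_deriv m g x (\<lambda>i. h (\<sigma> i)))"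
  let ?T = "{?t m \<sigma> | m (\<sigma> :: nat \<Rightarrow> nat). True}"
  show "?t 0 id \<in> ?T" by blast
  show "continuous_on (U \<times> UNIV) (\<lambda>(x, h). \<phi> x h)" if "\<phi> \<in> ?T" for \<phi>
  proof -
    from that obtain m \<sigma> where \<phi>: "\<phi> = ?t m \<sigma>" by blast
    show ?thesis
      using continuous_on_Pair[OF continuous_on_iter_deriv_shift[OF assms(2), of m \<sigma>]
          continuous_on_iter_deriv_shift[OF assms(3), of m \<sigma>]]
      by (simp add: \<phi> case_prod_beta)
  qed
  show "\<exists>\<psi>\<in>?T. \<forall>x\<in>U. \<forall>h. has_dir_deriv (\<lambda>y. \<phi> y h) x (h n) (\<psi> x h)" if "\<phi> \<in> ?T" for \<phi> n
  proof -
    from that obtain m \<sigma> where \<phi>: "\<phi> = ?t m \<sigma>" by blast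
    have "has_dir_deriv (\<lambda>y. \<phi> y h) x (h n) (?t (Suc m) (\<sigma>(m := n)) x h)" if "x \<in> U" for x h
      using tendsto_Pair[OF smooth_on_iter_deriv_shift[OF assms(2) that, of m h \<sigma> n, unfolded has_dir_deriv_tendsto]
          smooth_on_iter_deriv_shift[OF assms(3) that, of m h \<sigma> n, unfolded has_dir_deriv_tendsto]]
      unfolding has_dir_deriv_tendsto \<phi> by simp
    then show ?thesis by (intro bexI[of _ "?t (Suc m) (\<sigma>(m := n))"]) blast+
  qed
qed simp

lemma smooth_on_cong:
  assumes "smooth_on U f" "open U" "\<And>x. x \<in> U \<Longrightarrow> f x = g x"
  shows "smooth_on U g"
proof (rule smooth_onI_coinduct[OF assms(2)])
  let ?t = "\<lambda>m \<sigma> x (h :: nat \<Rightarrow> 'a). iter_deriv m f x (\<lambda>i. h (\<sigma> i))"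
  let ?T = "{?t m \<sigma> | m (\<sigma> :: nat \<Rightarrow> nat). True}"
  show "?t 0 id \<in> ?T" by blast
  show "continuous_on (U \<times> UNIV) (\<lambda>(x, h). \<phi> x h)" if "\<phi> \<in> ?T" for \<phi>
    using that continuous_on_iter_deriv_shift[OF assms(1)] by blast
  show "\<exists>\<psi>\<in>?T. \<forall>x\<in>U. \<forall>h. has_dir_deriv (\<lambda>y. \<phi> y h) x (h n) (\<psi> x h)" if "\<phi> \<in> ?T" for \<phi> n
  proof -
    from that obtain m \<sigma> where \<phi>: "\<phi> = ?t m \<sigma>" by blast
    show ?thesis
    proof (rule bexI)
      show "?t (Suc m) (\<sigma>(m := n)) \<in> ?T" by blast
      show "\<forall>x\<in>U. \<forall>h. has_dir_deriv (\<lambda>y. \<phi> y h) x (h n) (?t (Suc m) (\<sigma>(m := n)) x h)"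
        unfolding \<phi> by (intro ballI allI smooth_on_iter_deriv_shift[OF assms(1)])
    qed
  qed
qed (use assms in simp)

lemma smooth_on_subset: "smooth_on U f \<Longrightarrow> N \<subseteq> U \<Longrightarrow> smooth_on N f"
  unfolding smooth_on_def by (meson Sigma_mono continuous_on_subset order_refl subsetD)

lemma smooth_on_local:
  assumes "\<And>x. x \<in> U \<Longrightarrow> \<exists>N. open N \<and> x \<in> N \<and> smooth_on N f"
  shows "smooth_on U f"
  unfolding smooth_on_def
proof (intro allI conjI ballI)
  fix n x h assume "x \<in> U"
  then show "dir_differentiable (\<lambda>y. iter_deriv n f y h) x (h n)"
    using assms unfolding smooth_on_def by blast
next
  fix n
  let ?S = "{N. open N \<and> smooth_on N f}"
  have "continuous_on (\<Union>N\<in>?S. N \<times> UNIV) (\<lambda>(x, h). iter_deriv n f x h)"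
    by (rule continuous_on_open_UN) (auto intro: open_Times smooth_on_continuous_iter_deriv)
  then show "continuous_on (U \<times> UNIV) (\<lambda>(x, h). iter_deriv n f x h)"
    by (rule continuous_on_subset) (use assms in blast)
qed

text \<open>Order k = 0 is smoothness of composites and k = 1 is smoothness of derivatives along a
  varying direction. Treating all orders with varying directions together gives a statement that
  survives differentiation.\<close>

lemma smooth_on_iter_deriv_comp:
  fixes g :: "'f::locally_convex \<Rightarrow> 'g::locally_convex" and y :: "'e::locally_convex \<Rightarrow> 'f"
  assumes U: "open U" and V: "open V" and g: "smooth_on V g" and y: "smooth_on U y" "y ` U \<subseteq> V"
    and w: "\<And>i. smooth_on U (\<lambda>x. w x i)"
  shows "smooth_on U (\<lambda>x. iter_deriv k g (y x) (w x))"
proof -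
  \<comment> \<open>\<open>W\<close> and the set \<open>?T\<close> below are closed under differentiation up to sums, so that no explicit
    formula for the higher derivatives of a composition is needed.\<close>
  define W :: "('e \<Rightarrow> (nat \<Rightarrow> 'e) \<Rightarrow> 'f) set" where
    "W = {\<lambda>x h. iter_deriv m f x (\<lambda>i. h (\<sigma> i)) | m (\<sigma> :: nat \<Rightarrow> nat) f. smooth_on U f}"
  have W_cont: "continuous_on (U \<times> UNIV) (\<lambda>(x, h). u x h)" if "u \<in> W" for u
    using that continuous_on_iter_deriv_shift unfolding W_def by blast
  have W_deriv: "\<exists>u'\<in>W. \<forall>x\<in>U. \<forall>h. has_dir_deriv (\<lambda>y. u y h) x (h n) (u' x h)" if "u \<in> W" for u n
  proof -
    from that obtain m and \<sigma> :: "nat \<Rightarrow> nat" and f where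
      f: "u = (\<lambda>x h. iter_deriv m f x (\<lambda>i. h (\<sigma> i)))" "smooth_on U f"
      unfolding W_def by blast
    show ?thesis
    proof (rule bexI)
      show "(\<lambda>x h. iter_deriv (Suc m) f x (\<lambda>i. h ((\<sigma>(m := n)) i))) \<in> W"
        unfolding W_def using f(2) by blast
      show "\<forall>x\<in>U. \<forall>h. has_dir_deriv (\<lambda>y. u y h) x (h n) (iter_deriv (Suc m) f x (\<lambda>i. h ((\<sigma>(m := n)) i)))"
        unfolding f(1) by (intro ballI allI smooth_on_iter_deriv_shift[OF f(2)])
    qed
  qed
  have W_base: "(\<lambda>x h. f x) \<in> W" if "smooth_on U f" for f
    unfolding W_def using that by (auto intro!: exI[of _ 0])
  let ?t = "\<lambda>k u x h. iter_deriv k g (y x) (\<lambda>i. u i x h)"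
  let ?T = "{?t k u | k u. \<forall>i. u i \<in> W}"
  show ?thesis
  proof (rule smooth_onI_add_closure[OF U, where T = ?T])
    show "?t k (\<lambda>i x h. w x i) \<in> ?T"
      by (intro CollectI exI[of _ k] exI[of _ "\<lambda>i x h. w x i"]) (simp add: W_base[OF w])
    show "continuous_on (U \<times> UNIV) (\<lambda>(x, h). \<phi> x h)" if "\<phi> \<in> ?T" for \<phi>
    proof -
      from that obtain k u where \<phi>: "\<phi> = ?t k u" "\<forall>i. u i \<in> W" by blast
      have "continuous_on (U \<times> UNIV) (\<lambda>z. y (fst z))"
        by (rule continuous_on_compose2[OF smooth_on_imp_continuous_on[OF y(1)]]) (auto intro!: continuous_intros)
      then show ?thesis unfolding \<phi>(1) case_prod_beta
        by (rule continuous_on_iter_deriv[OF g])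
          (use y(2) W_cont \<phi>(2) in \<open>auto simp: case_prod_beta\<close>)
    qed
    show "\<exists>\<psi>\<in>add_closure ?T. \<forall>x\<in>U. \<forall>h. has_dir_deriv (\<lambda>y. \<phi> y h) x (h n) (\<psi> x h)" if "\<phi> \<in> ?T" for \<phi> n
    proof -
      from that obtain k u where \<phi>: "\<phi> = ?t k u" "\<forall>i. u i \<in> W" by blast
      obtain Y where Y: "Y \<in> W" "\<forall>x\<in>U. \<forall>h. has_dir_deriv y x (h n) (Y x h)"
        using W_deriv[OF W_base[OF y(1)], of n] by blast
      have "\<forall>i. \<exists>u'. u' \<in> W \<and> (\<forall>x\<in>U. \<forall>h. has_dir_deriv (\<lambda>y. u i y h) x (h n) (u' x h))"
        using W_deriv \<phi>(2) by blast
      then obtain u' where u': "\<And>i. u' i \<in> W"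
        "\<And>i x h. x \<in> U \<Longrightarrow> has_dir_deriv (\<lambda>y. u i y h) x (h n) (u' i x h)" by metis
      let ?\<psi> = "\<lambda>x h. ?t (Suc k) (u(k := Y)) x h + (\<Sum>j<k. ?t k (u(j := u' j)) x h)"
      have upd: "(\<lambda>i. (u(j := a)) i x h) = (\<lambda>i. u i x h)(j := a x h)" for j a x h by auto
      show ?thesis
      proof (rule bexI)
        show "?\<psi> \<in> add_closure ?T"
        proof (rule add_closure_sum)
          show "?t (Suc k) (u(k := Y)) \<in> ?T"
            by (intro CollectI exI[of _ "Suc k"] exI[of _ "u(k := Y)"] conjI refl) (simp add: \<phi>(2) Y(1))
          show "?t k (u(j := u' j)) \<in> ?T" for j
            by (intro CollectI exI[of _ k] exI[of _ "u(j := u' j)"] conjI refl) (simp add: \<phi>(2) u'(1))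
        qed
        show "\<forall>x\<in>U. \<forall>h. has_dir_deriv (\<lambda>y. \<phi> y h) x (h n) (?\<psi> x h)"
        proof (intro ballI allI)
          fix x h assume x: "x \<in> U"
          then have "y x \<in> V" using y(2) by blast
          show "has_dir_deriv (\<lambda>y. \<phi> y h) x (h n) (?\<psi> x h)" unfolding \<phi>(1) upd
            by (rule has_dir_deriv_iter_deriv[where w = "\<lambda>x i. u i x h" and y = y and x = x, OF V g \<open>y x \<in> V\<close>])
              (use x Y(2) u'(2) in auto)
        qed
      qed
    qed
  qed simp
qed

lemma smooth_on_compose:
  assumes "open U" "open V" "smooth_on V g" "smooth_on U y" "y ` U \<subseteq> V"
  shows "smooth_on U (\<lambda>x. g (y x))"
  using smooth_on_iter_deriv_comp[OF assms, of "\<lambda>x i. y x" 0] assms(4) by simp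

lemma smooth_on_dir_deriv_comp:
  assumes "open U" "open V" "smooth_on V g" "smooth_on U y" "y ` U \<subseteq> V" "smooth_on U v"
  shows "smooth_on U (\<lambda>x. dir_deriv g (y x) (v x))"
  using smooth_on_iter_deriv_comp[OF assms(1-5), of "\<lambda>x i. v x" 1] assms(6) by simp

lemma smooth_on_ident: "open U \<Longrightarrow> smooth_on U (\<lambda>x. x)"
  by (rule smooth_on_linear) (auto intro: continuous_intros linearI)

lemma smooth_on_fst: "open U \<Longrightarrow> smooth_on U fst"
  by (rule smooth_on_linear) (auto intro: continuous_intros linearI)

lemma smooth_on_snd: "open U \<Longrightarrow> smooth_on U snd"
  by (rule smooth_on_linear) (auto intro: continuous_intros linearI)

lemma smooth_on_fst_comp: "open U \<Longrightarrow> smooth_on U f \<Longrightarrow> smooth_on U (\<lambda>x. fst (f x))"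
  by (rule smooth_on_compose[OF _ open_UNIV smooth_on_fst]) auto

lemma smooth_on_snd_comp: "open U \<Longrightarrow> smooth_on U f \<Longrightarrow> smooth_on U (\<lambda>x. snd (f x))"
  by (rule smooth_on_compose[OF _ open_UNIV smooth_on_snd]) auto

lemma smooth_on_add:
  assumes "open U" "smooth_on U f" "smooth_on U g"
  shows "smooth_on U (\<lambda>x. f x + g x)"
proof -
  have "smooth_on UNIV (\<lambda>z. fst z + snd (z :: 'b \<times> 'b))"
    by (rule smooth_on_linear) (auto intro!: continuous_intros linearI simp: algebra_simps)
  from smooth_on_compose[OF assms(1) open_UNIV this smooth_on_Pair[OF assms]] show ?thesis by simp
qed

lemma smooth_on_scaleR_const:
  assumes "open U" "smooth_on U f"
  shows "smooth_on U (\<lambda>x. r *\<^sub>R f x)"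
proof (rule smooth_on_compose[OF assms(1) open_UNIV _ assms(2)])
  show "smooth_on UNIV (\<lambda>x::'b. r *\<^sub>R x)"
    by (rule smooth_on_linear) (auto intro!: continuous_intros linearI simp: algebra_simps)
qed simp

lemma smooth_on_diff:
  assumes "open U" "smooth_on U f" "smooth_on U g"
  shows "smooth_on U (\<lambda>x. f x - g x)"
  using smooth_on_add[OF assms(1,2) smooth_on_scaleR_const[OF assms(1,3), of "- 1"]] by simp

lemma has_curve_deriv_prod_scaleR:
  assumes "has_curve_deriv a a' t S" "has_curve_deriv b b' t S"
  shows "has_curve_deriv (\<lambda>s. a s *\<^sub>R b s) (a' *\<^sub>R b t + a t *\<^sub>R b') t S"
proof -
  have "((\<lambda>s. ((a s - a t) /\<^sub>R (s - t)) *\<^sub>R b s + a t *\<^sub>R ((b s - b t) /\<^sub>R (s - t)))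
    \<longlongrightarrow> a' *\<^sub>R b t + a t *\<^sub>R b') (at t within S)"
    using assms has_curve_deriv_tendsto[OF assms(2)] unfolding has_curve_deriv_def
    by (intro tendsto_intros)
  then show ?thesis unfolding has_curve_deriv_def
    by (simp add: algebra_simps)
qed

lemma has_dir_deriv_prod_scaleR:
  assumes "has_dir_deriv a x v a'" "has_dir_deriv b x v b'"
  shows "has_dir_deriv (\<lambda>y. a y *\<^sub>R b y) x v (a' *\<^sub>R b x + a x *\<^sub>R b')"
  using has_curve_deriv_prod_scaleR[OF assms[unfolded has_dir_deriv_def]]
  by (simp add: has_dir_deriv_def)

lemma smooth_on_scaleR:
  assumes U: "open U" "smooth_on U a" "smooth_on U b"
  shows "smooth_on U (\<lambda>x. a x *\<^sub>R b x)"
proof (rule smooth_onI_add_closure[OF U(1)])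
  let ?t = "\<lambda>m \<sigma> k \<tau> x (h :: nat \<Rightarrow> 'a). iter_deriv m a x (\<lambda>i. h (\<sigma> i)) *\<^sub>R iter_deriv k b x (\<lambda>i. h (\<tau> i))"
  let ?T = "{?t m \<sigma> k \<tau> | m (\<sigma> :: nat \<Rightarrow> nat) k (\<tau> :: nat \<Rightarrow> nat). True}"
  show "?t 0 id 0 id \<in> ?T" by blast
  show "continuous_on (U \<times> UNIV) (\<lambda>(x, h). \<phi> x h)" if "\<phi> \<in> ?T" for \<phi>
  proof -
    from that obtain m \<sigma> k \<tau> where \<phi>: "\<phi> = ?t m \<sigma> k \<tau>" by blast
    show ?thesis
      using continuous_on_scaleR_lc[OF continuous_on_iter_deriv_shift[OF U(2), of m \<sigma>]
          continuous_on_iter_deriv_shift[OF U(3), of k \<tau>]]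
      by (simp add: \<phi> case_prod_beta)
  qed
  show "\<exists>\<psi>\<in>add_closure ?T. \<forall>x\<in>U. \<forall>h. has_dir_deriv (\<lambda>y. \<phi> y h) x (h n) (\<psi> x h)" if "\<phi> \<in> ?T" for \<phi> n
  proof -
    from that obtain m \<sigma> k \<tau> where \<phi>: "\<phi> = ?t m \<sigma> k \<tau>" by blast
    show ?thesis
    proof (rule bexI)
      show "(\<lambda>x h. ?t (Suc m) (\<sigma>(m := n)) k \<tau> x h + ?t m \<sigma> (Suc k) (\<tau>(k := n)) x h) \<in> add_closure ?T"
        by (rule add_closure.add) (rule add_closure.base, blast)+
      show "\<forall>x\<in>U. \<forall>h. has_dir_deriv (\<lambda>y. \<phi> y h) x (h n)
          (?t (Suc m) (\<sigma>(m := n)) k \<tau> x h + ?t m \<sigma> (Suc k) (\<tau>(k := n)) x h)"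
        unfolding \<phi>
        by (intro ballI allI has_dir_deriv_prod_scaleR smooth_on_iter_deriv_shift) (use U in auto)
    qed
  qed
qed simp

subsection \<open>First and second derivatives\<close>

lemma smooth_on_curve_compose:
  assumes "open U" "smooth_on U f" "\<gamma> t \<in> U" "has_curve_deriv \<gamma> l t S"
  shows "has_curve_deriv (\<lambda>s. f (\<gamma> s)) (dir_deriv f (\<gamma> t) l) t S"
  by (rule C1_curve_compose[OF assms(1,3) smooth_on_has_dir_deriv[OF assms(2)]
        continuous_on_dir_deriv[OF assms(2)] assms(4)])

lemma has_dir_deriv_compose:
  assumes "open V" "smooth_on V g" "y x \<in> V" "has_dir_deriv y x v l"
  shows "has_dir_deriv (\<lambda>z. g (y z)) x v (dir_deriv g (y x) l)"
  using smooth_on_curve_compose[OF assms(1,2), of "\<lambda>s. y (x + s *\<^sub>R v)" 0] assms(3,4)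
  by (simp add: has_dir_deriv_def)

lemma dir_deriv_compose:
  assumes "open V" "smooth_on V g" "y x \<in> V" "open U" "smooth_on U y" "x \<in> U"
  shows "dir_deriv (\<lambda>z. g (y z)) x v = dir_deriv g (y x) (dir_deriv y x v)"
  by (rule dir_deriv_eq[OF has_dir_deriv_compose[OF assms(1-3) smooth_on_has_dir_deriv[OF assms(5,6)]]])

lemma dir_deriv_add_dir:
  assumes "open U" "smooth_on U f" "x \<in> U"
  shows "dir_deriv f x (v + w) = dir_deriv f x v + dir_deriv f x w"
  by (rule C1_deriv_add[OF assms(1,3) smooth_on_has_dir_deriv[OF assms(2)] continuous_on_dir_deriv[OF assms(2)]])

lemma dir_deriv_scaleR_dir:
  assumes "smooth_on U f" "x \<in> U"
  shows "dir_deriv f x (r *\<^sub>R v) = r *\<^sub>R dir_deriv f x v"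
  by (rule dir_deriv_eq[OF has_dir_deriv_scale_dir[OF smooth_on_has_dir_deriv[OF assms]]])

lemma linear_dir_deriv:
  assumes "open U" "smooth_on U f" "x \<in> U"
  shows "linear (dir_deriv f x)"
  by (rule linearI) (simp_all add: dir_deriv_add_dir[OF assms] dir_deriv_scaleR_dir[OF assms(2,3)])

lemma has_dir_deriv_Pair:
  assumes "has_dir_deriv f x v l" "has_dir_deriv g x v m"
  shows "has_dir_deriv (\<lambda>y. (f y, g y)) x v (l, m)"
  using tendsto_Pair[OF assms[unfolded has_dir_deriv_tendsto]]
  by (simp add: has_dir_deriv_tendsto)

text \<open>The mean value theorem is applied twice, to s in the direction v and then to r in the
  direction w. The second difference is symmetric in v and w while its limit is an iterated
  derivative in a definite order; symmetry of second derivatives follows by uniqueness of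
  limits.\<close>

lemma second_difference_tendsto:
  fixes f :: "'e::locally_convex \<Rightarrow> 'f::locally_convex"
  assumes U: "open U" "smooth_on U f" "x \<in> U"
  shows "((\<lambda>t. (f (x + t *\<^sub>R v + t *\<^sub>R w) - f (x + t *\<^sub>R w) - (f (x + t *\<^sub>R v) - f x)) /\<^sub>R (t * t))
    \<longlongrightarrow> dir_deriv (\<lambda>y. dir_deriv f y v) x w) (at 0)"
proof (rule tendsto_convexI)
  fix C assume C: "open C" "convex C" "dir_deriv (\<lambda>y. dir_deriv f y v) x w \<in> C"
  let ?D = "\<lambda>y. dir_deriv f y v" and ?D2 = "\<lambda>y. dir_deriv (\<lambda>y. dir_deriv f y v) y w"
  have D: "smooth_on U ?D"
    by (rule smooth_on_dir_deriv_comp[OF U(1,1,2) smooth_on_ident[OF U(1)] _ smooth_on_const[OF U(1)]]) simp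
  have "smooth_on U ?D2"
    by (rule smooth_on_dir_deriv_comp[OF U(1,1) D smooth_on_ident[OF U(1)] _ smooth_on_const[OF U(1)]]) simp
  then have "open (?D2 -` C \<inter> U)"
    by (metis C(1) Int_commute U(1) continuous_on_open_vimage smooth_on_imp_continuous_on)
  then have N: "open (?D2 -` C \<inter> U)" "x \<in> ?D2 -` C \<inter> U" using C U by auto
  obtain X W e1 where X: "open X" "x \<in> X" "w \<in> W" "e1 > 0"
    "\<And>y u s. y \<in> X \<Longrightarrow> u \<in> W \<Longrightarrow> \<bar>s\<bar> < e1 \<Longrightarrow> y + s *\<^sub>R u \<in> ?D2 -` C \<inter> U"
    using segment_neighbourhood[OF N, of w] by metis
  obtain X' V e2 where X': "x \<in> X'" "v \<in> V" "e2 > 0"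
    "\<And>y u s. y \<in> X' \<Longrightarrow> u \<in> V \<Longrightarrow> \<bar>s\<bar> < e2 \<Longrightarrow> y + s *\<^sub>R u \<in> X"
    using segment_neighbourhood[OF X(1,2), of v] by metis
  have "eventually (\<lambda>t::real. t \<noteq> 0 \<and> \<bar>t\<bar> < min e1 e2) (at 0)"
    using X(4) X'(3) by (auto simp: eventually_at intro!: exI[of _ "min e1 e2"])
  then show "eventually (\<lambda>t. (f (x + t *\<^sub>R v + t *\<^sub>R w) - f (x + t *\<^sub>R w) - (f (x + t *\<^sub>R v) - f x)) /\<^sub>R (t * t) \<in> C) (at 0)"
  proof eventually_elim
    case (elim t)
    have small: "\<bar>s * t\<bar> < e1" "\<bar>s * t\<bar> < e2" if "0 \<le> s" "s \<le> 1" for s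
    proof -
      have "\<bar>s * t\<bar> \<le> \<bar>t\<bar>" using that by (simp add: abs_mult mult_left_le_one_le)
      then show "\<bar>s * t\<bar> < e1" "\<bar>s * t\<bar> < e2" using elim by auto
    qed
    have mem: "x + (s * t) *\<^sub>R v + (r * t) *\<^sub>R w \<in> ?D2 -` C \<inter> U"
      if "0 \<le> s" "s \<le> 1" "0 \<le> r" "r \<le> 1" for s r
      using X(5)[OF X'(4)[OF X'(1,2) small(2)[OF that(1,2)]] X(3) small(1)[OF that(3,4)]] .
    let ?c = "\<lambda>s. f (x + t *\<^sub>R w + s *\<^sub>R (t *\<^sub>R v)) - f (x + s *\<^sub>R (t *\<^sub>R v))"
    let ?k = "\<lambda>s. (?D (x + (s * t) *\<^sub>R v + t *\<^sub>R w) - ?D (x + (s * t) *\<^sub>R v)) /\<^sub>R t"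
    have "(?c 1 - ?c 0) /\<^sub>R (t * t) \<in> C"
    proof (rule mean_value_scaled)
      show "t * t \<noteq> 0" using elim by simp
      fix s :: real assume s: "0 \<le> s" "s \<le> 1"
      let ?d = "\<lambda>r. ?D (x + (s * t) *\<^sub>R v + r *\<^sub>R (t *\<^sub>R w))"
      have "(?d 1 - ?d 0) /\<^sub>R t \<in> C"
      proof (rule mean_value_scaled[where k = "\<lambda>r. ?D2 (x + (s * t) *\<^sub>R v + (r * t) *\<^sub>R w)"])
        fix r :: real assume r: "0 \<le> r" "r \<le> 1"
        have "x + (s * t) *\<^sub>R v + r *\<^sub>R t *\<^sub>R w \<in> U" using mem[OF s r] by simp
        then have "has_dir_deriv ?D (x + (s * t) *\<^sub>R v + r *\<^sub>R t *\<^sub>R w) (t *\<^sub>R w) (t *\<^sub>R ?D2 (x + (s * t) *\<^sub>R v + r *\<^sub>R t *\<^sub>R w))"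
          by (intro has_dir_deriv_scale_dir smooth_on_has_dir_deriv[OF D])
        from has_curve_deriv_along_line[OF this]
        show "has_curve_deriv ?d (t *\<^sub>R ?D2 (x + (s * t) *\<^sub>R v + (r * t) *\<^sub>R w)) r {0..1}" by simp
        show "?D2 (x + (s * t) *\<^sub>R v + (r * t) *\<^sub>R w) \<in> C" using mem[OF s r] by simp
      qed (use C elim in auto)
      then show "?k s \<in> C" by simp
      have m1: "x + (s * t) *\<^sub>R v \<in> U" using mem[OF s, of 0] by simp
      have m2: "x + (s * t) *\<^sub>R v + t *\<^sub>R w \<in> U" using mem[OF s, of 1] by simp
      have "x + t *\<^sub>R w + s *\<^sub>R (t *\<^sub>R v) = x + (s * t) *\<^sub>R v + t *\<^sub>R w" by simp
      then have "has_dir_deriv f (x + t *\<^sub>R w + s *\<^sub>R (t *\<^sub>R v)) (t *\<^sub>R v) (t *\<^sub>R ?D (x + (s * t) *\<^sub>R v + t *\<^sub>R w))"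
        using has_dir_deriv_scale_dir[OF smooth_on_has_dir_deriv[OF U(2) m2]] by metis
      moreover have "has_dir_deriv f (x + s *\<^sub>R (t *\<^sub>R v)) (t *\<^sub>R v) (t *\<^sub>R ?D (x + (s * t) *\<^sub>R v))"
        using has_dir_deriv_scale_dir[OF smooth_on_has_dir_deriv[OF U(2) m1]] by simp
      ultimately have "has_curve_deriv ?c (t *\<^sub>R ?D (x + (s * t) *\<^sub>R v + t *\<^sub>R w) - t *\<^sub>R ?D (x + (s * t) *\<^sub>R v)) s {0..1}"
        by (intro has_curve_deriv_diff has_curve_deriv_along_line)
      moreover have "t *\<^sub>R ?D (x + (s * t) *\<^sub>R v + t *\<^sub>R w) - t *\<^sub>R ?D (x + (s * t) *\<^sub>R v) = (t * t) *\<^sub>R ?k s"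
      proof -
        have "(t * t) *\<^sub>R (z /\<^sub>R t) = t *\<^sub>R z" for z :: 'f using elim by simp
        then show ?thesis by (simp only: scaleR_diff_right)
      qed
      ultimately show "has_curve_deriv ?c ((t * t) *\<^sub>R ?k s) s {0..1}" by simp
    qed (use C in auto)
    moreover have "?c 1 - ?c 0 = f (x + t *\<^sub>R v + t *\<^sub>R w) - f (x + t *\<^sub>R w) - (f (x + t *\<^sub>R v) - f x)"
      by (simp add: add.assoc add.commute[of "t *\<^sub>R w"])
    ultimately show ?case by (simp only:)
  qed
qed

lemma dir_deriv_commute:
  assumes "open U" "smooth_on U f" "x \<in> U"
  shows "dir_deriv (\<lambda>y. dir_deriv f y v) x w = dir_deriv (\<lambda>y. dir_deriv f y w) x v"
proof -
  have "((\<lambda>t. (f (x + t *\<^sub>R v + t *\<^sub>R w) - f (x + t *\<^sub>R w) - (f (x + t *\<^sub>R v) - f x)) /\<^sub>R (t * t))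
    \<longlongrightarrow> dir_deriv (\<lambda>y. dir_deriv f y w) x v) (at 0)"
    using second_difference_tendsto[OF assms, of w v]
    by (simp add: add.assoc add.commute[of "_ *\<^sub>R w"] diff_diff_eq2 algebra_simps)
  with second_difference_tendsto[OF assms, of v w] show ?thesis
    by (rule tendsto_unique[OF trivial_limit_at])
qed

subsection \<open>Vector fields\<close>

lemma has_dir_deriv_of_dir_deriv:
  assumes "open V" "smooth_on V g" "y x \<in> V" "has_dir_deriv y x u y'" "has_dir_deriv Y x u l"
  shows "has_dir_deriv (\<lambda>z. dir_deriv g (y z) (Y z)) x u
    (dir_deriv (\<lambda>z. dir_deriv g z (Y x)) (y x) y' + dir_deriv g (y x) l)"
  using has_dir_deriv_iter_deriv[where w = "\<lambda>z i. Y z" and w' = "\<lambda>_. l" and k = 1, OF assms(1-5)]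
  by simp

lemma has_dir_deriv_ident: "has_dir_deriv (\<lambda>z. z) x v v"
  by (rule has_dir_deriv_linear) (simp add: linear_iff)

text \<open>The expression in \<open>vf_bracket\<close> for fields on the model space. It moves
  questions about brackets on the manifold into the calculus of a single chart.\<close>

definition field_bracket :: "('e::locally_convex \<Rightarrow> 'e) \<Rightarrow> ('e \<Rightarrow> 'e) \<Rightarrow> 'e \<Rightarrow> 'e" where
  "field_bracket X Y x = dir_deriv Y x (X x) - dir_deriv X x (Y x)"

text \<open>Differentiating Z'(\<tau> z) = d\<tau>(z)(Z z) yields a term with the second derivative
  of \<tau>. That term is symmetric in the two fields and cancels in the bracket. The lemma serves
  both changes of charts and left translations.\<close>

lemma field_bracket_related:
  assumes N: "open N" "open N'" "smooth_on N \<tau>" "\<tau> ` N \<subseteq> N'"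
    and X: "smooth_on N X" "smooth_on N' X'" "\<And>z. z \<in> N \<Longrightarrow> X' (\<tau> z) = dir_deriv \<tau> z (X z)"
    and Y: "smooth_on N Y" "smooth_on N' Y'" "\<And>z. z \<in> N \<Longrightarrow> Y' (\<tau> z) = dir_deriv \<tau> z (Y z)"
    and y: "y \<in> N"
  shows "field_bracket X' Y' (\<tau> y) = dir_deriv \<tau> y (field_bracket X Y y)"
proof -
  have \<tau>y: "\<tau> y \<in> N'" using N y by blast
  have key: "dir_deriv Z' (\<tau> y) (dir_deriv \<tau> y u) =
      dir_deriv (\<lambda>z. dir_deriv \<tau> z (Z y)) y u + dir_deriv \<tau> y (dir_deriv Z y u)"
    if Z: "smooth_on N Z" "smooth_on N' Z'" "\<And>z. z \<in> N \<Longrightarrow> Z' (\<tau> z) = dir_deriv \<tau> z (Z z)" for Z Z' u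
  proof -
    have "dir_deriv (\<lambda>z. Z' (\<tau> z)) y u = dir_deriv (\<lambda>z. dir_deriv \<tau> z (Z z)) y u"
      by (rule dir_deriv_cong[OF N(1) y Z(3)])
    moreover have "dir_deriv (\<lambda>z. Z' (\<tau> z)) y u = dir_deriv Z' (\<tau> y) (dir_deriv \<tau> y u)"
      by (rule dir_deriv_compose[OF N(2) Z(2) \<tau>y N(1,3) y])
    moreover have "dir_deriv (\<lambda>z. dir_deriv \<tau> z (Z z)) y u =
      dir_deriv (\<lambda>z. dir_deriv \<tau> z (Z y)) y u + dir_deriv \<tau> y (dir_deriv Z y u)"
      by (rule dir_deriv_eq[OF has_dir_deriv_of_dir_deriv[OF N(1,3) y has_dir_deriv_ident
            smooth_on_has_dir_deriv[OF Z(1) y]]])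
    ultimately show ?thesis by simp
  qed
  have "linear (dir_deriv \<tau> y)" by (rule linear_dir_deriv[OF N(1,3) y])
  then show ?thesis
    using dir_deriv_commute[OF N(1,3) y, of "Y y" "X y"] key[OF X, of "Y y"] key[OF Y, of "X y"]
    unfolding field_bracket_def X(3)[OF y] Y(3)[OF y] by (simp add: linear_diff)
qed

text \<open>Since the family is closed under brackets, \<open>X (br v w)\<close> may replace the
  bracket field, and differentiating this identity at e expresses \<open>b u (br v w)\<close> by
  second derivatives q and products of b. In the cyclic sum the q cancel by symmetry and the
  products of b cancel in pairs.\<close>

lemma field_bracket_Jacobi:
  fixes X :: "'e::locally_convex \<Rightarrow> 'e \<Rightarrow> 'e"
  assumes N: "open N" "e \<in> N" and X: "\<And>w. smooth_on N (X w)" "\<And>w. X w e = w"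
    and b: "\<And>v w. b v w = dir_deriv (X w) e v"
    and br: "\<And>v w. br v w = b v w - b w v"
    and closed: "\<And>x v w. x \<in> N \<Longrightarrow> field_bracket (X v) (X w) x = X (br v w) x"
  shows "br u (br v w) + br v (br w u) + br w (br u v) = 0"
proof -
  define q where "q w v u = dir_deriv (\<lambda>x. dir_deriv (X w) x v) e u" for w v u
  have q_sym: "q w v u = q w u v" for w v u
    unfolding q_def by (rule dir_deriv_commute[OF N(1) X(1) N(2)])
  have has_X: "has_dir_deriv (X v) e u (b u v)" for v u
    unfolding b by (rule smooth_on_has_dir_deriv[OF X(1) N(2)])
  have D: "has_dir_deriv (\<lambda>x. dir_deriv (X w) x (X v x)) e u (q w v u + b (b u v) w)" for u v w
    using has_dir_deriv_of_dir_deriv[where y = "\<lambda>z. z", OF N(1) X(1) N(2) has_dir_deriv_ident has_X[of v u], of w]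
    unfolding q_def X(2) b .
  have "has_dir_deriv (X (br v w)) e u
    (q w v u + b (b u v) w - (q v w u + b (b u w) v))" for u v w
  proof (rule has_dir_deriv_cong[OF has_dir_deriv_diff[OF D[of w v u] D[of v w u]] N])
    show "dir_deriv (X w) y (X v y) - dir_deriv (X v) y (X w y) = X (br v w) y" if "y \<in> N" for y
      using closed[OF that] by (simp add: field_bracket_def)
  qed
  then have main: "b u (br v w) = q w v u + b (b u v) w - (q v w u + b (b u w) v)" for u v w
    unfolding b[of u "br v w"] by (rule dir_deriv_eq)
  have lin: "linear (dir_deriv (X w) e)" for w by (rule linear_dir_deriv[OF N(1) X(1) N(2)])
  have b_diff: "b (v - v') w = b v w - b v' w" for v v' w
    unfolding b by (rule linear_diff[OF lin])
  have double: "br u (br v w) =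
      q w v u + b (b u v) w - (q v w u + b (b u w) v) - (b (b v w) u - b (b w v) u)" for u v w
    using br[of u "br v w"] main[of u v w] b_diff[of "b v w" "b w v" u] br[of v w] by simp
  show ?thesis
    unfolding double q_sym[of w u v] q_sym[of v w u] q_sym[of u v w] by (simp add: algebra_simps)
qed

section \<open>Primitives and parameter dependence\<close>

text \<open>The substitute for halving epsilon.\<close>

lemma neighbourhood_diff:
  fixes C :: "'a::locally_convex set"
  assumes "open C" "0 \<in> C"
  obtains D where "open D" "convex D" "0 \<in> D" "\<forall>x\<in>D. \<forall>y\<in>D. x - y \<in> C"
proof -
  have "open ((\<lambda>p. fst p - snd p) -` C)" by (intro open_vimage assms(1) continuous_intros)
  moreover have "(0, 0) \<in> (\<lambda>p. fst p - snd p) -` C" using assms(2) by simp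
  ultimately obtain A B where AB: "open A" "open B" "0 \<in> A" "0 \<in> B"
    "\<forall>x\<in>A. \<forall>y\<in>B. (x, y) \<in> (\<lambda>p. fst p - snd p) -` C" by (rule open_pair_elim)
  from AB have "open (A \<inter> B)" "0 \<in> A \<inter> B" by auto
  then obtain D where "open D" "convex D" "0 \<in> D" "D \<subseteq> A \<inter> B" by (rule convex_neighbourhood)
  then show ?thesis using AB(5) by (intro that[of D]) auto
qed

lemma eq_zero_if_in_neighbourhoods:
  fixes x :: "'a::locally_convex"
  assumes "\<And>C. open C \<Longrightarrow> convex C \<Longrightarrow> 0 \<in> C \<Longrightarrow> x \<in> C"
  shows "x = 0"
proof (rule ccontr)
  assume "x \<noteq> 0"
  then obtain U where U: "open U" "0 \<in> U" "x \<notin> U" by (metis separation_t1)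
  from U(1,2) obtain C where "open C" "convex C" "0 \<in> C" "C \<subseteq> U" by (rule convex_neighbourhood)
  then show False using assms U(3) by blast
qed

text \<open>\<open>I t\<close> stands for the integral of c from 0 to t. Only values on [0, 1]
  matter, and derivatives at the two ends are one-sided.\<close>

definition primitive :: "(real \<Rightarrow> 'f::locally_convex) \<Rightarrow> (real \<Rightarrow> 'f) \<Rightarrow> bool" where
  "primitive c I \<longleftrightarrow> I 0 = 0 \<and> (\<forall>t. 0 \<le> t \<and> t \<le> 1 \<longrightarrow> has_curve_deriv I (c t) t {0..1})"

lemma has_curve_deriv_subset: "has_curve_deriv c l t S \<Longrightarrow> S' \<subseteq> S \<Longrightarrow> has_curve_deriv c l t S'"
  unfolding has_curve_deriv_def by (rule tendsto_within_subset)

lemma primitive_diff: "primitive c I \<Longrightarrow> primitive d J \<Longrightarrow> primitive (\<lambda>t. c t - d t) (\<lambda>t. I t - J t)"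
  by (simp add: primitive_def has_curve_deriv_diff)

lemma primitive_scaleR: "primitive c I \<Longrightarrow> primitive (\<lambda>t. r *\<^sub>R c t) (\<lambda>t. r *\<^sub>R I t)"
  by (simp add: primitive_def has_curve_deriv_scaleR)

lemma primitive_quotient_in:
  assumes "primitive c I" "open C" "convex C" "0 \<le> a" "a < b" "b \<le> 1"
    "\<And>t. a \<le> t \<Longrightarrow> t \<le> b \<Longrightarrow> c t \<in> C"
  shows "(I b - I a) /\<^sub>R (b - a) \<in> C"
proof (rule mean_value_quotient[OF assms(5)])
  show "has_curve_deriv I (c t) t {a..b}" if "a \<le> t" "t \<le> b" for t
    by (rule has_curve_deriv_subset[of _ _ _ "{0..1}"])
      (use assms that in \<open>auto simp: primitive_def\<close>)
qed (use assms in auto)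

text \<open>The substitute for bounding an integral by a seminorm of its integrand:
  \<open>I t\<close> is the convex combination, with weights t and 1 - t, of its mean slope and
  0.\<close>

lemma primitive_in:
  assumes "primitive c I" "open C" "convex C" "0 \<in> C" "0 \<le> t" "t \<le> 1"
    "\<And>t. 0 \<le> t \<Longrightarrow> t \<le> 1 \<Longrightarrow> c t \<in> C"
  shows "I t \<in> C"
proof (cases "t = 0")
  case False
  have "(I t - I 0) /\<^sub>R (t - 0) \<in> C"
    by (rule primitive_quotient_in[OF assms(1-3)]) (use assms False in auto)
  then have "t *\<^sub>R (I t /\<^sub>R t) + (1 - t) *\<^sub>R 0 \<in> C"
    using assms by (intro convexD[OF assms(3)]) (auto simp: primitive_def)
  then show ?thesis using False by simp
qed (use assms in \<open>simp add: primitive_def\<close>)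

text \<open>If integrands converge uniformly, then so do their primitives, by
  \<open>primitive_in\<close> applied to differences. Sequential completeness provides a limit, and
  mean slopes show that it is a primitive of the limit integrand. This is where integrals come into
  existence.\<close>

lemma primitive_limit:
  fixes c :: "real \<Rightarrow> 'f::locally_convex"
  assumes complete: "sequentially_complete (UNIV :: 'f set)"
    and cont: "continuous_on {0..1} c"
    and prim: "eventually (\<lambda>s. primitive (k s) (I s)) (at (0::real))"
    and unif: "\<And>C. open C \<Longrightarrow> convex C \<Longrightarrow> 0 \<in> C \<Longrightarrow>
      eventually (\<lambda>s. \<forall>t\<in>{0..1}. k s t - c t \<in> C) (at 0)"
  shows "\<exists>J. primitive c J \<and> ((\<lambda>s. I s 1) \<longlongrightarrow> J 1) (at 0)"
proof -
  have cauchy: "\<exists>A. eventually A (at 0) \<and> (\<forall>s s'. A s \<longrightarrow> A s' \<longrightarrow> (\<forall>t\<in>{0..1}. I s t - I s' t \<in> C))"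
    if C: "open C" "convex C" "0 \<in> C" for C
  proof -
    from C(1,3) obtain D where D: "open D" "convex D" "0 \<in> D" "\<forall>x\<in>D. \<forall>y\<in>D. x - y \<in> C"
      by (rule neighbourhood_diff)
    let ?A = "\<lambda>s. primitive (k s) (I s) \<and> (\<forall>t\<in>{0..1}. k s t - c t \<in> D)"
    have "I s t - I s' t \<in> C" if *: "?A s" "?A s'" "t \<in> {0..1}" for s s' t
    proof (rule primitive_in[OF primitive_diff C])
      fix u :: real assume "0 \<le> u" "u \<le> 1"
      then have "k s u - c u \<in> D" "k s' u - c u \<in> D" using * by auto
      then have "k s u - c u - (k s' u - c u) \<in> C" using D(4) by blast
      then show "k s u - k s' u \<in> C" by simp
    qed (use * in auto)
    moreover have "eventually ?A (at 0)" using prim unif[OF D(1-3)] by (rule eventually_conj)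
    ultimately show ?thesis by blast
  qed
  \<comment> \<open>Completeness speaks of sequences only, so the parameter s is sampled at 1/(n +
    1), which tends to 0 without reaching it.\<close>
  define X where "X t n = I (inverse (real (Suc n))) t" for t n
  have seq: "filterlim (\<lambda>n. inverse (real (Suc n))) (at 0) sequentially"
    using LIMSEQ_inverse_real_of_nat by (auto simp: filterlim_at)
  have "\<exists>L. X t \<longlonglongrightarrow> L" if t: "t \<in> {0..1}" for t
  proof -
    have "\<exists>N. \<forall>m\<ge>N. \<forall>n\<ge>N. X t m - X t n \<in> U" if U: "open U" "0 \<in> U" for U
    proof -
      obtain C where C: "open C" "convex C" "0 \<in> C" "C \<subseteq> U" using U by (rule convex_neighbourhood)
      from cauchy[OF C(1-3)] obtain A where A: "eventually A (at 0)"
        "\<forall>s s'. A s \<longrightarrow> A s' \<longrightarrow> (\<forall>t\<in>{0..1}. I s t - I s' t \<in> C)" by blast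
      from filterlim_iff[THEN iffD1, OF seq, rule_format, OF A(1)]
      obtain N where "\<forall>n\<ge>N. A (inverse (real (Suc n)))" unfolding eventually_sequentially by blast
      then show ?thesis using A(2) t C(4) unfolding X_def by blast
    qed
    then show ?thesis using complete unfolding sequentially_complete_def by blast
  qed
  then obtain J where J: "\<And>t. t \<in> {0..1} \<Longrightarrow> X t \<longlonglongrightarrow> J t" by metis
  \<comment> \<open>Convergence along the whole filter and not only along the samples:
    \<open>J t\<close> is compared with a late sample, which is close to \<open>I s t\<close> by the
    Cauchy property.\<close>
  have conv: "eventually (\<lambda>s. \<forall>t\<in>{0..1}. I s t - J t \<in> C) (at 0)"
    if C: "open C" "convex C" "0 \<in> C" for C
  proof -
    from C(1,3) obtain E where E: "open E" "convex E" "0 \<in> E" "\<forall>x\<in>E. \<forall>y\<in>E. x - y \<in> C"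
      by (rule neighbourhood_diff)
    from cauchy[OF E(1-3)] obtain A where A: "eventually A (at 0)"
      "\<forall>s s'. A s \<longrightarrow> A s' \<longrightarrow> (\<forall>t\<in>{0..1}. I s t - I s' t \<in> E)" by blast
    show ?thesis using A(1)
    proof eventually_elim
      case (elim s)
      show ?case
      proof
        fix t :: real assume t: "t \<in> {0..1}"
        have "(\<lambda>n. J t - X t n) \<longlonglongrightarrow> J t - J t" by (intro tendsto_intros J t)
        then have "eventually (\<lambda>n. J t - X t n \<in> E) sequentially"
          using E(1,3) by (auto dest: topological_tendstoD)
        then have "eventually (\<lambda>n. J t - X t n \<in> E \<and> A (inverse (real (Suc n)))) sequentially"
          using filterlim_iff[THEN iffD1, OF seq, rule_format, OF A(1)] by (rule eventually_conj)
        then obtain n where n: "J t - X t n \<in> E" "A (inverse (real (Suc n)))"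
          unfolding eventually_sequentially by blast
        have "I s t - X t n \<in> E" using A(2) elim n(2) t unfolding X_def by blast
        then have "I s t - X t n - (J t - X t n) \<in> C" using E(4) n(1) by blast
        then show "I s t - J t \<in> C" by simp
      qed
    qed
  qed
  have J_lim: "((\<lambda>s. I s t) \<longlongrightarrow> J t) (at 0)" if t: "t \<in> {0..1}" for t
  proof -
    have "((\<lambda>s. I s t - J t) \<longlongrightarrow> 0) (at 0)"
    proof (rule tendsto_convexI)
      fix C :: "'f set" assume "open C" "convex C" "0 \<in> C"
      then have "eventually (\<lambda>s. \<forall>t\<in>{0..1}. I s t - J t \<in> C) (at 0)" by (rule conv)
      then show "eventually (\<lambda>s. I s t - J t \<in> C) (at 0)" by eventually_elim (use t in blast)
    qed
    from tendsto_add[OF this tendsto_const[of "J t"]] show ?thesis by simp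
  qed
  have "primitive c J" unfolding primitive_def
  proof (intro conjI allI impI)
    have "((\<lambda>s. 0) \<longlongrightarrow> J 0) (at (0::real))"
      by (rule Lim_transform_eventually[OF J_lim]) (use prim in \<open>auto simp: primitive_def elim: eventually_mono\<close>)
    then show "J 0 = 0" by (simp add: tendsto_const_iff)
    fix t :: real assume t: "0 \<le> t \<and> t \<le> 1"
    show "has_curve_deriv J (c t) t {0..1}" unfolding has_curve_deriv_def
    proof (rule tendsto_convexI)
      fix C assume C: "open C" "convex C" "c t \<in> C"
      \<comment> \<open>The error is split in two. The slope of \<open>I s\<close> differs from
        \<open>c t\<close> by an element of \<open>D\<close>, since near t the integrand does so by
        the choice of \<open>E\<close>, and from the slope of \<open>J\<close> by another element of
        \<open>D\<close>. The difference of the two elements lies in C - c t.\<close>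
      have "open ((\<lambda>x. x - (- c t)) -` C)" "0 \<in> (\<lambda>x. x - (- c t)) -` C"
        using C open_vimage_minus_lc[OF C(1), of "- c t"] by auto
      then obtain D where D: "open D" "convex D" "0 \<in> D"
        "\<forall>x\<in>D. \<forall>y\<in>D. x - y \<in> (\<lambda>x. x - (- c t)) -` C" by (rule neighbourhood_diff)
      from D(1,3) obtain E where E: "open E" "convex E" "0 \<in> E" "\<forall>x\<in>E. \<forall>y\<in>E. x - y \<in> D"
        by (rule neighbourhood_diff)
      have "((\<lambda>u. c t - c u) \<longlongrightarrow> c t - c t) (at t within {0..1})"
        using cont t by (intro tendsto_intros) (auto simp: continuous_on_def)
      then have "eventually (\<lambda>u. c t - c u \<in> E) (at t within {0..1})"
        using E(1,3) by (auto dest: topological_tendstoD)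
      then obtain d where d: "d > 0" "\<And>u. 0 \<le> u \<Longrightarrow> u \<le> 1 \<Longrightarrow> \<bar>u - t\<bar> < d \<Longrightarrow> c t - c u \<in> E"
        unfolding eventually_at dist_real_def using E(3) by (metis atLeastAtMost_iff diff_self)
      have "(J u - J t) /\<^sub>R (u - t) \<in> C" if u: "0 \<le> u" "u \<le> 1" "u \<noteq> t" "\<bar>u - t\<bar> < d" for u
      proof -
        let ?q = "\<lambda>H. (H u - H t) /\<^sub>R (u - t)"
        have q_sym: "?q H = (H t - H u) /\<^sub>R (t - u)" for H :: "real \<Rightarrow> 'f"
        proof -
          have "inverse (t - u) = - inverse (u - t)" by (metis inverse_minus_eq minus_diff_eq)
          then show ?thesis by (simp add: scaleR_diff_right)
        qed
        \<comment> \<open>The parameter s is chosen after u, so pointwise convergence at t and u is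
          enough here.\<close>
        have "((\<lambda>s. ?q (I s) - ?q J) \<longlongrightarrow> ?q J - ?q J) (at 0)"
          using u t by (intro tendsto_intros J_lim) auto
        then have "eventually (\<lambda>s. ?q (I s) - ?q J \<in> D) (at 0)"
          using D(1,3) by (auto dest: topological_tendstoD)
        then have "eventually (\<lambda>s. ?q (I s) - ?q J \<in> D \<and> primitive (k s) (I s) \<and>
          (\<forall>t\<in>{0..1}. k s t - c t \<in> E)) (at 0)"
          using prim unif[OF E(1-3)] by (intro eventually_conj)
        from eventually_happens[OF this] obtain s where s: "?q (I s) - ?q J \<in> D"
          "primitive (k s) (I s)" "\<forall>t\<in>{0..1}. k s t - c t \<in> E" by auto
        have D': "open ((\<lambda>x. x - c t) -` D)" "convex ((\<lambda>x. x - c t) -` D)"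
        proof -
          show "open ((\<lambda>x. x - c t) -` D)" by (rule open_vimage_minus_lc[OF D(1)])
          have "(\<lambda>x. x - c t) -` D = (+) (c t) ` D"
          proof safe
            fix x assume "x - c t \<in> D"
            then have "c t + (x - c t) \<in> (+) (c t) ` D" by blast
            then show "x \<in> (+) (c t) ` D" by simp
          qed simp
          then show "convex ((\<lambda>x. x - c t) -` D)" using convex_translation[OF D(2)] by metis
        qed
        have k_in: "k s r \<in> (\<lambda>x. x - c t) -` D" if "0 \<le> r" "r \<le> 1" "\<bar>r - t\<bar> < d" for r
        proof -
          have "k s r - c r \<in> E" "c t - c r \<in> E" using s(3) d(2)[of r] that by auto
          then have "k s r - c r - (c t - c r) \<in> D" using E(4) by blast
          then show ?thesis by simp
        qed
        have "?q (I s) \<in> (\<lambda>x. x - c t) -` D"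
        proof (cases "t < u")
          case True
          show ?thesis
            by (rule primitive_quotient_in[OF s(2) D']) (use True t u in \<open>auto intro!: k_in simp del: vimage_eq\<close>)
        next
          case False
          show ?thesis unfolding q_sym
            by (rule primitive_quotient_in[OF s(2) D']) (use False t u in \<open>auto intro!: k_in simp del: vimage_eq\<close>)
        qed
        then have "?q (I s) - c t - (?q (I s) - ?q J) \<in> (\<lambda>x. x - (- c t)) -` C"
          using D(4) s(1) by (metis vimageD)
        then show ?thesis by simp
      qed
      then show "eventually (\<lambda>u. (J u - J t) /\<^sub>R (u - t) \<in> C) (at t within {0..1})"
        unfolding eventually_at dist_real_def using d(1) by (intro exI[of _ d]) auto
    qed
  qed
  then show ?thesis using J_lim[of 1] by auto
qed

text \<open>Compactness of [0, 1] in the form of interval induction: a property holding near each t,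
  for late s, holds for late s on all of [0, 1].\<close>

lemma eventually_uniform_on_unit_interval:
  fixes P :: "'s \<Rightarrow> real \<Rightarrow> bool"
  assumes "\<And>t. t \<in> {0..1} \<Longrightarrow> eventually (\<lambda>(u, s). P s u) (inf (nhds t) (principal {0..1}) \<times>\<^sub>F F)"
  shows "eventually (\<lambda>s. \<forall>t\<in>{0..1}. P s t) F"
proof -
  define Q where "Q a b \<longleftrightarrow> eventually (\<lambda>s. \<forall>u\<in>{a..b}. u \<in> {0..1} \<longrightarrow> P s u) F" for a b
  have "Q 0 1"
  proof (rule Bolzano)
    fix a b c assume "Q a b" "Q b c"
    then show "Q a c" unfolding Q_def
    proof eventually_elim
      case (elim s)
      then show ?case by (metis atLeastAtMost_iff linear)
    qed
  next
    fix t :: real assume "0 \<le> t" "t \<le> 1"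
    then have "eventually (\<lambda>(u, s). P s u) (inf (nhds t) (principal {0..1}) \<times>\<^sub>F F)" using assms by simp
    then obtain P1 P2 where P: "eventually P1 (inf (nhds t) (principal {0..1}))" "eventually P2 F"
      "\<And>u s. P1 u \<Longrightarrow> P2 s \<Longrightarrow> P s u" unfolding eventually_prod_filter by auto
    from P(1) obtain d where d: "d > 0" "\<And>u. \<bar>u - t\<bar> < d \<Longrightarrow> u \<in> {0..1} \<Longrightarrow> P1 u"
      unfolding eventually_inf_principal eventually_nhds_metric dist_real_def by blast
    have "Q a b" if "a \<le> t" "t \<le> b" "b - a < d" for a b
      unfolding Q_def using P(2)
      by eventually_elim (use d(2) P(3) that in auto)
    then show "\<exists>d>0. \<forall>a b. a \<le> t \<and> t \<le> b \<and> b - a < d \<longrightarrow> Q a b" using d(1) by blast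
  qed simp
  then show ?thesis unfolding Q_def by simp
qed

text \<open>Differentiation under the integral sign for the integral of \<beta>(t, z) over t in
  [0, 1]. The coinductive family consists of the integrals of all z-derivatives of \<beta>; it is
  closed under differentiation itself, so no sums arise.\<close>

lemma smooth_on_parametric_primitive:
  fixes \<beta> :: "real \<times> 'z::locally_convex \<Rightarrow> 'f::locally_convex"
  assumes W: "open W" and S: "open S" "{0..1} \<times> W \<subseteq> S" and \<beta>: "smooth_on S \<beta>"
    and complete: "sequentially_complete (UNIV :: 'f set)"
    and F: "\<And>z. z \<in> W \<Longrightarrow> \<exists>I. primitive (\<lambda>t. \<beta> (t, z)) I \<and> I 1 = F z"
  shows "smooth_on W F"
proof -
  \<comment> \<open>The directions (0, h) differentiate in z only. As before, \<sigma> tells which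
    entry of h fills each slot.\<close>
  define b where "b n \<sigma> t z h = iter_deriv n \<beta> (t, z) (\<lambda>i. (0, h (\<sigma> i)))"
    for n and \<sigma> :: "nat \<Rightarrow> nat" and t z and h :: "nat \<Rightarrow> 'z"
  define P where "P \<phi> n \<sigma> \<longleftrightarrow> (\<forall>z\<in>W. \<forall>h. \<exists>I. primitive (\<lambda>t. b n \<sigma> t z h) I \<and> I 1 = \<phi> z h)" for \<phi> n \<sigma>
  define T where "T = {\<phi>. \<exists>n \<sigma>. P \<phi> n \<sigma>}"
  have PD: "\<exists>I. primitive (\<lambda>t. b n \<sigma> t z h) I \<and> I 1 = \<phi> z h" if "P \<phi> n \<sigma>" "z \<in> W" for \<phi> n \<sigma> z h
    using that unfolding P_def by blast
  have T_base: "(\<lambda>z h. F z) \<in> T"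
    unfolding T_def P_def
  proof (rule CollectI, rule exI[of _ 0], rule exI[of _ id], intro ballI allI)
    fix z and h :: "nat \<Rightarrow> 'z" assume "z \<in> W"
    then show "\<exists>I. primitive (\<lambda>t. b 0 id t z h) I \<and> I 1 = F z" unfolding b_def by (simp add: F)
  qed
  have cont_b: "continuous_on X (\<lambda>x. b n \<sigma> (t x) (z x) (h x))"
    if "continuous_on X t" "continuous_on X z" "\<And>i. continuous_on X (\<lambda>x. h x i)"
      "\<And>x. x \<in> X \<Longrightarrow> t x \<in> {0..1} \<and> z x \<in> W"
    for n \<sigma> and X :: "'x::topological_space set" and t z h
    unfolding b_def
    by (rule continuous_on_iter_deriv[OF \<beta>]) (use that S in \<open>auto intro!: continuous_intros\<close>)
  have T_cont: "continuous_on (W \<times> UNIV) (\<lambda>(z, h). \<phi> z h)" if "\<phi> \<in> T" for \<phi>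
  proof -
    from that obtain n \<sigma> where P: "P \<phi> n \<sigma>" unfolding T_def by blast
    have "((\<lambda>(z, h). \<phi> z h) \<longlongrightarrow> \<phi> z h) (at (z, h) within W \<times> UNIV)" if z: "z \<in> W" for z h
    proof -
      let ?F = "at (z, h) within W \<times> UNIV"
      have "((\<lambda>p. \<phi> (fst p) (snd p) - \<phi> z h) \<longlongrightarrow> 0) ?F"
      proof (rule tendsto_convexI)
        fix C :: "'f set" assume C: "open C" "convex C" "0 \<in> C"
        have unif: "eventually (\<lambda>p. \<forall>t\<in>{0..1}. b n \<sigma> t (fst p) (snd p) - b n \<sigma> t z h \<in> C) ?F"
        proof (rule eventually_uniform_on_unit_interval)
          fix t :: real assume t: "t \<in> {0..1}"
          let ?G = "inf (nhds t) (principal {0..1}) \<times>\<^sub>F ?F"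
          let ?X = "{0..1} \<times> W \<times> (UNIV :: (nat \<Rightarrow> 'z) set)"
          have c: "continuous_on ?X (\<lambda>x. b n \<sigma> (fst x) (fst (snd x)) (snd (snd x)) - b n \<sigma> (fst x) z h)"
          proof (rule continuous_on_diff; rule cont_b)
            show "continuous_on ?X (\<lambda>x. snd (snd x) i)" for i
              by (rule continuous_on_product_then_coordinatewise) (intro continuous_intros)
          qed (use z in \<open>auto intro!: continuous_intros\<close>)
          have G: "(fst \<longlongrightarrow> t) ?G" "(snd \<longlongrightarrow> (z, h)) ?G"
          proof -
            have "filterlim fst (inf (nhds t) (principal {0..1})) ?G" by (rule filterlim_fst)
            then show "(fst \<longlongrightarrow> t) ?G" by (simp add: filterlim_inf)
            have "filterlim snd ?F ?G" by (rule filterlim_snd)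
            then show "(snd \<longlongrightarrow> (z, h)) ?G" by (simp add: at_within_def filterlim_inf)
          qed
          have lim: "((\<lambda>x. (fst x, snd x)) \<longlongrightarrow> (t, (z, h))) ?G" by (rule tendsto_Pair[OF G])
          have ev: "eventually (\<lambda>x. x \<in> ?X) ?G"
          proof -
            have "eventually (\<lambda>u. u \<in> {0..1}) (inf (nhds t) (principal {0..1}))"
              by (simp add: eventually_inf_principal)
            moreover have "eventually (\<lambda>p. p \<in> W \<times> UNIV) ?F" by (simp add: eventually_at_filter)
            ultimately show ?thesis unfolding eventually_prod_filter by fastforce
          qed
          have "((\<lambda>x. b n \<sigma> (fst x) (fst (snd x)) (snd (snd x)) - b n \<sigma> (fst x) z h) \<longlongrightarrow>
            b n \<sigma> t z h - b n \<sigma> t z h) ?G"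
            using continuous_on_tendsto_compose[OF c lim] t z ev by simp
          then have "eventually (\<lambda>x. b n \<sigma> (fst x) (fst (snd x)) (snd (snd x)) - b n \<sigma> (fst x) z h \<in> C) ?G"
            using C(1,3) by (auto dest: topological_tendstoD)
          then show "eventually (\<lambda>(u, p). b n \<sigma> u (fst p) (snd p) - b n \<sigma> u z h \<in> C) ?G"
            unfolding case_prod_beta .
        qed
        have "eventually (\<lambda>p. p \<in> W \<times> UNIV) ?F" by (simp add: eventually_at_filter)
        with unif show "eventually (\<lambda>p. \<phi> (fst p) (snd p) - \<phi> z h \<in> C) ?F"
        proof eventually_elim
          case (elim p)
          then have "fst p \<in> W" by auto
          from PD[OF P this] obtain I where I: "primitive (\<lambda>t. b n \<sigma> t (fst p) (snd p)) I" "I 1 = \<phi> (fst p) (snd p)" by blast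
          from PD[OF P z] obtain J where J: "primitive (\<lambda>t. b n \<sigma> t z h) J" "J 1 = \<phi> z h" by blast
          have "I 1 - J 1 \<in> C"
            by (rule primitive_in[OF primitive_diff[OF I(1) J(1)] C]) (use elim in auto)
          then show ?case by (simp add: I J)
        qed
      qed
      from tendsto_add[OF this tendsto_const[of "\<phi> z h"]] show ?thesis
        unfolding case_prod_beta by simp
    qed
    then show ?thesis unfolding continuous_on_def by auto
  qed
  have T_deriv: "\<exists>\<psi>\<in>T. \<forall>z\<in>W. \<forall>h. has_dir_deriv (\<lambda>y. \<phi> y h) z (h m) (\<psi> z h)" if "\<phi> \<in> T" for \<phi> m
  proof -
    from that obtain n \<sigma> where P: "P \<phi> n \<sigma>" unfolding T_def by blast
    let ?c = "\<lambda>z h t. b (Suc n) (\<sigma>(n := m)) t z h"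
    have deriv_b: "has_dir_deriv (\<lambda>z. b n \<sigma> t z h) z v (iter_deriv (Suc n) \<beta> (t, z) ((\<lambda>i. (0, h (\<sigma> i)))(n := (0, v))))"
      if "t \<in> {0..1}" "z \<in> W" for t z h v
    proof -
      have "(t, z) \<in> S" using that S by blast
      from smooth_on_iter_deriv_upd[OF \<beta> this, of n "\<lambda>i. (0, h (\<sigma> i))" "(0, v)"]
      show ?thesis by (simp add: has_dir_deriv_tendsto b_def)
    qed
    have ex: "\<exists>J. primitive (?c z h) J \<and> has_dir_deriv (\<lambda>y. \<phi> y h) z (h m) (J 1)" if z: "z \<in> W" for z h
    proof -
      have "\<forall>y. \<exists>I. y \<in> W \<longrightarrow> primitive (\<lambda>t. b n \<sigma> t y h) I \<and> I 1 = \<phi> y h" using PD[OF P] by blast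
      then obtain I where I: "\<And>y. y \<in> W \<Longrightarrow> primitive (\<lambda>t. b n \<sigma> t y h) (I y)" "\<And>y. y \<in> W \<Longrightarrow> I y 1 = \<phi> y h"
        by metis
      let ?z = "\<lambda>s. z + s *\<^sub>R h m"
      let ?k = "\<lambda>s t. (b n \<sigma> t (?z s) h - b n \<sigma> t z h) /\<^sub>R s"
      let ?I = "\<lambda>s t. (I (?z s) t - I z t) /\<^sub>R s"
      have ev: "eventually (\<lambda>s. ?z s \<in> W) (at 0)"
        using eventually_add_scaleR_in[OF W z, of "h m"] by (auto simp: eventually_at_filter elim: eventually_mono)
      \<comment> \<open>The difference quotients in z converge uniformly in t to the differentiated
        integrand. The limit theorem thereby yields at once a primitive of that integrand and the
        derivative of the integral.\<close>
      have "\<exists>J. primitive (?c z h) J \<and> ((\<lambda>s. ?I s 1) \<longlongrightarrow> J 1) (at 0)"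
      proof (rule primitive_limit[OF complete])
        show cont_c: "continuous_on {0..1} (?c z h)"
          by (rule cont_b) (use z in \<open>auto intro!: continuous_intros\<close>)
        show "eventually (\<lambda>s. primitive (?k s) (?I s)) (at 0)" using ev
          by eventually_elim (intro primitive_scaleR primitive_diff I z)
        fix C :: "'f set" assume C: "open C" "convex C" "0 \<in> C"
        show "eventually (\<lambda>s. \<forall>t\<in>{0..1}. ?k s t - ?c z h t \<in> C) (at 0)"
        proof (rule eventually_uniform_on_unit_interval)
          fix t :: real assume t: "t \<in> {0..1}"
          let ?G = "inf (nhds t) (principal {0..1}) \<times>\<^sub>F at (0::real)"
          let ?\<phi>' = "\<lambda>z t v. iter_deriv (Suc n) \<beta> (t, z) ((\<lambda>i. (0, h (\<sigma> i)))(n := (0, v)))"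
          have upd: "((\<lambda>i. (0, h (\<sigma> i)))(n := (0, h m))) = (\<lambda>i. (0 :: real, h ((\<sigma>(n := m)) i)))" by auto
          have G: "(fst \<longlongrightarrow> t) ?G" "(snd \<longlongrightarrow> 0) ?G" "eventually (\<lambda>x. fst x \<in> {0..1}) ?G"
            "eventually (\<lambda>x. snd x \<noteq> 0) ?G"
          proof -
            have *: "filterlim fst (inf (nhds t) (principal {0..1})) ?G" by (rule filterlim_fst)
            then show "(fst \<longlongrightarrow> t) ?G" "eventually (\<lambda>x. fst x \<in> {0..1}) ?G"
              by (simp_all add: filterlim_inf filterlim_principal)
            have "filterlim snd (at (0::real)) ?G" by (rule filterlim_snd)
            then show "(snd \<longlongrightarrow> 0) ?G" "eventually (\<lambda>x. snd x \<noteq> 0) ?G" by (simp_all add: filterlim_at)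
          qed
          have 1: "((\<lambda>x. (b n \<sigma> (fst x) (z + snd x *\<^sub>R h m) h - b n \<sigma> (fst x) z h) /\<^sub>R snd x) \<longlongrightarrow> ?\<phi>' z t (h m)) ?G"
          proof (rule difference_quotient_tendsto[where \<phi> = "\<lambda>z t. b n \<sigma> t z h" and \<phi>' = ?\<phi>' and U = W
                and Q = "{0..1}" and x = "\<lambda>_. z" and v = "\<lambda>_. h m" and p = fst and t = snd])
            show "continuous_on (W \<times> {0..1} \<times> UNIV) (\<lambda>(z, t, v). ?\<phi>' z t v)"
              unfolding case_prod_beta
            proof (rule continuous_on_iter_deriv[OF \<beta>])
              show "continuous_on (W \<times> {0..1} \<times> UNIV) (\<lambda>x. ((\<lambda>i. (0, h (\<sigma> i)))(n := (0, snd (snd x)))) i)" for i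
                by (cases "i = n") (auto intro!: continuous_intros)
            qed (use S in \<open>auto intro!: continuous_intros\<close>)
          qed (use W z t G deriv_b in \<open>auto intro!: tendsto_const\<close>)
          have 2: "((\<lambda>x. ?c z h (fst x)) \<longlongrightarrow> ?c z h t) ?G"
            using continuous_on_tendsto_compose[OF cont_c G(1) t G(3)] .
          have 3: "((\<lambda>x. (b n \<sigma> (fst x) (z + snd x *\<^sub>R h m) h - b n \<sigma> (fst x) z h) /\<^sub>R snd x - ?c z h (fst x))
            \<longlongrightarrow> ?\<phi>' z t (h m) - ?c z h t) ?G"
            by (rule tendsto_diff[OF 1 2])
          have eq0: "?\<phi>' z t (h m) - ?c z h t = 0" unfolding b_def upd by (rule diff_self)
          have "eventually (\<lambda>x. (b n \<sigma> (fst x) (z + snd x *\<^sub>R h m) h - b n \<sigma> (fst x) z h) /\<^sub>R snd x - ?c z h (fst x) \<in> C) ?G"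
            by (rule topological_tendstoD[OF 3[unfolded eq0] C(1,3)])
          then show "eventually (\<lambda>(u, s). ?k s u - ?c z h u \<in> C) ?G" unfolding case_prod_beta .
        qed
      qed
      then obtain J where J: "primitive (?c z h) J" "((\<lambda>s. ?I s 1) \<longlongrightarrow> J 1) (at 0)" by blast
      have "((\<lambda>s. (\<phi> (?z s) h - \<phi> z h) /\<^sub>R s) \<longlongrightarrow> J 1) (at 0)"
        by (rule Lim_transform_eventually[OF J(2)])
          (use ev in \<open>eventually_elim, simp add: I(2) z\<close>)
      then show ?thesis using J(1) unfolding has_dir_deriv_tendsto by blast
    qed
    then have "\<forall>z h. \<exists>J. z \<in> W \<longrightarrow> primitive (?c z h) J \<and> has_dir_deriv (\<lambda>y. \<phi> y h) z (h m) (J 1)" by blast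
    then obtain J where J: "\<And>z h. z \<in> W \<Longrightarrow> primitive (?c z h) (J z h) \<and> has_dir_deriv (\<lambda>y. \<phi> y h) z (h m) (J z h 1)"
      by metis
    show ?thesis
    proof (rule bexI)
      show "\<forall>z\<in>W. \<forall>h. has_dir_deriv (\<lambda>y. \<phi> y h) z (h m) (J z h 1)" using J by blast
      have "P (\<lambda>z h. J z h 1) (Suc n) (\<sigma>(n := m))" unfolding P_def using J by blast
      then show "(\<lambda>z h. J z h 1) \<in> T" unfolding T_def by blast
    qed
  qed
  show ?thesis by (rule smooth_onI_coinduct[OF W T_base _ T_cont T_deriv]) simp
qed

text \<open>F(y, x) is the integral of B(y, x0 + t (x - x0), x - x0) over t in [0, 1], because F
  vanishes at x0. Its regularity in y is inherited from B alone.\<close>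

lemma smooth_on_if_partial_deriv_smooth:
  fixes F :: "'d::locally_convex \<times> 'e::locally_convex \<Rightarrow> 'f::locally_convex"
  assumes U: "open U" and V: "open V" "convex V" "x0 \<in> V"
    and complete: "sequentially_complete (UNIV :: 'f set)"
    and B: "smooth_on (U \<times> V \<times> UNIV) B"
    and F: "\<And>y x v. y \<in> U \<Longrightarrow> x \<in> V \<Longrightarrow> has_dir_deriv (\<lambda>x. F (y, x)) x v (B (y, x, v))"
    and F0: "\<And>y. y \<in> U \<Longrightarrow> F (y, x0) = 0"
  shows "smooth_on (U \<times> V) F"
proof -
  let ?g = "\<lambda>z :: real \<times> 'd \<times> 'e. (fst (snd z), x0 + fst z *\<^sub>R (snd (snd z) - x0), snd (snd z) - x0)"
  let ?S = "?g -` (U \<times> V \<times> UNIV)"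
  have S: "open ?S" by (intro open_vimage open_Times U V open_UNIV continuous_intros)
  have g: "smooth_on ?S ?g"
    by (intro smooth_on_Pair smooth_on_add smooth_on_scaleR smooth_on_diff smooth_on_const
        smooth_on_fst_comp smooth_on_snd_comp smooth_on_ident S smooth_on_fst smooth_on_snd)
  have B': "smooth_on ?S (\<lambda>z. B (?g z))"
    by (rule smooth_on_compose[OF S _ B g]) (use U V in \<open>auto intro: open_Times\<close>)
  show ?thesis
  proof (rule smooth_on_parametric_primitive[OF _ S _ B' complete])
    show "open (U \<times> V)" by (intro open_Times U V)
    have line: "x0 + t *\<^sub>R (x - x0) \<in> V" if "x \<in> V" "0 \<le> t" "t \<le> 1" for x t
    proof -
      have "(1 - t) *\<^sub>R x0 + t *\<^sub>R x \<in> V" by (rule convexD[OF V(2,3) that(1)]) (use that in auto)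
      then show ?thesis by (simp add: algebra_simps)
    qed
    then show "{0..1} \<times> (U \<times> V) \<subseteq> ?S" by auto
    fix z assume "z \<in> U \<times> V"
    then obtain y x where z: "z = (y, x)" "y \<in> U" "x \<in> V" by blast
    show "\<exists>I. primitive (\<lambda>t. B (?g (t, z))) I \<and> I 1 = F z"
    proof (intro exI conjI)
      show "primitive (\<lambda>t. B (?g (t, z))) (\<lambda>t. F (y, x0 + t *\<^sub>R (x - x0)))"
        unfolding primitive_def
        by (intro conjI allI impI has_curve_deriv_along_line) (use z line F0 F in auto)
      show "F (y, x0 + 1 *\<^sub>R (x - x0)) = F z" by (simp add: z)
    qed
  qed
qed

section \<open>Smooth maps between manifolds\<close>

lemma atlas_chart:
  assumes "smooth_atlas A" "c \<in> A"
  shows open_chart_domain: "open (fst c)" and open_chart_image: "open (snd c ` fst c)"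
    and chart_inv_chart: "\<And>p. p \<in> fst c \<Longrightarrow> chart_inv c (snd c p) = p"
    and chart_inv_in: "\<And>x. x \<in> snd c ` fst c \<Longrightarrow> chart_inv c x \<in> fst c"
    and chart_chart_inv: "\<And>x. x \<in> snd c ` fst c \<Longrightarrow> snd c (chart_inv c x) = x"
    and continuous_on_chart: "continuous_on (fst c) (snd c)"
    and continuous_on_chart_inv: "continuous_on (snd c ` fst c) (chart_inv c)"
  using assms unfolding smooth_atlas_def homeomorphism_def by auto

lemma smooth_on_transition:
  "smooth_atlas A \<Longrightarrow> c \<in> A \<Longrightarrow> d \<in> A \<Longrightarrow>
    smooth_on (snd c ` (fst c \<inter> fst d)) (\<lambda>x. snd d (chart_inv c x))"
  unfolding smooth_atlas_def by (auto simp: o_def)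

lemma open_chart_image_subset:
  assumes "smooth_atlas A" "c \<in> A" "open N" "N \<subseteq> fst c"
  shows "open (snd c ` N)"
proof -
  have "snd c ` N = chart_inv c -` N \<inter> snd c ` fst c"
    using assms(4) atlas_chart(3-5)[OF assms(1,2)] by force
  then show ?thesis
    using continuous_on_open_vimage[OF open_chart_image[OF assms(1,2)], THEN iffD1,
        OF continuous_on_chart_inv[OF assms(1,2)]] assms(3) by metis
qed

lemma charts_atD: "c \<in> charts_at A p \<Longrightarrow> c \<in> A" "c \<in> charts_at A p \<Longrightarrow> p \<in> fst c"
  by (simp_all add: charts_at_def)

lemma chart_at_in_charts_at:
  assumes "smooth_atlas A"
  shows "chart_at A p \<in> charts_at A p"
proof -
  have "p \<in> (\<Union>c\<in>A. fst c)" using assms unfolding smooth_atlas_def by simp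
  then have "\<exists>c. c \<in> charts_at A p" by (auto simp: charts_at_def)
  then show ?thesis unfolding chart_at_def by (rule someI_ex)
qed

definition local_rep :: "('m, 'e) chart \<Rightarrow> ('n, 'f) chart \<Rightarrow> ('m \<Rightarrow> 'n) \<Rightarrow> 'e \<Rightarrow> 'f" where
  "local_rep c d f x = snd d (f (chart_inv c x))"

definition smooth_near ::
  "('m::t2_space, 'e::locally_convex) chart \<Rightarrow> ('n::t2_space, 'f::locally_convex) chart \<Rightarrow>
   ('m \<Rightarrow> 'n) \<Rightarrow> 'm \<Rightarrow> 'm set \<Rightarrow> bool" where
  "smooth_near c d f p N \<longleftrightarrow> open N \<and> p \<in> N \<and> N \<subseteq> fst c \<and> f ` N \<subseteq> fst d \<and> continuous_on N f \<and>
     smooth_on (snd c ` N) (local_rep c d f)"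

text \<open>Smoothness at one point, witnessed by a single pair of charts. Composites and pairs can
  then be treated pointwise, without following the domains that occur in
  \<open>mfd_smooth_on\<close>.\<close>

definition smooth_at ::
  "('m::t2_space, 'e::locally_convex) chart set \<Rightarrow> ('n::t2_space, 'f::locally_convex) chart set \<Rightarrow>
   ('m \<Rightarrow> 'n) \<Rightarrow> 'm \<Rightarrow> bool" where
  "smooth_at A B f p \<longleftrightarrow> (\<exists>c\<in>A. \<exists>d\<in>B. \<exists>N. smooth_near c d f p N)"

text \<open>Continuity of f comes from its smooth coordinate expression, as f is recovered from it
  by composing with the charts.\<close>

lemma smooth_nearI:
  assumes A: "smooth_atlas A" "c \<in> A" and B: "smooth_atlas B" "d \<in> B"
    and N: "open N" "p \<in> N" "N \<subseteq> fst c" "f ` N \<subseteq> fst d"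
    and s: "smooth_on (snd c ` N) (local_rep c d f)"
  shows "smooth_near c d f p N"
proof -
  have "continuous_on N (\<lambda>q. chart_inv d (local_rep c d f (snd c q)))"
  proof (rule continuous_on_compose2[OF continuous_on_chart_inv[OF B]])
    show "continuous_on N (\<lambda>q. local_rep c d f (snd c q))"
      by (rule continuous_on_compose2[OF smooth_on_imp_continuous_on[OF s]
            continuous_on_subset[OF continuous_on_chart[OF A] N(3)]]) simp
    show "(\<lambda>q. local_rep c d f (snd c q)) ` N \<subseteq> snd d ` fst d"
      using N atlas_chart(3)[OF A] by (auto simp: local_rep_def subset_iff)
  qed
  moreover have "chart_inv d (local_rep c d f (snd c q)) = f q" if "q \<in> N" for q
    using that N atlas_chart(3)[OF A] atlas_chart(3)[OF B] by (auto simp: local_rep_def subset_iff)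
  ultimately have "continuous_on N f" by (metis (mono_tags, lifting) continuous_on_cong)
  then show ?thesis using assms by (simp add: smooth_near_def)
qed

lemma smooth_near_subset:
  assumes "smooth_near c d f p N" "open N'" "p \<in> N'" "N' \<subseteq> N"
  shows "smooth_near c d f p N'"
  using assms unfolding smooth_near_def
  by (meson continuous_on_subset image_mono order_trans smooth_on_subset)

lemma smooth_near_compose:
  assumes A: "smooth_atlas A" "c \<in> A" and B: "smooth_atlas B" "d \<in> B" and C: "smooth_atlas C" "e \<in> C"
    and f: "smooth_near c d f p N" and g: "smooth_near d e g (f p) N'"
  shows "smooth_near c e (\<lambda>q. g (f q)) p (f -` N' \<inter> N)"
proof (rule smooth_nearI[OF A C])
  note f' = f[unfolded smooth_near_def] and g' = g[unfolded smooth_near_def]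
  show o: "open (f -` N' \<inter> N)"
    using f' g' continuous_on_open_vimage by metis
  let ?S = "snd c ` (f -` N' \<inter> N)"
  have S: "open ?S" using open_chart_image_subset[OF A o] f' by blast
  have T: "open (snd d ` N')" using open_chart_image_subset[OF B] g' by blast
  have "smooth_on ?S (\<lambda>x. local_rep d e g (local_rep c d f x))"
  proof (rule smooth_on_compose[OF S T])
    show "smooth_on (snd d ` N') (local_rep d e g)" using g' by blast
    show "smooth_on ?S (local_rep c d f)"
      by (rule smooth_on_subset[of "snd c ` N"]) (use f' in auto)
    show "local_rep c d f ` ?S \<subseteq> snd d ` N'"
      using f' atlas_chart(3)[OF A] by (auto simp: local_rep_def subset_iff)
  qed
  then show "smooth_on ?S (local_rep c e (\<lambda>q. g (f q)))"
  proof (rule smooth_on_cong[OF _ S])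
    fix x assume "x \<in> ?S"
    then show "local_rep d e g (local_rep c d f x) = local_rep c e (\<lambda>q. g (f q)) x"
      using f' atlas_chart(3)[OF A] atlas_chart(3)[OF B] by (auto simp: local_rep_def subset_iff)
  qed
qed (use f g in \<open>auto simp: smooth_near_def\<close>)

lemma smooth_near_id:
  assumes A: "smooth_atlas A" "c \<in> charts_at A p" "d \<in> charts_at A p"
  shows "smooth_near c d (\<lambda>q. q) p (fst c \<inter> fst d)"
  by (rule smooth_nearI[OF A(1) _ A(1)])
    (use assms smooth_on_transition[OF A(1)] in \<open>auto simp: charts_at_def local_rep_def[abs_def]
      intro!: open_Int atlas_chart(1)[OF A(1)]\<close>)

text \<open>Any other pair of charts is reached by composing with chart changes on both sides, that
  is, with the identity read in two charts.\<close>

lemma smooth_at_charts: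
  assumes A: "smooth_atlas A" and B: "smooth_atlas B" and f: "smooth_at A B f p"
    and c: "c \<in> charts_at A p" and d: "d \<in> charts_at B (f p)"
  shows "\<exists>N. smooth_near c d f p N"
proof -
  obtain c' d' N where N: "c' \<in> A" "d' \<in> B" "smooth_near c' d' f p N"
    using f unfolding smooth_at_def by blast
  then have c': "c' \<in> charts_at A p" and d': "d' \<in> charts_at B (f p)"
    unfolding smooth_near_def charts_at_def by auto
  note cA = charts_atD(1)[OF c] and dB = charts_atD(1)[OF d]
  from smooth_near_compose[OF A cA A N(1) B N(2) smooth_near_id[OF A c c'] N(3)]
  obtain M where M: "smooth_near c d' f p M" by blast
  from smooth_near_compose[OF A cA B N(2) B dB M smooth_near_id[OF B d' d]]
  show ?thesis by blast
qed

lemma smooth_atI: "c \<in> A \<Longrightarrow> d \<in> B \<Longrightarrow> smooth_near c d f p N \<Longrightarrow> smooth_at A B f p"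
  unfolding smooth_at_def by blast

lemma mfd_smooth_on_iff:
  assumes A: "smooth_atlas A" and B: "smooth_atlas B"
  shows "mfd_smooth_on A B W f \<longleftrightarrow> open W \<and> (\<forall>p\<in>W. smooth_at A B f p)"
proof safe
  assume f: "mfd_smooth_on A B W f"
  then show W: "open W" unfolding mfd_smooth_on_def by blast
  fix p assume p: "p \<in> W"
  let ?c = "chart_at A p" and ?d = "chart_at B (f p)"
  have c: "?c \<in> A" "p \<in> fst ?c" and d: "?d \<in> B" "f p \<in> fst ?d"
    using chart_at_in_charts_at[OF A] chart_at_in_charts_at[OF B] by (auto simp: charts_at_def)
  let ?N = "{q \<in> W \<inter> fst ?c. f q \<in> fst ?d}"
  have eq: "?N = f -` fst ?d \<inter> W \<inter> fst ?c" by auto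
  have "open (f -` fst ?d \<inter> W)"
    using f continuous_on_open_vimage[OF W, of f] open_chart_domain[OF B d(1)] unfolding mfd_smooth_on_def by blast
  then have oN: "open ?N" unfolding eq using open_chart_domain[OF A c(1)] by blast
  have "smooth_on (snd ?c ` ?N) (snd ?d \<circ> f \<circ> chart_inv ?c)"
    using f c(1) d(1) unfolding mfd_smooth_on_def by blast
  then have "smooth_on (snd ?c ` ?N) (local_rep ?c ?d f)"
    by (simp add: o_def local_rep_def[abs_def])
  then have "smooth_near ?c ?d f p ?N"
    by (intro smooth_nearI[OF A c(1) B d(1) oN]) (use p c d in auto)
  then show "smooth_at A B f p" by (rule smooth_atI[OF c(1) d(1)])
next
  assume W: "open W" and f: "\<forall>p\<in>W. smooth_at A B f p"
  show "mfd_smooth_on A B W f" unfolding mfd_smooth_on_def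
  proof (intro conjI ballI W)
    let ?S = "{N. open N \<and> continuous_on N f}"
    have "continuous_on (\<Union>N\<in>?S. N) f" by (rule continuous_on_open_UN) auto
    moreover have "W \<subseteq> (\<Union>N\<in>?S. N)"
    proof
      fix p assume "p \<in> W"
      then obtain N where "open N" "continuous_on N f" "p \<in> N"
        using f unfolding smooth_at_def smooth_near_def by blast
      then show "p \<in> (\<Union>N\<in>?S. N)" by auto
    qed
    ultimately show "continuous_on W f" by (rule continuous_on_subset)
    fix c d assume c: "c \<in> A" and d: "d \<in> B"
    show "smooth_on (snd c ` {p \<in> W \<inter> fst c. f p \<in> fst d}) (snd d \<circ> f \<circ> chart_inv c)"
    proof (rule smooth_on_local)
      fix x assume "x \<in> snd c ` {p \<in> W \<inter> fst c. f p \<in> fst d}"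
      then obtain p where p: "x = snd c p" "p \<in> W" "c \<in> charts_at A p" "d \<in> charts_at B (f p)"
        using c d by (auto simp: charts_at_def)
      then obtain N where N: "smooth_near c d f p N" using smooth_at_charts[OF A B bspec[OF f p(2)] p(3,4)] by blast
      have "open (snd c ` N)" using open_chart_image_subset[OF A c] N by (auto simp: smooth_near_def)
      then show "\<exists>N. open N \<and> x \<in> N \<and> smooth_on N (snd d \<circ> f \<circ> chart_inv c)"
        using N p(1) by (intro exI[of _ "snd c ` N"]) (auto simp: smooth_near_def local_rep_def[abs_def] o_def)
    qed
  qed
qed

lemma smooth_at_compose:
  assumes A: "smooth_atlas A" and B: "smooth_atlas B" and C: "smooth_atlas C"
    and f: "smooth_at A B f p" and g: "smooth_at B C g (f p)"
  shows "smooth_at A C (\<lambda>q. g (f q)) p"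
proof -
  note ch = chart_at_in_charts_at
  obtain N where N: "smooth_near (chart_at A p) (chart_at B (f p)) f p N"
    using smooth_at_charts[OF A B f ch[OF A] ch[OF B]] by blast
  obtain M where M: "smooth_near (chart_at B (f p)) (chart_at C (g (f p))) g (f p) M"
    using smooth_at_charts[OF B C g ch[OF B] ch[OF C]] by blast
  show ?thesis
    by (rule smooth_atI[OF _ _ smooth_near_compose[OF A _ B _ C _ N M]])
      (use ch[OF A] ch[OF B] ch[OF C] in \<open>auto simp: charts_at_def\<close>)
qed

lemma smooth_at_id: "smooth_atlas A \<Longrightarrow> smooth_at A A (\<lambda>q. q) p"
  using smooth_near_id[OF _ chart_at_in_charts_at chart_at_in_charts_at]
  by (metis charts_atD(1) chart_at_in_charts_at smooth_atI)

lemma smooth_at_const: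
  assumes A: "smooth_atlas A" and B: "smooth_atlas B"
  shows "smooth_at A B (\<lambda>q. b) p"
proof -
  let ?c = "chart_at A p" and ?d = "chart_at B b"
  have c: "?c \<in> A" "p \<in> fst ?c" and d: "?d \<in> B" "b \<in> fst ?d"
    using chart_at_in_charts_at[OF A] chart_at_in_charts_at[OF B] by (auto simp: charts_at_def)
  have "smooth_near ?c ?d (\<lambda>q. b) p (fst ?c)"
    by (rule smooth_nearI[OF A c(1) B d(1)])
      (use c d open_chart_domain[OF A c(1)] smooth_on_const[OF open_chart_image[OF A c(1)]]
        in \<open>auto simp: local_rep_def[abs_def]\<close>)
  then show ?thesis by (rule smooth_atI[OF c(1) d(1)])
qed

subsection \<open>Products and vector spaces\<close>

definition prod_chart :: "('m, 'e) chart \<Rightarrow> ('n, 'f) chart \<Rightarrow> ('m \<times> 'n, 'e \<times> 'f) chart" where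
  "prod_chart c d = (fst c \<times> fst d, map_prod (snd c) (snd d))"

lemma prod_atlas_eq: "prod_atlas A B = {prod_chart c d | c d. c \<in> A \<and> d \<in> B}"
  by (simp add: prod_atlas_def prod_chart_def)

lemma prod_chart_in_prod_atlas: "c \<in> A \<Longrightarrow> d \<in> B \<Longrightarrow> prod_chart c d \<in> prod_atlas A B"
  unfolding prod_atlas_eq by blast

lemma fst_prod_chart: "fst (prod_chart c d) = fst c \<times> fst d"
  and snd_prod_chart: "snd (prod_chart c d) = map_prod (snd c) (snd d)"
  by (simp_all add: prod_chart_def)

lemma chart_inv_prod:
  assumes "smooth_atlas A" "c \<in> A" "smooth_atlas B" "d \<in> B" "p \<in> fst c" "q \<in> fst d"
  shows "chart_inv (prod_chart c d) (snd c p, snd d q) = (p, q)"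
proof -
  have "inj_on (snd c) (fst c)" "inj_on (snd d) (fst d)"
    using atlas_chart(3)[OF assms(1,2)] atlas_chart(3)[OF assms(3,4)] by (auto intro: inj_on_inverseI)
  then have "inj_on (snd (prod_chart c d)) (fst (prod_chart c d))"
    unfolding prod_chart_def by (auto intro: map_prod_inj_on)
  from inv_into_f_f[OF this, of "(p, q)"] assms(5,6)
  show ?thesis unfolding chart_inv_def by (simp add: prod_chart_def)
qed

lemma chart_inv_prod':
  assumes "smooth_atlas A" "c \<in> A" "smooth_atlas B" "d \<in> B" "x \<in> snd c ` fst c" "y \<in> snd d ` fst d"
  shows "chart_inv (prod_chart c d) (x, y) = (chart_inv c x, chart_inv d y)"
  using assms(5,6) chart_inv_prod[OF assms(1-4)] atlas_chart(3)[OF assms(1,2)] atlas_chart(3)[OF assms(3,4)]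
  by auto

lemma smooth_atlas_prod:
  assumes A: "smooth_atlas A" and B: "smooth_atlas B"
  shows "smooth_atlas (prod_atlas A B)"
  unfolding smooth_atlas_def
proof (intro conjI ballI)
  have cov: "(\<Union>c\<in>A. fst c) = UNIV" "(\<Union>c\<in>B. fst c) = UNIV"
    using A B by (auto simp: smooth_atlas_def)
  show "(\<Union>c\<in>prod_atlas A B. fst c) = UNIV"
  proof -
    have "z \<in> (\<Union>c\<in>prod_atlas A B. fst c)" for z
    proof -
      obtain c d where "c \<in> A" "fst z \<in> fst c" "d \<in> B" "snd z \<in> fst d" using cov by blast
      then show ?thesis
        by (intro UN_I[of "prod_chart c d"] prod_chart_in_prod_atlas)
          (auto simp: fst_prod_chart mem_Times_iff)
    qed
    then show ?thesis by blast
  qed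
  fix e assume "e \<in> prod_atlas A B"
  then obtain c d where e: "e = prod_chart c d" and c: "c \<in> A" and d: "d \<in> B"
    by (auto simp: prod_atlas_eq)
  have im: "snd e ` fst e = (snd c ` fst c) \<times> (snd d ` fst d)"
    unfolding e by (auto simp: prod_chart_def)
  show "open (fst e)" "open (snd e ` fst e)"
    unfolding im unfolding e fst_prod_chart
    by (intro open_Times open_chart_domain[OF A c] open_chart_domain[OF B d] open_chart_image[OF A c] open_chart_image[OF B d])+
  have cont: "continuous_on (fst e) (snd e)"
  proof -
    have "continuous_on (fst c \<times> fst d) (\<lambda>z. (snd c (fst z), snd d (snd z)))"
      by (intro continuous_on_Pair continuous_on_compose2[OF continuous_on_chart[OF A c]]
          continuous_on_compose2[OF continuous_on_chart[OF B d]] continuous_intros) auto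
    then show ?thesis unfolding e by (simp add: prod_chart_def map_prod_def case_prod_beta')
  qed
  have "continuous_on (snd e ` fst e) (\<lambda>z. (chart_inv c (fst z), chart_inv d (snd z)))"
    unfolding im
    by (intro continuous_on_Pair continuous_on_compose2[OF continuous_on_chart_inv[OF A c]]
        continuous_on_compose2[OF continuous_on_chart_inv[OF B d]] continuous_intros) auto
  moreover have "(chart_inv c (fst z), chart_inv d (snd z)) = chart_inv e z" if "z \<in> snd e ` fst e" for z
  proof -
    have "fst z \<in> snd c ` fst c" "snd z \<in> snd d ` fst d"
      using that unfolding im by (auto simp only: mem_Times_iff)
    from chart_inv_prod'[OF A c B d this] show ?thesis unfolding e by simp
  qed
  ultimately have cont': "continuous_on (snd e ` fst e) (chart_inv e)"
    by (simp cong: continuous_on_cong)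
  show "homeomorphism (fst e) (snd e ` fst e) (snd e) (chart_inv e)"
  proof (rule homeomorphismI[OF cont cont'])
    show inv: "chart_inv e (snd e x) = x" if "x \<in> fst e" for x
      using that chart_inv_prod[OF A c B d] unfolding e by (auto simp: fst_prod_chart snd_prod_chart)
    show "chart_inv e ` (snd e ` fst e) \<subseteq> fst e" using inv by auto
    show "snd e (chart_inv e y) = y" if "y \<in> snd e ` fst e" for y using that inv by auto
  qed simp
  fix e' assume "e' \<in> prod_atlas A B"
  then obtain c' d' where e': "e' = prod_chart c' d'" and c': "c' \<in> A" and d': "d' \<in> B"
    by (auto simp: prod_atlas_eq)
  let ?S = "snd c ` (fst c \<inter> fst c')" and ?T = "snd d ` (fst d \<inter> fst d')"
  have S: "open ?S"
    by (rule open_chart_image_subset[OF A c]) (auto intro: open_chart_domain[OF A c] open_chart_domain[OF A c'])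
  have T: "open ?T"
    by (rule open_chart_image_subset[OF B d]) (auto intro: open_chart_domain[OF B d] open_chart_domain[OF B d'])
  have "fst e \<inter> fst e' = (fst c \<inter> fst c') \<times> (fst d \<inter> fst d')"
    unfolding e e' fst_prod_chart by blast
  then have im': "snd e ` (fst e \<inter> fst e') = ?S \<times> ?T"
    unfolding e snd_prod_chart by (simp add: map_prod_surj_on[OF refl refl])
  have "smooth_on (?S \<times> ?T) (\<lambda>z. (snd c' (chart_inv c (fst z)), snd d' (chart_inv d (snd z))))"
    by (intro smooth_on_Pair open_Times S T
        smooth_on_compose[OF _ S smooth_on_transition[OF A c c'] smooth_on_fst]
        smooth_on_compose[OF _ T smooth_on_transition[OF B d d'] smooth_on_snd]) auto
  then show "smooth_on (snd e ` (fst e \<inter> fst e')) (snd e' \<circ> chart_inv e)"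
    unfolding im'
  proof (rule smooth_on_cong[OF _ open_Times[OF S T]])
    fix z assume "z \<in> ?S \<times> ?T"
    then have "chart_inv e z = (chart_inv c (fst z), chart_inv d (snd z))"
      using chart_inv_prod'[OF A c B d, of "fst z" "snd z"] unfolding e by auto
    then show "(snd c' (chart_inv c (fst z)), snd d' (chart_inv d (snd z))) = (snd e' \<circ> chart_inv e) z"
      by (simp add: e' prod_chart_def)
  qed
qed

lemma smooth_at_fst:
  assumes A: "smooth_atlas A" and B: "smooth_atlas B"
  shows "smooth_at (prod_atlas A B) A fst z"
proof -
  let ?c = "chart_at A (fst z)" and ?d = "chart_at B (snd z)"
  have c: "?c \<in> A" "fst z \<in> fst ?c" and d: "?d \<in> B" "snd z \<in> fst ?d"
    using chart_at_in_charts_at[OF A] chart_at_in_charts_at[OF B] by (auto simp: charts_at_def)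
  let ?e = "prod_chart ?c ?d"
  have e: "?e \<in> prod_atlas A B" using c(1) d(1) by (rule prod_chart_in_prod_atlas)
  have im: "snd ?e ` fst ?e = (snd ?c ` fst ?c) \<times> (snd ?d ` fst ?d)" by (auto simp: prod_chart_def)
  note o = open_chart_image[OF smooth_atlas_prod[OF A B] e]
  have "smooth_near ?e ?c fst z (fst ?e)"
  proof (rule smooth_nearI[OF smooth_atlas_prod[OF A B] e A c(1) open_chart_domain[OF smooth_atlas_prod[OF A B] e]])
    show "smooth_on (snd ?e ` fst ?e) (local_rep ?e ?c fst)"
      by (rule smooth_on_cong[OF smooth_on_fst[OF o] o])
        (auto simp: im local_rep_def chart_inv_prod[OF A c(1) B d(1)])
  qed (use c d in \<open>auto simp: fst_prod_chart mem_Times_iff\<close>)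
  then show ?thesis by (rule smooth_atI[OF e c(1)])
qed

lemma smooth_at_snd:
  assumes A: "smooth_atlas A" and B: "smooth_atlas B"
  shows "smooth_at (prod_atlas A B) B snd z"
proof -
  let ?c = "chart_at A (fst z)" and ?d = "chart_at B (snd z)"
  have c: "?c \<in> A" "fst z \<in> fst ?c" and d: "?d \<in> B" "snd z \<in> fst ?d"
    using chart_at_in_charts_at[OF A] chart_at_in_charts_at[OF B] by (auto simp: charts_at_def)
  let ?e = "prod_chart ?c ?d"
  have e: "?e \<in> prod_atlas A B" using c(1) d(1) by (rule prod_chart_in_prod_atlas)
  have im: "snd ?e ` fst ?e = (snd ?c ` fst ?c) \<times> (snd ?d ` fst ?d)" by (auto simp: prod_chart_def)
  note o = open_chart_image[OF smooth_atlas_prod[OF A B] e]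
  have "smooth_near ?e ?d snd z (fst ?e)"
  proof (rule smooth_nearI[OF smooth_atlas_prod[OF A B] e B d(1) open_chart_domain[OF smooth_atlas_prod[OF A B] e]])
    show "smooth_on (snd ?e ` fst ?e) (local_rep ?e ?d snd)"
      by (rule smooth_on_cong[OF smooth_on_snd[OF o] o])
        (auto simp: im local_rep_def chart_inv_prod[OF A c(1) B d(1)])
  qed (use c d in \<open>auto simp: fst_prod_chart mem_Times_iff\<close>)
  then show ?thesis by (rule smooth_atI[OF e d(1)])
qed

lemma smooth_at_Pair:
  assumes M: "smooth_atlas M" and A: "smooth_atlas A" and B: "smooth_atlas B"
    and f: "smooth_at M A f p" and g: "smooth_at M B g p"
  shows "smooth_at M (prod_atlas A B) (\<lambda>q. (f q, g q)) p"
proof -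
  let ?b = "chart_at M p" and ?c = "chart_at A (f p)" and ?d = "chart_at B (g p)"
  note ch = chart_at_in_charts_at
  obtain N where N: "smooth_near ?b ?c f p N" using smooth_at_charts[OF M A f ch[OF M] ch[OF A]] by blast
  obtain N' where N': "smooth_near ?b ?d g p N'" using smooth_at_charts[OF M B g ch[OF M] ch[OF B]] by blast
  have NN: "open (N \<inter> N')" "p \<in> N \<inter> N'" using N N' by (auto simp: smooth_near_def)
  note * = smooth_near_subset[OF N NN Int_lower1, unfolded smooth_near_def]
    smooth_near_subset[OF N' NN Int_lower2, unfolded smooth_near_def]
  have b: "?b \<in> M" and c: "?c \<in> A" and d: "?d \<in> B" using ch[OF M] ch[OF A] ch[OF B] by (auto simp: charts_at_def)
  have e: "prod_chart ?c ?d \<in> prod_atlas A B" using c d by (rule prod_chart_in_prod_atlas)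
  have o: "open (snd ?b ` (N \<inter> N'))" using open_chart_image_subset[OF M b] * by blast
  have "smooth_near ?b (prod_chart ?c ?d) (\<lambda>q. (f q, g q)) p (N \<inter> N')"
  proof (rule smooth_nearI[OF M b smooth_atlas_prod[OF A B] e])
    have "local_rep ?b (prod_chart ?c ?d) (\<lambda>q. (f q, g q)) = (\<lambda>x. (local_rep ?b ?c f x, local_rep ?b ?d g x))"
      by (simp add: local_rep_def fun_eq_iff prod_chart_def)
    then show "smooth_on (snd ?b ` (N \<inter> N')) (local_rep ?b (prod_chart ?c ?d) (\<lambda>q. (f q, g q)))"
      using smooth_on_Pair[OF o] * by auto
  qed (use * in \<open>auto simp: fst_prod_chart\<close>)
  then show ?thesis by (rule smooth_atI[OF b e])
qed

lemma chart_inv_UNIV_id: "chart_inv (UNIV, id) = id"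
  by (simp add: chart_inv_def)

lemma smooth_atlas_vec: "smooth_atlas (vec_atlas :: ('a::{locally_convex}, 'a) chart set)"
  by (auto simp: smooth_atlas_def vec_atlas_def chart_inv_UNIV_id homeomorphism_def
      intro!: smooth_on_ident[unfolded id_def[symmetric]] continuous_on_id)

lemma charts_at_vec: "charts_at vec_atlas p = {(UNIV, id)}"
  by (auto simp: charts_at_def vec_atlas_def)

lemma smooth_at_vecD:
  assumes A: "smooth_atlas A" and f: "smooth_at A vec_atlas f p" and c: "c \<in> charts_at A p"
  obtains N where "open N" "p \<in> N" "N \<subseteq> fst c" "smooth_on (snd c ` N) (\<lambda>x. f (chart_inv c x))"
proof -
  obtain N where "smooth_near c (UNIV, id) f p N"
    using smooth_at_charts[OF A smooth_atlas_vec f c] by (auto simp: charts_at_vec)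
  then show ?thesis by (intro that[of N]) (auto simp: smooth_near_def local_rep_def[abs_def])
qed

lemma smooth_at_vecI:
  assumes A: "smooth_atlas A" and c: "c \<in> A"
    and N: "open N" "p \<in> N" "N \<subseteq> fst c" "smooth_on (snd c ` N) (\<lambda>x. f (chart_inv c x))"
  shows "smooth_at A vec_atlas f p"
proof -
  have v: "(UNIV, id) \<in> vec_atlas" by (simp add: vec_atlas_def)
  have "smooth_near c (UNIV, id) f p N"
    by (rule smooth_nearI[OF A c smooth_atlas_vec v]) (use N in \<open>auto simp: local_rep_def[abs_def]\<close>)
  then show ?thesis by (rule smooth_atI[OF c v])
qed

lemma smooth_at_vec_map:
  assumes A: "smooth_atlas A" and f: "smooth_at A vec_atlas f p" and g: "smooth_on U g" "open U" "f p \<in> U"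
  shows "smooth_at A vec_atlas (\<lambda>q. g (f q)) p"
proof (rule smooth_at_compose[OF A smooth_atlas_vec smooth_atlas_vec f])
  show "smooth_at vec_atlas vec_atlas g (f p)"
    by (rule smooth_at_vecI[OF smooth_atlas_vec, of "(UNIV, id)" U])
      (use g in \<open>auto simp: vec_atlas_def chart_inv_UNIV_id\<close>)
qed

lemma smooth_at_vec_add:
  assumes A: "smooth_atlas A" and f: "smooth_at A vec_atlas f p" and g: "smooth_at A vec_atlas g p"
  shows "smooth_at A vec_atlas (\<lambda>q. f q + g q) p"
proof -
  let ?c = "chart_at A p"
  note c = chart_at_in_charts_at[OF A, of p]
  obtain N where N: "open N" "p \<in> N" "N \<subseteq> fst ?c" "smooth_on (snd ?c ` N) (\<lambda>x. f (chart_inv ?c x))"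
    by (rule smooth_at_vecD[OF A f c])
  obtain M where M: "open M" "p \<in> M" "M \<subseteq> fst ?c" "smooth_on (snd ?c ` M) (\<lambda>x. g (chart_inv ?c x))"
    by (rule smooth_at_vecD[OF A g c])
  have o: "open (snd ?c ` (N \<inter> M))"
    using open_chart_image_subset[OF A charts_atD(1)[OF c], of "N \<inter> M"] N M by auto
  show ?thesis
  proof (rule smooth_at_vecI[OF A charts_atD(1)[OF c], of "N \<inter> M"])
    show "smooth_on (snd ?c ` (N \<inter> M)) (\<lambda>x. f (chart_inv ?c x) + g (chart_inv ?c x))"
      by (intro smooth_on_add o smooth_on_subset[OF N(4)] smooth_on_subset[OF M(4)]) auto
  qed (use N M in auto)
qed

lemma smooth_at_vec_scaleR:
  "smooth_atlas A \<Longrightarrow> smooth_at A vec_atlas f p \<Longrightarrow> smooth_at A vec_atlas (\<lambda>q. r *\<^sub>R f q) p"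
  by (rule smooth_at_vec_map[OF _ _ smooth_on_scaleR_const[OF open_UNIV smooth_on_ident[OF open_UNIV]]]) auto

lemma smooth_at_vec_diff:
  "smooth_atlas A \<Longrightarrow> smooth_at A vec_atlas f p \<Longrightarrow> smooth_at A vec_atlas g p \<Longrightarrow>
    smooth_at A vec_atlas (\<lambda>q. f q - g q) p"
  using smooth_at_vec_add[of A f p "\<lambda>q. (-1) *\<^sub>R g q"] smooth_at_vec_scaleR[of A g p "-1"] by simp

subsection \<open>Tangent vectors\<close>

lemma smooth_near_has_dir_deriv:
  assumes "smooth_near c d f p N"
  shows "has_dir_deriv (local_rep c d f) (snd c p) v (dir_deriv (local_rep c d f) (snd c p) v)"
  by (rule smooth_on_has_dir_deriv[of "snd c ` N"]) (use assms in \<open>auto simp: smooth_near_def\<close>)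

text \<open>The chain rule in arbitrary charts. Taking the identity for f or g gives the
  transformation of derivatives under a change of charts.\<close>

lemma dir_deriv_local_rep_compose:
  assumes A: "smooth_atlas A" and B: "smooth_atlas B" and C: "smooth_atlas C"
    and f: "smooth_at A B f p" and g: "smooth_at B C g (f p)"
    and c: "c \<in> charts_at A p" and d: "d \<in> charts_at B (f p)" and e: "e \<in> charts_at C (g (f p))"
  shows "dir_deriv (local_rep c e (\<lambda>q. g (f q))) (snd c p) v =
    dir_deriv (local_rep d e g) (snd d (f p)) (dir_deriv (local_rep c d f) (snd c p) v)"
proof -
  obtain N where N: "smooth_near c d f p N" using smooth_at_charts[OF A B f c d] by blast
  obtain M where M: "smooth_near d e g (f p) M" using smooth_at_charts[OF B C g d e] by blast
  note cA = charts_atD[OF c] and dB = charts_atD[OF d] and eC = charts_atD[OF e]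
  have rep: "local_rep c d f (snd c p) = snd d (f p)"
    by (simp add: local_rep_def atlas_chart(3)[OF A cA])
  have oM: "open (snd d ` M)" using open_chart_image_subset[OF B dB(1)] M by (auto simp: smooth_near_def)
  have "has_dir_deriv (\<lambda>x. local_rep d e g (local_rep c d f x)) (snd c p) v
    (dir_deriv (local_rep d e g) (local_rep c d f (snd c p)) (dir_deriv (local_rep c d f) (snd c p) v))"
    by (rule has_dir_deriv_compose[OF oM _ _ smooth_near_has_dir_deriv[OF N]])
      (use M rep in \<open>auto simp: smooth_near_def\<close>)
  then have "has_dir_deriv (local_rep c e (\<lambda>q. g (f q))) (snd c p) v
    (dir_deriv (local_rep d e g) (local_rep c d f (snd c p)) (dir_deriv (local_rep c d f) (snd c p) v))"
  proof (rule has_dir_deriv_cong)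
    show "open (snd c ` N)" using open_chart_image_subset[OF A cA(1)] N by (auto simp: smooth_near_def)
    show "snd c p \<in> snd c ` N" using N by (auto simp: smooth_near_def)
    fix x assume "x \<in> snd c ` N"
    then show "local_rep d e g (local_rep c d f x) = local_rep c e (\<lambda>q. g (f q)) x"
      using N atlas_chart(3)[OF A cA(1)] atlas_chart(3)[OF B dB(1)]
      by (auto simp: smooth_near_def local_rep_def subset_iff)
  qed
  then show ?thesis unfolding rep by (rule dir_deriv_eq)
qed

lemma local_rep_transition: "local_rep c d (\<lambda>q. q) = snd d \<circ> chart_inv c"
  by (simp add: local_rep_def fun_eq_iff)

lemma linear_dir_deriv_local_rep:
  assumes A: "smooth_atlas A" and B: "smooth_atlas B" and f: "smooth_at A B f p"
    and c: "c \<in> charts_at A p" and d: "d \<in> charts_at B (f p)"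
  shows "linear (dir_deriv (local_rep c d f) (snd c p))"
proof -
  obtain N where N: "smooth_near c d f p N" using smooth_at_charts[OF A B f c d] by blast
  have "open (snd c ` N)" using open_chart_image_subset[OF A charts_atD(1)[OF c]] N by (auto simp: smooth_near_def)
  then show ?thesis
    by (rule linear_dir_deriv) (use N in \<open>auto simp: smooth_near_def\<close>)
qed

lemma dir_deriv_local_rep_id:
  assumes "smooth_atlas A" "c \<in> charts_at A p"
  shows "dir_deriv (local_rep c c (\<lambda>q. q)) (snd c p) v = v"
proof -
  note c = charts_atD[OF assms(2)]
  have "dir_deriv (local_rep c c (\<lambda>q. q)) (snd c p) v = dir_deriv (\<lambda>x. x) (snd c p) v"
    by (rule dir_deriv_cong[OF open_chart_image[OF assms(1) c(1)]])
      (use c atlas_chart(5)[OF assms(1) c(1)] in \<open>auto simp: local_rep_def\<close>)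
  also have "\<dots> = v" by (rule dir_deriv_eq[OF has_dir_deriv_ident])
  finally show ?thesis .
qed

lemma tangent_coordinate:
  "v \<in> tangent_space A p \<Longrightarrow> c \<in> charts_at A p \<Longrightarrow> d \<in> charts_at A p \<Longrightarrow>
    v d = dir_deriv (local_rep c d (\<lambda>q. q)) (snd c p) (v c)"
  unfolding tangent_space_def local_rep_transition by blast

lemma tangent_of_eq: "d \<in> charts_at A p \<Longrightarrow>
    tangent_of A c p x d = dir_deriv (local_rep c d (\<lambda>q. q)) (snd c p) x"
  by (simp add: tangent_of_def local_rep_transition)

lemma tangent_of_in_tangent_space:
  assumes A: "smooth_atlas A" and c: "c \<in> charts_at A p"
  shows "tangent_of A c p x \<in> tangent_space A p"
proof -
  have "tangent_of A c p x e = dir_deriv (snd e \<circ> chart_inv d) (snd d p) (tangent_of A c p x d)"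
    if "d \<in> charts_at A p" "e \<in> charts_at A p" for d e
    unfolding tangent_of_eq[OF that(1)] tangent_of_eq[OF that(2)] local_rep_transition[symmetric]
    by (rule dir_deriv_local_rep_compose[OF A A A smooth_at_id[OF A] smooth_at_id[OF A] c that])
  then show ?thesis unfolding tangent_space_def by (intro CollectI conjI) (blast, simp add: tangent_of_def)
qed

lemma tangent_of_coordinate: "smooth_atlas A \<Longrightarrow> c \<in> charts_at A p \<Longrightarrow> tangent_of A c p x c = x"
  by (simp add: tangent_of_eq dir_deriv_local_rep_id)

lemma tangent_of_tangent:
  assumes "v \<in> tangent_space A p" "c \<in> charts_at A p"
  shows "tangent_of A c p (v c) = v"
proof
  fix d
  show "tangent_of A c p (v c) d = v d"
  proof (cases "d \<in> charts_at A p")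
    case True
    then show ?thesis using tangent_coordinate[OF assms True] by (simp add: tangent_of_eq)
  next
    case False
    then have "v d = 0" using assms(1) unfolding tangent_space_def by blast
    then show ?thesis using False by (simp add: tangent_of_def)
  qed
qed

lemma tangent_eqI:
  "v \<in> tangent_space A p \<Longrightarrow> w \<in> tangent_space A p \<Longrightarrow> c \<in> charts_at A p \<Longrightarrow> v c = w c \<Longrightarrow> v = w"
  by (metis tangent_of_tangent)

lemma tangent_of_linear:
  assumes A: "smooth_atlas A" and c: "c \<in> charts_at A p"
  shows "tangent_of A c p (x + y) = (\<lambda>d. tangent_of A c p x d + tangent_of A c p y d)"
    and "tangent_of A c p (r *\<^sub>R x) = (\<lambda>d. r *\<^sub>R tangent_of A c p x d)"
proof -
  note lin = linear_dir_deriv_local_rep[OF A A smooth_at_id[OF A] c]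
  show "tangent_of A c p (x + y) = (\<lambda>d. tangent_of A c p x d + tangent_of A c p y d)"
  proof
    show "tangent_of A c p (x + y) d = tangent_of A c p x d + tangent_of A c p y d" for d
      by (cases "d \<in> charts_at A p") (simp add: tangent_of_eq linear_add[OF lin], simp add: tangent_of_def)
  qed
  show "tangent_of A c p (r *\<^sub>R x) = (\<lambda>d. r *\<^sub>R tangent_of A c p x d)"
  proof
    show "tangent_of A c p (r *\<^sub>R x) d = r *\<^sub>R tangent_of A c p x d" for d
      by (cases "d \<in> charts_at A p") (simp add: tangent_of_eq linear_scale[OF lin], simp add: tangent_of_def)
  qed
qed

lemma tangent_space_closed:
  assumes A: "smooth_atlas A" and v: "v \<in> tangent_space A p" and w: "w \<in> tangent_space A p"
  shows "(\<lambda>c. v c + w c) \<in> tangent_space A p" and "(\<lambda>c. r *\<^sub>R v c) \<in> tangent_space A p"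
proof -
  let ?c = "chart_at A p"
  note c = chart_at_in_charts_at[OF A, of p]
  show "(\<lambda>c. v c + w c) \<in> tangent_space A p"
    using tangent_of_in_tangent_space[OF A c, of "v ?c + w ?c"]
    unfolding tangent_of_linear(1)[OF A c] tangent_of_tangent[OF v c] tangent_of_tangent[OF w c] .
  show "(\<lambda>c. r *\<^sub>R v c) \<in> tangent_space A p"
    using tangent_of_in_tangent_space[OF A c, of "r *\<^sub>R v ?c"]
    unfolding tangent_of_linear(2)[OF A c] tangent_of_tangent[OF v c] .
qed

text \<open>\<open>tangent_map\<close> is defined with a chosen chart; by the chain rule any chart
  at p gives the same value.\<close>

lemma tangent_map_eq:
  assumes A: "smooth_atlas A" and B: "smooth_atlas B" and f: "smooth_at A B f p"
    and v: "v \<in> tangent_space A p" and c: "c \<in> charts_at A p" and d: "d \<in> charts_at B (f p)"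
  shows "tangent_map A B f p v d = dir_deriv (local_rep c d f) (snd c p) (v c)"
proof -
  let ?c = "chart_at A p"
  note c' = chart_at_in_charts_at[OF A, of p]
  have "tangent_map A B f p v d = dir_deriv (local_rep ?c d f) (snd ?c p) (v ?c)"
    using d by (simp add: tangent_map_def local_rep_def[abs_def] o_def Let_def)
  also have "\<dots> = dir_deriv (local_rep c d f) (snd c p) (v c)"
    using dir_deriv_local_rep_compose[OF A A B smooth_at_id[OF A] f c c' d] tangent_coordinate[OF v c c'] by simp
  finally show ?thesis .
qed

lemma tangent_map_in_tangent_space:
  assumes A: "smooth_atlas A" and B: "smooth_atlas B" and f: "smooth_at A B f p"
    and v: "v \<in> tangent_space A p"
  shows "tangent_map A B f p v \<in> tangent_space B (f p)"
proof -
  let ?c = "chart_at A p"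
  note c = chart_at_in_charts_at[OF A, of p]
  have "tangent_map A B f p v e = dir_deriv (snd e \<circ> chart_inv d) (snd d (f p)) (tangent_map A B f p v d)"
    if "d \<in> charts_at B (f p)" "e \<in> charts_at B (f p)" for d e
    using dir_deriv_local_rep_compose[OF A B B f smooth_at_id[OF B] c that]
    unfolding tangent_map_eq[OF A B f v c that(1)] tangent_map_eq[OF A B f v c that(2)]
      local_rep_transition[symmetric] .
  then show ?thesis unfolding tangent_space_def by (intro CollectI conjI) (blast, simp add: tangent_map_def)
qed

lemma differential_eq:
  assumes A: "smooth_atlas A" and f: "smooth_at A vec_atlas h p"
    and v: "v \<in> tangent_space A p" and c: "c \<in> charts_at A p"
  shows "differential A h p v = dir_deriv (\<lambda>x. h (chart_inv c x)) (snd c p) (v c)"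
proof -
  have vec: "(UNIV, id) \<in> charts_at vec_atlas (h p)" by (simp add: charts_at_vec)
  have "differential A h p v = tangent_map A vec_atlas h p v (UNIV, id)"
    using vec by (simp add: differential_def tangent_map_def)
  also have "\<dots> = dir_deriv (local_rep c (UNIV, id) h) (snd c p) (v c)"
    by (rule tangent_map_eq[OF A smooth_atlas_vec f v c vec])
  finally show ?thesis by (simp add: local_rep_def[abs_def])
qed

lemma smooth_at_nearby:
  assumes "smooth_at A B f p"
  shows "\<exists>N. open N \<and> p \<in> N \<and> (\<forall>q\<in>N. smooth_at A B f q)"
proof -
  obtain c d N where N: "c \<in> A" "d \<in> B" "smooth_near c d f p N"
    using assms unfolding smooth_at_def by blast
  have "smooth_at A B f q" if "q \<in> N" for q
    by (rule smooth_atI[OF N(1,2), of _ _ N]) (use N(3) that in \<open>simp add: smooth_near_def\<close>)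
  then show ?thesis using N(3) by (auto simp: smooth_near_def)
qed

lemma smooth_on_local_rep:
  assumes A: "smooth_atlas A" and B: "smooth_atlas B" and f: "\<And>p. smooth_at A B f p"
    and c: "c \<in> A" and d: "d \<in> B"
  shows "open {x \<in> snd c ` fst c. f (chart_inv c x) \<in> fst d}" (is "open ?S")
    and "smooth_on {x \<in> snd c ` fst c. f (chart_inv c x) \<in> fst d} (local_rep c d f)"
proof -
  have mfd: "mfd_smooth_on A B UNIV f" using mfd_smooth_on_iff[OF A B] f by auto
  have eq: "?S = snd c ` {p \<in> UNIV \<inter> fst c. f p \<in> fst d}"
    using atlas_chart(3)[OF A c] by auto
  have "open (f -` fst d)"
    using mfd continuous_on_open_vimage[OF open_UNIV, of f] open_chart_domain[OF B d]
    unfolding mfd_smooth_on_def by auto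
  moreover have "{p \<in> UNIV \<inter> fst c. f p \<in> fst d} = f -` fst d \<inter> fst c" by auto
  ultimately have "open {p \<in> UNIV \<inter> fst c. f p \<in> fst d}" using open_chart_domain[OF A c] by auto
  then show "open ?S" unfolding eq by (rule open_chart_image_subset[OF A c]) auto
  show "smooth_on ?S (local_rep c d f)"
    using mfd c d unfolding eq mfd_smooth_on_def by (auto simp: local_rep_def[abs_def] o_def)
qed

lemma smooth_on_local_rep2:
  fixes f :: "'m::t2_space \<times> 'n::t2_space \<Rightarrow> 'k::t2_space"
  assumes A: "smooth_atlas A" and B: "smooth_atlas B" and C: "smooth_atlas C"
    and f: "\<And>p. smooth_at (prod_atlas A B) C f p" and c: "c \<in> A" and d: "d \<in> B" and k: "k \<in> C"
  defines "S \<equiv> {z \<in> (snd c ` fst c) \<times> (snd d ` fst d). f (chart_inv c (fst z), chart_inv d (snd z)) \<in> fst k}"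
  shows "open S" and "smooth_on S (\<lambda>z. snd k (f (chart_inv c (fst z), chart_inv d (snd z))))"
proof -
  let ?e = "prod_chart c d"
  note e = prod_chart_in_prod_atlas[OF c d]
  have im: "snd ?e ` fst ?e = (snd c ` fst c) \<times> (snd d ` fst d)" by (auto simp: prod_chart_def)
  have inv: "chart_inv ?e z = (chart_inv c (fst z), chart_inv d (snd z))"
    if "z \<in> (snd c ` fst c) \<times> (snd d ` fst d)" for z
    using chart_inv_prod'[OF A c B d, of "fst z" "snd z"] that by (simp only: mem_Times_iff prod.collapse)
  have S: "{z \<in> snd ?e ` fst ?e. f (chart_inv ?e z) \<in> fst k} = S"
    unfolding im S_def using inv by (intro Collect_cong conj_cong refl) (simp only:)
  show o: "open S"
    using smooth_on_local_rep(1)[OF smooth_atlas_prod[OF A B] C f e k] unfolding S .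
  have "smooth_on S (local_rep ?e k f)"
    using smooth_on_local_rep(2)[OF smooth_atlas_prod[OF A B] C f e k] unfolding S .
  then show "smooth_on S (\<lambda>z. snd k (f (chart_inv c (fst z), chart_inv d (snd z))))"
    by (rule smooth_on_cong[OF _ o]) (simp add: S_def local_rep_def inv)
qed

lemma smooth_at_prod_vecI:
  assumes A: "smooth_atlas A" and B: "smooth_atlas B" and c: "c \<in> charts_at A p" and d: "d \<in> charts_at B q"
    and U: "open U" "U \<subseteq> snd c ` fst c" "snd c p \<in> U" and V: "open V" "V \<subseteq> snd d ` fst d" "snd d q \<in> V"
    and s: "smooth_on (U \<times> V) (\<lambda>z. f (chart_inv c (fst z), chart_inv d (snd z)))"
  shows "smooth_at (prod_atlas A B) vec_atlas f (p, q)"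
proof (rule smooth_at_vecI[OF smooth_atlas_prod[OF A B] prod_chart_in_prod_atlas])
  note cA = charts_atD[OF c] and dB = charts_atD[OF d]
  show "c \<in> A" "d \<in> B" using cA dB by blast+
  let ?M = "snd c -` U \<inter> fst c" and ?N = "snd d -` V \<inter> fst d"
  show "open (?M \<times> ?N)"
    using continuous_on_open_vimage[OF open_chart_domain[OF A cA(1)], THEN iffD1, OF continuous_on_chart[OF A cA(1)]]
      continuous_on_open_vimage[OF open_chart_domain[OF B dB(1)], THEN iffD1, OF continuous_on_chart[OF B dB(1)]]
      U(1) V(1) by (intro open_Times) blast+
  show "(p, q) \<in> ?M \<times> ?N" using U V cA dB by simp
  show "?M \<times> ?N \<subseteq> fst (prod_chart c d)" by (auto simp: fst_prod_chart)
  have "snd c ` ?M = U" "snd d ` ?N = V" using U(2) V(2) by auto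
  then have im: "snd (prod_chart c d) ` (?M \<times> ?N) = U \<times> V"
    unfolding snd_prod_chart by (rule map_prod_surj_on)
  show "smooth_on (snd (prod_chart c d) ` (?M \<times> ?N)) (\<lambda>x. f (chart_inv (prod_chart c d) x))"
    unfolding im
  proof (rule smooth_on_cong[OF s open_Times[OF U(1) V(1)]])
    fix z assume "z \<in> U \<times> V"
    then have "fst z \<in> snd c ` fst c" "snd z \<in> snd d ` fst d" using U(2) V(2) by (auto simp only: mem_Times_iff)
    from chart_inv_prod'[OF A cA(1) B dB(1) this]
    show "f (chart_inv c (fst z), chart_inv d (snd z)) = f (chart_inv (prod_chart c d) z)" by simp
  qed
qed

text \<open>Along a segment in a convex chart domain the increment is a primitive of 0, so it lies
  in every convex neighbourhood of 0 and vanishes. The function is thus locally constant, and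
  preimages of arbitrary sets are open.\<close>

lemma constant_if_dir_deriv_zero:
  fixes \<phi> :: "'m::t2_space \<Rightarrow> 'a::locally_convex" and A :: "('m, 'e::locally_convex) chart set"
  assumes A: "smooth_atlas A" and conn: "connected (UNIV :: 'm set)"
    and D: "\<And>p c v. c \<in> charts_at A p \<Longrightarrow> has_dir_deriv (\<lambda>x. \<phi> (chart_inv c x)) (snd c p) v 0"
  shows "\<phi> p = \<phi> q"
proof -
  have loc: "\<exists>N. open N \<and> p \<in> N \<and> (\<forall>q\<in>N. \<phi> q = \<phi> p)" for p
  proof -
    let ?c = "chart_at A p"
    note c = charts_atD[OF chart_at_in_charts_at[OF A, of p]]
    have "snd ?c p \<in> snd ?c ` fst ?c" using c by blast
    then obtain V where V: "open V" "convex V" "snd ?c p \<in> V" "V \<subseteq> snd ?c ` fst ?c"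
      using convex_neighbourhood[OF open_chart_image[OF A c(1)]] by metis
    have "\<phi> q = \<phi> p" if q: "q \<in> snd ?c -` V \<inter> fst ?c" for q
    proof -
      let ?x = "snd ?c p" and ?y = "snd ?c q"
      let ?I = "\<lambda>t. \<phi> (chart_inv ?c (?x + t *\<^sub>R (?y - ?x))) - \<phi> (chart_inv ?c (?x + 0 *\<^sub>R (?y - ?x)))"
      have "primitive (\<lambda>t. 0) ?I" unfolding primitive_def
      proof (intro conjI allI impI)
        fix t :: real assume t: "0 \<le> t \<and> t \<le> 1"
        have "(1 - t) *\<^sub>R ?x + t *\<^sub>R ?y \<in> V" using V(2,3) q t by (intro convexD) auto
        then have "?x + t *\<^sub>R (?y - ?x) \<in> snd ?c ` fst ?c" using V(4) by (auto simp: algebra_simps)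
        then obtain r where r: "r \<in> fst ?c" "?x + t *\<^sub>R (?y - ?x) = snd ?c r" by blast
        have "has_dir_deriv (\<lambda>x. \<phi> (chart_inv ?c x)) (?x + t *\<^sub>R (?y - ?x)) (?y - ?x) 0"
          unfolding r(2) by (rule D) (use r(1) c(1) in \<open>simp add: charts_at_def\<close>)
        from has_curve_deriv_diff[OF has_curve_deriv_along_line[OF this] has_curve_deriv_const]
        show "has_curve_deriv ?I 0 t {0..1}" by simp
      qed simp
      then have "?I 1 = 0"
        by (intro eq_zero_if_in_neighbourhoods primitive_in[of "\<lambda>t. 0" ?I]) auto
      then show ?thesis using q c atlas_chart(3)[OF A c(1)] by auto
    qed
    moreover have "open (snd ?c -` V \<inter> fst ?c)"
      using continuous_on_open_vimage[OF open_chart_domain[OF A c(1)], THEN iffD1, OF continuous_on_chart[OF A c(1)]] V(1) by blast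
    ultimately show ?thesis using V(3) c by blast
  qed
  have op: "open (\<phi> -` S)" for S
  proof (subst open_subopen, intro ballI)
    fix p assume p: "p \<in> \<phi> -` S"
    from loc[of p] obtain N where N: "open N" "p \<in> N" "\<forall>q\<in>N. \<phi> q = \<phi> p" by (elim exE conjE)
    have "N \<subseteq> \<phi> -` S"
    proof
      fix r assume "r \<in> N"
      then have "\<phi> r = \<phi> p" using N(3) by blast
      then show "r \<in> \<phi> -` S" using p by simp
    qed
    with N(1,2) show "\<exists>T. open T \<and> p \<in> T \<and> T \<subseteq> \<phi> -` S" by blast
  qed
  have "\<phi> -` {\<phi> p} \<inter> UNIV = {} \<or> \<phi> -` (- {\<phi> p}) \<inter> UNIV = {}"
    by (rule connectedD[OF conn op op]) blast+
  then have "q \<in> \<phi> -` {\<phi> p}" by blast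
  then show ?thesis by simp
qed

section \<open>Lie groups and smooth modules\<close>

locale lie_module =
  fixes G :: "'g::t2_space monoid" and A :: "('g, 'e::locally_convex) chart set"
    and \<rho> :: "'g \<Rightarrow> 'a::locally_convex \<Rightarrow> 'a"
  assumes lie: "lie_group A G" and module: "smooth_module A G \<rho>"
begin

abbreviation gmult :: "'g \<Rightarrow> 'g \<Rightarrow> 'g" (infixl "\<odot>" 70) where "g \<odot> h \<equiv> g \<otimes>\<^bsub>G\<^esub> h"
abbreviation gone :: 'g ("\<one>") where "\<one> \<equiv> \<one>\<^bsub>G\<^esub>"
abbreviation ginv :: "'g \<Rightarrow> 'g" where "ginv g \<equiv> inv\<^bsub>G\<^esub> g"

lemma group_G: "group G" and carrier_G [simp]: "carrier G = UNIV" and atlas: "smooth_atlas A"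
  using lie by (simp_all add: lie_group_def)

lemma g_assoc [simp]: "(g \<odot> h) \<odot> k = g \<odot> (h \<odot> k)"
  and g_one [simp]: "\<one> \<odot> g = g" "g \<odot> \<one> = g"
  and g_inv [simp]: "ginv g \<odot> g = \<one>" "g \<odot> ginv g = \<one>"
  and g_inv_cancel [simp]: "ginv g \<odot> (g \<odot> h) = h" "g \<odot> (ginv g \<odot> h) = h"
proof -
  interpret group G by (rule group_G)
  show assoc: "(g \<odot> h) \<odot> k = g \<odot> (h \<odot> k)" for g h k by (rule m_assoc) simp_all
  show one: "\<one> \<odot> g = g" "g \<odot> \<one> = g" for g by simp_all
  show inv: "ginv g \<odot> g = \<one>" "g \<odot> ginv g = \<one>" for g by simp_all
  show "ginv g \<odot> (g \<odot> h) = h" "g \<odot> (ginv g \<odot> h) = h"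
    by (simp_all add: assoc[symmetric] one inv)
qed

lemma \<rho>_linear: "linear (\<rho> g)" and \<rho>_one [simp]: "\<rho> \<one> a = a" and \<rho>_mult: "\<rho> (g \<odot> h) a = \<rho> g (\<rho> h a)"
  using module by (simp_all add: smooth_module_def)

lemma smooth_at_gmult:
  assumes M: "smooth_atlas M" and "smooth_at M A f p" "smooth_at M A k p"
  shows "smooth_at M A (\<lambda>q. f q \<odot> k q) p"
proof -
  have "mfd_smooth_on (prod_atlas A A) A UNIV (\<lambda>(g, h). g \<odot> h)"
    using lie by (simp add: lie_group_def)
  then have "smooth_at (prod_atlas A A) A (\<lambda>(g, h). g \<odot> h) z" for z
    using mfd_smooth_on_iff[OF smooth_atlas_prod[OF atlas atlas] atlas] by blast
  from smooth_at_compose[OF M smooth_atlas_prod[OF atlas atlas] atlas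
      smooth_at_Pair[OF M atlas atlas assms(2,3)] this]
  show ?thesis by simp
qed

lemma smooth_at_ginv:
  assumes M: "smooth_atlas M" and "smooth_at M A f p"
  shows "smooth_at M A (\<lambda>q. ginv (f q)) p"
proof -
  have "smooth_at A A (\<lambda>g. ginv g) z" for z
    using lie mfd_smooth_on_iff[OF atlas atlas] by (auto simp: lie_group_def)
  from smooth_at_compose[OF M atlas atlas assms(2) this] show ?thesis .
qed

lemma smooth_at_action_pair: "smooth_at (prod_atlas A vec_atlas) vec_atlas (\<lambda>(g, a). \<rho> g a) z"
  using module mfd_smooth_on_iff[OF smooth_atlas_prod[OF atlas smooth_atlas_vec] smooth_atlas_vec]
  by (auto simp: smooth_module_def)

lemma smooth_at_action:
  assumes M: "smooth_atlas M" and "smooth_at M A f p" "smooth_at M vec_atlas a p"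
  shows "smooth_at M vec_atlas (\<lambda>q. \<rho> (f q) (a q)) p"
  using smooth_at_compose[OF M smooth_atlas_prod[OF atlas smooth_atlas_vec] smooth_atlas_vec
      smooth_at_Pair[OF M atlas smooth_atlas_vec assms(2,3)] smooth_at_action_pair]
  by simp

lemma smooth_at_left: "smooth_at A A (\<lambda>h. g \<odot> h) p"
  by (rule smooth_at_gmult[OF atlas smooth_at_const[OF atlas atlas] smooth_at_id[OF atlas]])

lemma smooth_on_action_chart:
  assumes c: "c \<in> A"
  shows "smooth_on (snd c ` fst c \<times> UNIV) (\<lambda>z. \<rho> (chart_inv c (fst z)) (snd z))"
proof -
  have v: "(UNIV, id) \<in> (vec_atlas :: ('a, 'a) chart set)" by (simp add: vec_atlas_def)
  have eq: "{z \<in> snd c ` fst c \<times> snd (UNIV, id) ` fst (UNIV, id :: 'a \<Rightarrow> 'a).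
      (\<lambda>(g, a). \<rho> g a) (chart_inv c (fst z), chart_inv (UNIV, id) (snd z)) \<in> fst (UNIV, id :: 'a \<Rightarrow> 'a)}
    = snd c ` fst c \<times> UNIV" by auto
  show ?thesis
    using smooth_on_local_rep2(2)[OF atlas smooth_atlas_vec smooth_atlas_vec smooth_at_action_pair c v v]
    unfolding eq by (simp add: chart_inv_UNIV_id)
qed

lemma has_dir_deriv_\<rho>:
  assumes "has_dir_deriv f x v l"
  shows "has_dir_deriv (\<lambda>x. \<rho> g (f x)) x v (\<rho> g l)"
proof -
  let ?c = "chart_at A g"
  note c = charts_atD[OF chart_at_in_charts_at[OF atlas, of g]]
  have "smooth_on UNIV (\<lambda>a. (\<lambda>z. \<rho> (chart_inv ?c (fst z)) (snd z)) (snd ?c g, a))"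
    by (rule smooth_on_compose[OF open_UNIV _ smooth_on_action_chart[OF c(1)]])
      (use c open_chart_image[OF atlas c(1)] in \<open>auto intro!: open_Times smooth_on_Pair smooth_on_const smooth_on_ident\<close>)
  then have s: "smooth_on UNIV (\<rho> g)" using c atlas_chart(3)[OF atlas c(1)] by simp
  have "dir_deriv (\<rho> g) (f x) l = \<rho> g l"
    by (rule dir_deriv_eq[OF has_dir_deriv_linear[OF \<rho>_linear]])
  then show ?thesis using has_dir_deriv_compose[OF open_UNIV s _ assms] by simp
qed

text \<open>T is open, since it contains xN for each x in T. It is also closed: if x is outside T
  and h is so close to x that h^{-1} x lies in N, then h in T would give x = h (h^{-1} x) in T.
  Closure of T under inverses is therefore no issue.\<close>

lemma submonoid_neighbourhood_eq_UNIV: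
  assumes conn: "connected (UNIV :: 'g set)" and N: "open N" "\<one> \<in> N" "N \<subseteq> T"
    and mult: "\<And>x y. x \<in> T \<Longrightarrow> y \<in> T \<Longrightarrow> x \<odot> y \<in> T"
  shows "T = UNIV"
proof -
  have cont: "continuous_on UNIV (\<lambda>h. g \<odot> h)" "continuous_on UNIV (\<lambda>h. ginv h \<odot> g)" for g
  proof -
    have "mfd_smooth_on A A UNIV (\<lambda>h. g \<odot> h)" "mfd_smooth_on A A UNIV (\<lambda>h. ginv h \<odot> g)"
      unfolding mfd_smooth_on_iff[OF atlas atlas]
      by (auto intro!: smooth_at_left smooth_at_gmult[OF atlas] smooth_at_ginv[OF atlas] smooth_at_const[OF atlas atlas] smooth_at_id[OF atlas])
    then show "continuous_on UNIV (\<lambda>h. g \<odot> h)" "continuous_on UNIV (\<lambda>h. ginv h \<odot> g)"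
      unfolding mfd_smooth_on_def by blast+
  qed
  have "open T"
  proof (subst open_subopen, intro ballI)
    fix x assume x: "x \<in> T"
    have "open ((\<lambda>h. ginv x \<odot> h) -` N)" by (rule open_vimage[OF N(1) cont(1)])
    moreover have "(\<lambda>h. ginv x \<odot> h) -` N \<subseteq> T"
    proof
      fix h assume "h \<in> (\<lambda>h. ginv x \<odot> h) -` N"
      then have "x \<odot> (ginv x \<odot> h) \<in> T" using mult[OF x] N(3) by blast
      then show "h \<in> T" by simp
    qed
    ultimately show "\<exists>S. open S \<and> x \<in> S \<and> S \<subseteq> T" using N(2) by (intro exI conjI) auto
  qed
  moreover have "open (- T)"
  proof (subst open_subopen, intro ballI)
    fix x assume x: "x \<in> - T"
    have "open ((\<lambda>h. ginv h \<odot> x) -` N)" by (rule open_vimage[OF N(1) cont(2)])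
    moreover have "(\<lambda>h. ginv h \<odot> x) -` N \<subseteq> - T"
    proof
      fix h assume h: "h \<in> (\<lambda>h. ginv h \<odot> x) -` N"
      show "h \<in> - T"
      proof
        assume "h \<in> T"
        then have "h \<odot> (ginv h \<odot> x) \<in> T" using mult h N(3) by blast
        then show False using x by simp
      qed
    qed
    ultimately show "\<exists>S. open S \<and> x \<in> S \<and> S \<subseteq> - T" using N(2) by (intro exI conjI) auto
  qed
  ultimately have "T \<inter> UNIV = {} \<or> (- T) \<inter> UNIV = {}"
    by (intro connectedD[OF conn]) auto
  then show ?thesis using N by auto
qed

section \<open>The extension defined by a smooth cocycle\<close>

lemma extension_lie_group:
  assumes f1: "\<And>g. f g \<one> = 0" "\<And>g. f \<one> g = 0"
    and cocycle: "\<And>g g' g''. \<rho> g (f g' g'') - f (g \<odot> g') g'' + f g (g' \<odot> g'') - f g g' = 0"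
    and smooth: "\<And>z. smooth_at (prod_atlas A A) vec_atlas (\<lambda>(g, h). f g h) z"
  shows "lie_group (prod_atlas vec_atlas A) (extension_group G \<rho> f)"
proof -
  let ?G = "extension_group G \<rho> f"
  let ?E = "prod_atlas (vec_atlas :: ('a, 'a) chart set) A"
  have mult: "(a, g) \<otimes>\<^bsub>?G\<^esub> (a', g') = (a + \<rho> g a' + f g g', g \<odot> g')" for a g a' g'
    by (simp add: extension_group_def)
  have one: "\<one>\<^bsub>?G\<^esub> = (0, \<one>)" and car: "carrier ?G = UNIV" by (simp_all add: extension_group_def)

  \<comment> \<open>The cocycle identity at (g^{-1}, g, g^{-1}). It turns the inverse below, written
    with f(g, g^{-1}), into a left inverse, where f(g^{-1}, g) occurs.\<close>
  have inv_cocycle: "\<rho> (ginv g) (f g (ginv g)) = f (ginv g) g" for g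
    using cocycle[of "ginv g" g "ginv g"] by (simp add: f1)
  let ?inv = "\<lambda>(a, g). (- \<rho> (ginv g) (a + f g (ginv g)), ginv g)"
  have l_inv: "?inv x \<otimes>\<^bsub>?G\<^esub> x = \<one>\<^bsub>?G\<^esub>" for x
    by (cases x) (simp add: mult one linear_add[OF \<rho>_linear] inv_cocycle)
  have grp: "group ?G"
  proof (rule groupI)
    fix x y z assume "x \<in> carrier ?G" "y \<in> carrier ?G" "z \<in> carrier ?G"
    obtain a g b h c k where xyz: "x = (a, g)" "y = (b, h)" "z = (c, k)" by (metis surj_pair)
    have "\<rho> g (f h k) + f g (h \<odot> k) = f g h + f (g \<odot> h) k"
      using cocycle[of g h k] by (simp add: algebra_simps)
    then show "x \<otimes>\<^bsub>?G\<^esub> y \<otimes>\<^bsub>?G\<^esub> z = x \<otimes>\<^bsub>?G\<^esub> (y \<otimes>\<^bsub>?G\<^esub> z)"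
      by (simp add: xyz mult linear_add[OF \<rho>_linear] \<rho>_mult add.assoc add.left_commute)
  next
    fix x assume "x \<in> carrier ?G"
    show "\<one>\<^bsub>?G\<^esub> \<otimes>\<^bsub>?G\<^esub> x = x" by (cases x) (simp add: mult one f1)
    show "\<exists>y\<in>carrier ?G. y \<otimes>\<^bsub>?G\<^esub> x = \<one>\<^bsub>?G\<^esub>" using l_inv car by blast
  qed (simp_all add: car)
  have inv_eq: "inv\<^bsub>?G\<^esub> x = ?inv x" for x
    by (rule group.inv_equality[OF grp l_inv]) (simp_all add: car)
  note E = smooth_atlas_prod[OF smooth_atlas_vec atlas]
  note EE = smooth_atlas_prod[OF E E]
  have f_at: "smooth_at M vec_atlas (\<lambda>q. f (u q) (v q)) p"
    if M: "smooth_atlas M" and "smooth_at M A u p" "smooth_at M A v p" for M u v p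
    using smooth_at_compose[OF M smooth_atlas_prod[OF atlas atlas] smooth_atlas_vec
      smooth_at_Pair[OF M atlas atlas that(2,3)] smooth] by simp
  have mult_smooth: "smooth_at (prod_atlas ?E ?E) ?E
      (\<lambda>z. (fst (fst z) + \<rho> (snd (fst z)) (fst (snd z)) + f (snd (fst z)) (snd (snd z)), snd (fst z) \<odot> snd (snd z))) z" for z
  proof -
    note ff = smooth_at_compose[OF EE E smooth_atlas_vec smooth_at_fst[OF E E] smooth_at_fst[OF smooth_atlas_vec atlas], of z]
    note sf = smooth_at_compose[OF EE E atlas smooth_at_fst[OF E E] smooth_at_snd[OF smooth_atlas_vec atlas], of z]
    note fs = smooth_at_compose[OF EE E smooth_atlas_vec smooth_at_snd[OF E E] smooth_at_fst[OF smooth_atlas_vec atlas], of z]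
    note ss = smooth_at_compose[OF EE E atlas smooth_at_snd[OF E E] smooth_at_snd[OF smooth_atlas_vec atlas], of z]
    show ?thesis
      by (rule smooth_at_Pair[OF EE smooth_atlas_vec atlas], rule smooth_at_vec_add[OF EE], rule smooth_at_vec_add[OF EE],
          rule ff, rule smooth_at_action[OF EE], rule sf, rule fs, rule f_at[OF EE], rule sf, rule ss,
          rule smooth_at_gmult[OF EE], rule sf, rule ss)
  qed
  have inv_smooth: "smooth_at ?E ?E (\<lambda>x. ((- 1) *\<^sub>R \<rho> (ginv (snd x)) (fst x + f (snd x) (ginv (snd x))), ginv (snd x))) z" for z
  proof -
    note f1 = smooth_at_fst[OF smooth_atlas_vec atlas, of z] and s1 = smooth_at_snd[OF smooth_atlas_vec atlas, of z]
    show ?thesis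
      by (rule smooth_at_Pair[OF E smooth_atlas_vec atlas], rule smooth_at_vec_scaleR[OF E], rule smooth_at_action[OF E],
          rule smooth_at_ginv[OF E], rule s1, rule smooth_at_vec_add[OF E], rule f1, rule f_at[OF E], rule s1,
          rule smooth_at_ginv[OF E], rule s1, rule smooth_at_ginv[OF E], rule s1)
  qed
  show ?thesis unfolding lie_group_def
  proof (intro conjI grp car E)
    have "(\<lambda>(g, h). g \<otimes>\<^bsub>?G\<^esub> h) = (\<lambda>z. (fst (fst z) + \<rho> (snd (fst z)) (fst (snd z)) + f (snd (fst z)) (snd (snd z)), snd (fst z) \<odot> snd (snd z)))"
      by (auto simp: fun_eq_iff mult)
    then show "mfd_smooth_on (prod_atlas ?E ?E) ?E UNIV (\<lambda>(g, h). g \<otimes>\<^bsub>?G\<^esub> h)"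
      unfolding mfd_smooth_on_iff[OF EE E] using mult_smooth by simp
    have "(\<lambda>g. inv\<^bsub>?G\<^esub> g) = (\<lambda>x. ((- 1) *\<^sub>R \<rho> (ginv (snd x)) (fst x + f (snd x) (ginv (snd x))), ginv (snd x)))"
      by (auto simp: fun_eq_iff inv_eq)
    then show "mfd_smooth_on ?E ?E UNIV (\<lambda>g. inv\<^bsub>?G\<^esub> g)"
      unfolding mfd_smooth_on_iff[OF E E] using inv_smooth by simp
  qed
qed

end

lemma smooth_at_vec_has_dir_deriv:
  assumes A: "smooth_atlas A" and f: "smooth_at A vec_atlas f p" and c: "c \<in> charts_at A p"
  shows "has_dir_deriv (\<lambda>x. f (chart_inv c x)) (snd c p) u (dir_deriv (\<lambda>x. f (chart_inv c x)) (snd c p) u)"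
proof -
  obtain N where "open N" "p \<in> N" "N \<subseteq> fst c" "smooth_on (snd c ` N) (\<lambda>x. f (chart_inv c x))"
    by (rule smooth_at_vecD[OF A f c])
  then show ?thesis by (intro smooth_on_has_dir_deriv[of "snd c ` N"]) auto
qed

lemma has_dir_deriv_vec_compose:
  assumes A: "smooth_atlas A" and B: "smooth_atlas B" and f: "smooth_at A B f p"
    and h: "smooth_at B vec_atlas h (f p)" and c: "c \<in> charts_at A p" and d: "d \<in> charts_at B (f p)"
  shows "has_dir_deriv (\<lambda>x. h (f (chart_inv c x))) (snd c p) u
    (dir_deriv (\<lambda>y. h (chart_inv d y)) (snd d (f p)) (dir_deriv (local_rep c d f) (snd c p) u))"
proof -
  have v: "(UNIV, id) \<in> charts_at vec_atlas (h (f p))" by (simp add: charts_at_vec)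
  show ?thesis
    using smooth_at_vec_has_dir_deriv[OF A smooth_at_compose[OF A B smooth_atlas_vec f h] c, of u]
      dir_deriv_local_rep_compose[OF A B smooth_atlas_vec f h c d v, of u]
    by (simp add: local_rep_def[abs_def])
qed

subsection \<open>One-forms in charts\<close>

definition form_rep ::
  "('m, 'e::locally_convex) chart set \<Rightarrow> ('m \<Rightarrow> ('m, 'e) tangent \<Rightarrow> 'a) \<Rightarrow> ('m, 'e) chart \<Rightarrow> 'e \<times> 'e \<Rightarrow> 'a" where
  "form_rep A \<theta> c z = \<theta> (chart_inv c (fst z)) (tangent_of A c (chart_inv c (fst z)) (snd z))"

lemma smooth_on_form_rep:
  "\<theta> \<in> one_forms A \<Longrightarrow> c \<in> A \<Longrightarrow> smooth_on (snd c ` fst c \<times> UNIV) (form_rep A \<theta> c)"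
  unfolding one_forms_def form_rep_def[abs_def] by (auto simp: Let_def case_prod_beta')

lemma form_rep_tangent_of:
  assumes "smooth_atlas A" "c \<in> charts_at A p"
  shows "form_rep A \<theta> c (snd c p, u) = \<theta> p (tangent_of A c p u)"
  using atlas_chart(3)[OF assms(1) charts_atD[OF assms(2)]] by (simp add: form_rep_def)

lemma form_rep_eq:
  assumes "smooth_atlas A" "c \<in> charts_at A p" "v \<in> tangent_space A p"
  shows "\<theta> p v = form_rep A \<theta> c (snd c p, v c)"
  unfolding form_rep_tangent_of[OF assms(1,2)] tangent_of_tangent[OF assms(3,2)] ..

lemma linear_form_rep:
  assumes A: "smooth_atlas A" and \<theta>: "\<theta> \<in> one_forms A" and c: "c \<in> charts_at A p"
  shows "linear (\<lambda>u. form_rep A \<theta> c (snd c p, u))"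
proof -
  have lin: "linear_on_space (tangent_space A p) (\<theta> p)" using \<theta> unfolding one_forms_def by blast
  show ?thesis
    by (rule linearI)
      (use lin tangent_of_in_tangent_space[OF A c] in
        \<open>simp_all add: form_rep_tangent_of[OF A c] tangent_of_linear[OF A c] linear_on_space_def\<close>)
qed

subsection \<open>The multiplication in charts\<close>

context lie_module
begin

abbreviation c0 :: "('g, 'e) chart" where "c0 \<equiv> chart_at A \<one>"
abbreviation x0 :: 'e where "x0 \<equiv> snd c0 \<one>"

lemma c0_in_charts_at: "c0 \<in> charts_at A \<one>" and c0_in: "c0 \<in> A" and one_in_c0: "\<one> \<in> fst c0"
  using chart_at_in_charts_at[OF atlas, of \<one>] by (simp_all add: charts_at_def)

text \<open>The second factor is always read in the chart at the identity, while the first factor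
  and the product are read in d. Differentiating in the second factor at the identity then gives the
  left invariant fields in every chart.\<close>

definition mult_rep :: "('g, 'e) chart \<Rightarrow> 'e \<times> 'e \<Rightarrow> 'e" where
  "mult_rep d z = snd d (chart_inv d (fst z) \<odot> chart_inv c0 (snd z))"

definition mult_dom :: "('g, 'e) chart \<Rightarrow> ('e \<times> 'e) set" where
  "mult_dom d = {z \<in> (snd d ` fst d) \<times> (snd c0 ` fst c0).
     chart_inv d (fst z) \<odot> chart_inv c0 (snd z) \<in> fst d}"

lemma open_mult_dom: "d \<in> A \<Longrightarrow> open (mult_dom d)"
  and smooth_on_mult_rep: "d \<in> A \<Longrightarrow> smooth_on (mult_dom d) (mult_rep d)"
proof -
  assume d: "d \<in> A"
  have "smooth_at (prod_atlas A A) A (\<lambda>z. fst z \<odot> snd z) z" for z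
    by (rule smooth_at_gmult[OF smooth_atlas_prod[OF atlas atlas] smooth_at_fst[OF atlas atlas] smooth_at_snd[OF atlas atlas]])
  from smooth_on_local_rep2[OF atlas atlas atlas this d c0_in d]
  show "open (mult_dom d)" "smooth_on (mult_dom d) (mult_rep d)"
    unfolding mult_dom_def mult_rep_def[abs_def] by simp_all
qed

lemma dir_deriv_mult_rep:
  "dir_deriv (mult_rep d) (y, x) (0, v) = dir_deriv (local_rep c0 d (\<lambda>q. chart_inv d y \<odot> q)) x v"
  unfolding dir_deriv_def by (simp add: mult_rep_def local_rep_def)

end

section \<open>The group cocycle\<close>

locale integrated_form = lie_module G A \<rho>
  for G :: "'g::t2_space monoid" and A :: "('g, 'e::locally_convex) chart set"
    and \<rho> :: "'g \<Rightarrow> 'a::locally_convex \<Rightarrow> 'a" +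
  fixes \<theta> :: "'g \<Rightarrow> ('g, 'e) tangent \<Rightarrow> 'a"
  assumes conn: "connected (UNIV :: 'g set)"
    and complete: "sequentially_complete (UNIV :: 'a set)"
    and theta: "\<theta> \<in> one_forms A"
    and exact: "\<And>g. exact_form A (\<lambda>p v. pullback A A (\<lambda>x. g \<otimes>\<^bsub>G\<^esub> x) \<theta> p v - \<rho> g (\<theta> p v))"
begin

abbreviation \<Theta> :: "('g, 'e) chart \<Rightarrow> 'e \<times> 'e \<Rightarrow> 'a" where "\<Theta> \<equiv> form_rep A \<theta>"

text \<open>The condition dh = (pullback of \<theta> along left translation by g) - g.\<theta>,
  spelled out for all charts c at p and d at g p. Later arguments can then choose the charts that
  suit them, and the value 0 at the identity fixes the constant.\<close>

definition potential :: "'g \<Rightarrow> ('g \<Rightarrow> 'a) \<Rightarrow> bool" where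
  "potential g h \<longleftrightarrow> (\<forall>p. smooth_at A vec_atlas h p) \<and> h \<one> = 0 \<and>
     (\<forall>p c d u. c \<in> charts_at A p \<longrightarrow> d \<in> charts_at A (g \<odot> p) \<longrightarrow>
       has_dir_deriv (\<lambda>x. h (chart_inv c x)) (snd c p) u
         (\<Theta> d (snd d (g \<odot> p), dir_deriv (local_rep c d (\<lambda>q. g \<odot> q)) (snd c p) u) - \<rho> g (\<Theta> c (snd c p, u))))"

text \<open>\<open>H g p\<close> is the value f(g, p) of the cocycle to be constructed.\<close>

definition H :: "'g \<Rightarrow> 'g \<Rightarrow> 'a" where "H g = (SOME h. potential g h)"

lemma potential_H: "potential g (H g)"
proof -
  obtain h where h: "mfd_smooth_on A vec_atlas UNIV h"
    "\<And>p v. v \<in> tangent_space A p \<Longrightarrow>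
      pullback A A (\<lambda>x. g \<odot> x) \<theta> p v - \<rho> g (\<theta> p v) = differential A h p v"
    using exact[of g] unfolding exact_form_def by blast
  have s: "smooth_at A vec_atlas h p" for p
    using h(1) mfd_smooth_on_iff[OF atlas smooth_atlas_vec] by blast
  have "potential g (\<lambda>p. h p - h \<one>)" unfolding potential_def
  proof (intro conjI allI impI)
    show "smooth_at A vec_atlas (\<lambda>p. h p - h \<one>) p" for p
      by (rule smooth_at_vec_diff[OF atlas s smooth_at_const[OF atlas smooth_atlas_vec]])
    fix p c d u assume c: "c \<in> charts_at A p" and d: "d \<in> charts_at A (g \<odot> p)"
    let ?v = "tangent_of A c p u"
    have v: "?v \<in> tangent_space A p" by (rule tangent_of_in_tangent_space[OF atlas c])
    have vc: "?v c = u" by (rule tangent_of_coordinate[OF atlas c])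
    have "pullback A A (\<lambda>x. g \<odot> x) \<theta> p ?v = \<Theta> d (snd d (g \<odot> p), tangent_map A A (\<lambda>x. g \<odot> x) p ?v d)"
      unfolding pullback_def
      by (rule form_rep_eq[OF atlas d tangent_map_in_tangent_space[OF atlas atlas smooth_at_left v]])
    also have "tangent_map A A (\<lambda>x. g \<odot> x) p ?v d = dir_deriv (local_rep c d (\<lambda>q. g \<odot> q)) (snd c p) u"
      using tangent_map_eq[OF atlas atlas smooth_at_left v c d] vc by simp
    finally have "dir_deriv (\<lambda>x. h (chart_inv c x)) (snd c p) u =
      \<Theta> d (snd d (g \<odot> p), dir_deriv (local_rep c d (\<lambda>q. g \<odot> q)) (snd c p) u) - \<rho> g (\<Theta> c (snd c p, u))"
      using h(2)[OF v] differential_eq[OF atlas s v c] vc form_rep_tangent_of[OF atlas c, of \<theta> u] by simp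
    then have "has_dir_deriv (\<lambda>x. h (chart_inv c x)) (snd c p) u
        (\<Theta> d (snd d (g \<odot> p), dir_deriv (local_rep c d (\<lambda>q. g \<odot> q)) (snd c p) u) - \<rho> g (\<Theta> c (snd c p, u)))"
      using smooth_at_vec_has_dir_deriv[OF atlas s c, of u] by simp
    from has_dir_deriv_diff[OF this has_dir_deriv_const[of "h \<one>"]]
    show "has_dir_deriv (\<lambda>x. h (chart_inv c x) - h \<one>) (snd c p) u
        (\<Theta> d (snd d (g \<odot> p), dir_deriv (local_rep c d (\<lambda>q. g \<odot> q)) (snd c p) u) - \<rho> g (\<Theta> c (snd c p, u)))"
      by simp
  qed simp
  then show ?thesis unfolding H_def by (rule someI[of "potential g"])
qed

lemma smooth_at_H: "smooth_at A vec_atlas (H g) p"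
  and H_one_right [simp]: "H g \<one> = 0"
  and has_dir_deriv_H: "c \<in> charts_at A p \<Longrightarrow> d \<in> charts_at A (g \<odot> p) \<Longrightarrow>
    has_dir_deriv (\<lambda>x. H g (chart_inv c x)) (snd c p) u
      (\<Theta> d (snd d (g \<odot> p), dir_deriv (local_rep c d (\<lambda>q. g \<odot> q)) (snd c p) u) - \<rho> g (\<Theta> c (snd c p, u)))"
  using potential_H[of g] unfolding potential_def by blast+

text \<open>For g = 1 the two parts of the prescribed differential agree, so the primitive is
  constant.\<close>

lemma H_one_left [simp]: "H \<one> p = 0"
proof -
  have "H \<one> p = H \<one> \<one>"
  proof (rule constant_if_dir_deriv_zero[OF atlas conn])
    fix p c u assume c: "c \<in> charts_at A p"
    then have c': "c \<in> charts_at A (\<one> \<odot> p)" by simp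
    have "(\<lambda>q. \<one> \<odot> q) = (\<lambda>q. q)" by simp
    then show "has_dir_deriv (\<lambda>x. H \<one> (chart_inv c x)) (snd c p) u 0"
      using has_dir_deriv_H[OF c c', of u] by (simp add: dir_deriv_local_rep_id[OF atlas c])
  qed
  then show ?thesis by simp
qed

lemma H_cocycle: "\<rho> g (H g' g'') - H (g \<odot> g') g'' + H g (g' \<odot> g'') - H g g' = 0"
proof -
  let ?\<phi> = "\<lambda>p. \<rho> g (H g' p) - H (g \<odot> g') p + H g (g' \<odot> p)"
  have "?\<phi> g'' = ?\<phi> \<one>"
  proof (rule constant_if_dir_deriv_zero[OF atlas conn])
    fix p c u assume c: "c \<in> charts_at A p"
    define d where "d = chart_at A (g' \<odot> p)"
    define k where "k = chart_at A (g \<odot> (g' \<odot> p))"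
    have d: "d \<in> charts_at A (g' \<odot> p)" and k: "k \<in> charts_at A (g \<odot> (g' \<odot> p))"
      and k': "k \<in> charts_at A ((g \<odot> g') \<odot> p)"
      unfolding d_def k_def using chart_at_in_charts_at[OF atlas] by simp_all
    define u' where "u' = dir_deriv (local_rep c d (\<lambda>q. g' \<odot> q)) (snd c p) u"
    \<comment> \<open>\<open>?K\<close> is \<theta> on the translate of u by g g'. Up to sign each
      of \<open>?K\<close>, g.\<theta>(g'.u) and g.(g'.\<theta>(u)) occurs twice in the three
      derivatives, and the alternating sum vanishes.\<close>
    let ?K = "\<Theta> k (snd k (g \<odot> (g' \<odot> p)), dir_deriv (local_rep d k (\<lambda>q. g \<odot> q)) (snd d (g' \<odot> p)) u')"
    have 1: "has_dir_deriv (\<lambda>x. \<rho> g (H g' (chart_inv c x))) (snd c p) u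
      (\<rho> g (\<Theta> d (snd d (g' \<odot> p), u') - \<rho> g' (\<Theta> c (snd c p, u))))"
      unfolding u'_def by (rule has_dir_deriv_\<rho>[OF has_dir_deriv_H[OF c d]])
    have "dir_deriv (local_rep c k (\<lambda>q. g \<odot> g' \<odot> q)) (snd c p) u =
        dir_deriv (local_rep d k (\<lambda>q. g \<odot> q)) (snd d (g' \<odot> p)) u'"
      using dir_deriv_local_rep_compose[OF atlas atlas atlas smooth_at_left[of g'] smooth_at_left[of g] c d k]
      by (simp add: u'_def)
    then have 2: "has_dir_deriv (\<lambda>x. H (g \<odot> g') (chart_inv c x)) (snd c p) u
      (?K - \<rho> g (\<rho> g' (\<Theta> c (snd c p, u))))"
      using has_dir_deriv_H[OF c k', of u] by (simp add: \<rho>_mult)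
    have "dir_deriv (\<lambda>y. H g (chart_inv d y)) (snd d (g' \<odot> p)) u' = ?K - \<rho> g (\<Theta> d (snd d (g' \<odot> p), u'))"
      by (rule dir_deriv_eq[OF has_dir_deriv_H[OF d k]])
    then have 3: "has_dir_deriv (\<lambda>x. H g (g' \<odot> chart_inv c x)) (snd c p) u
      (?K - \<rho> g (\<Theta> d (snd d (g' \<odot> p), u')))"
      using has_dir_deriv_vec_compose[OF atlas atlas smooth_at_left smooth_at_H c d, of g u]
      by (simp add: u'_def)
    from has_dir_deriv_add[OF has_dir_deriv_diff[OF 1 2] 3]
    show "has_dir_deriv (\<lambda>x. ?\<phi> (chart_inv c x)) (snd c p) u 0"
      by (simp add: linear_diff[OF \<rho>_linear])
  qed
  then show ?thesis by (simp add: linear_0[OF \<rho>_linear])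
qed

lemma smooth_at_H_one: "smooth_at (prod_atlas A A) vec_atlas (\<lambda>z. H (fst z) (snd z)) (\<one>, \<one>)"
proof -
  let ?im = "snd c0 ` fst c0" and ?\<mu> = "mult_rep c0" and ?S = "mult_dom c0"
  note inv0 = atlas_chart(3)[OF atlas c0_in one_in_c0]
  have x0: "x0 \<in> ?im" using one_in_c0 by blast
  have "(x0, x0) \<in> ?S" using x0 by (simp add: mult_dom_def inv0 one_in_c0)
  with open_mult_dom[OF c0_in] obtain U V' where UV: "open U" "open V'" "x0 \<in> U" "x0 \<in> V'"
    "\<forall>x\<in>U. \<forall>y\<in>V'. (x, y) \<in> ?S" by (rule open_pair_elim)
  \<comment> \<open>Convexity is needed because f is recovered by integrating along segments from
    x0.\<close>
  from UV(2,4) obtain V where V: "open V" "convex V" "x0 \<in> V" "V \<subseteq> V'" by (rule convex_neighbourhood)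
  have S: "(y, x) \<in> ?S" if "y \<in> U" "x \<in> V" for y x using UV(5) V(4) that by blast
  have Uim: "U \<subseteq> ?im" and Vim: "V \<subseteq> ?im"
    using S[OF _ V(3)] S[OF UV(3)] unfolding mult_dom_def by (simp_all only: subset_iff mem_Collect_eq mem_Sigma_iff) blast+
  let ?T = "U \<times> V \<times> (UNIV :: 'e set)"
  have T: "open ?T" by (intro open_Times UV V open_UNIV)
  \<comment> \<open>The differential of \<open>H g\<close> in the chart, as a function of the
    coordinates of g, the point and the vector. Unlike \<open>H\<close> it is visibly smooth in
    g.\<close>
  let ?B = "\<lambda>z. \<Theta> c0 (?\<mu> (fst z, fst (snd z)), dir_deriv ?\<mu> (fst z, fst (snd z)) (0, snd (snd z)))
    - \<rho> (chart_inv c0 (fst z)) (\<Theta> c0 (fst (snd z), snd (snd z)))"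
  note sm = smooth_on_Pair[OF T] smooth_on_fst_comp[OF T] smooth_on_snd_comp[OF T] smooth_on_fst[OF T]
    smooth_on_snd[OF T] smooth_on_const[OF T]
  have oim: "open (?im \<times> (UNIV :: 'b set))" for ui :: "'b::topological_space itself"
    by (intro open_Times open_chart_image[OF atlas c0_in] open_UNIV)
  have pair: "smooth_on ?T (\<lambda>z. (fst z, fst (snd z)))" "(\<lambda>z. (fst z, fst (snd z))) ` ?T \<subseteq> ?S"
    using S by (auto intro!: sm)
  have \<mu>: "smooth_on ?T (\<lambda>z. ?\<mu> (fst z, fst (snd z)))"
    by (rule smooth_on_compose[OF T open_mult_dom[OF c0_in] smooth_on_mult_rep[OF c0_in] pair])
  have d\<mu>: "smooth_on ?T (\<lambda>z. dir_deriv ?\<mu> (fst z, fst (snd z)) (0, snd (snd z)))"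
    by (rule smooth_on_dir_deriv_comp[OF T open_mult_dom[OF c0_in] smooth_on_mult_rep[OF c0_in] pair])
      (intro sm)
  have 1: "smooth_on ?T (\<lambda>z. \<Theta> c0 (?\<mu> (fst z, fst (snd z)), dir_deriv ?\<mu> (fst z, fst (snd z)) (0, snd (snd z))))"
  proof (rule smooth_on_compose[OF T oim smooth_on_form_rep[OF theta c0_in] smooth_on_Pair[OF T \<mu> d\<mu>]])
    have "?\<mu> (y, x) \<in> ?im" if "y \<in> U" "x \<in> V" for y x
      using S[OF that] by (simp add: mult_dom_def mult_rep_def)
    then show "(\<lambda>z. (?\<mu> (fst z, fst (snd z)), dir_deriv ?\<mu> (fst z, fst (snd z)) (0, snd (snd z)))) ` ?T \<subseteq> ?im \<times> UNIV"
      by auto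
  qed
  have "smooth_on ?T (\<lambda>z. \<Theta> c0 (fst (snd z), snd (snd z)))"
    by (rule smooth_on_compose[OF T oim smooth_on_form_rep[OF theta c0_in]])
      (use Vim in \<open>auto intro!: sm\<close>)
  note pair' = smooth_on_Pair[OF T smooth_on_fst[OF T] this]
  have "(\<lambda>z. (fst z, \<Theta> c0 (fst (snd z), snd (snd z)))) ` ?T \<subseteq> ?im \<times> UNIV" using Uim by auto
  then have 2: "smooth_on ?T (\<lambda>z. \<rho> (chart_inv c0 (fst z)) (\<Theta> c0 (fst (snd z), snd (snd z))))"
    using smooth_on_compose[OF T oim smooth_on_action_chart[OF c0_in] pair'] by simp
  have s: "smooth_on (U \<times> V) (\<lambda>z. H (chart_inv c0 (fst z)) (chart_inv c0 (snd z)))"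
  proof (rule smooth_on_if_partial_deriv_smooth[OF UV(1) V(1-3) complete smooth_on_diff[OF T 1 2]])
    fix y x v assume y: "y \<in> U" and x: "x \<in> V"
    let ?g = "chart_inv c0 y" and ?p = "chart_inv c0 x"
    have yx: "y \<in> ?im" "x \<in> ?im" using x y Uim Vim by blast+
    have p: "c0 \<in> charts_at A ?p" "c0 \<in> charts_at A (?g \<odot> ?p)"
      using S[OF y x] c0_in atlas_chart(4)[OF atlas c0_in] yx by (simp_all add: mult_dom_def charts_at_def)
    show "has_dir_deriv (\<lambda>x. H (chart_inv c0 (fst (y, x))) (chart_inv c0 (snd (y, x)))) x v (?B (y, x, v))"
      using has_dir_deriv_H[OF p, of v] atlas_chart(5)[OF atlas c0_in yx(2)]
      by (simp add: dir_deriv_mult_rep mult_rep_def)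
  qed (simp add: inv0)
  show ?thesis
    by (rule smooth_at_prod_vecI[OF atlas atlas c0_in_charts_at c0_in_charts_at UV(1) Uim UV(3) V(1) Vim V(3)])
      (simp add: s)
qed

lemma smooth_at_H_comp:
  assumes M: "smooth_atlas M" and "smooth_at M A u p" "smooth_at M A v p"
    and "smooth_at (prod_atlas A A) vec_atlas (\<lambda>z. H (fst z) (snd z)) (u p, v p)"
  shows "smooth_at M vec_atlas (\<lambda>q. H (u q) (v q)) p"
  using smooth_at_compose[OF M smooth_atlas_prod[OF atlas atlas] smooth_atlas_vec smooth_at_Pair[OF M atlas atlas assms(2,3)] assms(4)]
  by simp

lemma smooth_at_H_pair: "smooth_at (prod_atlas A A) vec_atlas (\<lambda>z. H (fst z) (snd z)) z"
proof -
  let ?AA = "prod_atlas A A" and ?f = "\<lambda>z. H (fst z) (snd z)"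
  note AA = smooth_atlas_prod[OF atlas atlas]
  note f1 = smooth_at_fst[OF atlas atlas] and s1 = smooth_at_snd[OF atlas atlas] and k1 = smooth_at_const[OF AA atlas]
  note HH = smooth_at_compose[OF AA atlas smooth_atlas_vec _ smooth_at_H]
  obtain W where W: "open W" "(\<one>, \<one>) \<in> W" "\<forall>z\<in>W. smooth_at ?AA vec_atlas ?f z"
    using smooth_at_nearby[OF smooth_at_H_one] by blast
  from W(1,2) obtain N' N where N: "open N'" "open N" "\<one> \<in> N'" "\<one> \<in> N" "\<forall>g\<in>N'. \<forall>x\<in>N. (g, x) \<in> W"
    by (rule open_pair_elim)
  let ?T = "{x. \<forall>g. smooth_at ?AA vec_atlas ?f (g, x)}"
  have "?T = UNIV"
  proof (rule submonoid_neighbourhood_eq_UNIV[OF conn N(2,4)])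
    show "N \<subseteq> ?T"
    proof safe
      fix x g\<^sub>0 assume x: "x \<in> N"
      let ?k = "\<lambda>z. ginv g\<^sub>0 \<odot> fst z"
      \<comment> \<open>The cocycle identity at (g0, k, x) with k = g0^{-1} g. As g tends to g0, k
        tends to 1, where joint smoothness is known; the other two terms contain the fixed function
        \<open>H g\<^sub>0\<close> only.\<close>
      have eq: "?f = (\<lambda>z. \<rho> g\<^sub>0 (H (?k z) (snd z)) + H g\<^sub>0 (?k z \<odot> snd z) - H g\<^sub>0 (?k z))"
      proof
        fix z
        have "\<rho> g\<^sub>0 (H (?k z) (snd z)) + H g\<^sub>0 (?k z \<odot> snd z) - H g\<^sub>0 (?k z) - H (g\<^sub>0 \<odot> ?k z) (snd z) = 0"
          using H_cocycle[of g\<^sub>0 "?k z" "snd z"] by (simp add: algebra_simps)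
        then show "?f z = \<rho> g\<^sub>0 (H (?k z) (snd z)) + H g\<^sub>0 (?k z \<odot> snd z) - H g\<^sub>0 (?k z)" by simp
      qed
      have k: "smooth_at ?AA A ?k (g\<^sub>0, x)" by (rule smooth_at_gmult[OF AA k1 f1])
      have "smooth_at ?AA vec_atlas ?f (?k (g\<^sub>0, x), snd (g\<^sub>0, x))" using W(3) N(3,5) x by simp
      then have "smooth_at ?AA vec_atlas (\<lambda>z. H (?k z) (snd z)) (g\<^sub>0, x)" by (rule smooth_at_H_comp[OF AA k s1])
      then show "smooth_at ?AA vec_atlas ?f (g\<^sub>0, x)"
        unfolding eq
        by (rule smooth_at_vec_diff[OF AA smooth_at_vec_add[OF AA smooth_at_action[OF AA k1] HH[OF smooth_at_gmult[OF AA k s1]]] HH[OF k]])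
    qed
    fix x y assume x: "x \<in> ?T" and y: "y \<in> ?T"
    show "x \<odot> y \<in> ?T"
    proof safe
      fix g\<^sub>0 :: 'g
      let ?w = "\<lambda>z. ginv x \<odot> snd z" and ?p = "(g\<^sub>0, x \<odot> y)"
      \<comment> \<open>The cocycle identity at (g, x, w), where w = x^{-1} z tends to y as the
        second argument z tends to x y. Membership of x and of y in the set handles the outer terms,
        and the middle one uses the single function \<open>H x\<close>.\<close>
      have eq: "?f = (\<lambda>z. H (fst z) x - \<rho> (fst z) (H x (?w z)) + H (fst z \<odot> x) (?w z))"
      proof
        fix z
        have "H (fst z) (x \<odot> ?w z) - (H (fst z) x - \<rho> (fst z) (H x (?w z)) + H (fst z \<odot> x) (?w z)) = 0"
          using H_cocycle[of "fst z" x "?w z"] by (simp add: algebra_simps)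
        then show "?f z = H (fst z) x - \<rho> (fst z) (H x (?w z)) + H (fst z \<odot> x) (?w z)" by simp
      qed
      have w: "smooth_at ?AA A ?w ?p" by (rule smooth_at_gmult[OF AA k1 s1])
      have 1: "smooth_at ?AA vec_atlas (\<lambda>z. H (fst z) x) ?p"
        by (rule smooth_at_H_comp[OF AA f1 k1]) (use x in simp)
      have 2: "smooth_at ?AA vec_atlas (\<lambda>z. H (fst z \<odot> x) (?w z)) ?p"
        by (rule smooth_at_H_comp[OF AA smooth_at_gmult[OF AA f1 k1] w]) (use y in simp)
      show "smooth_at ?AA vec_atlas ?f ?p" unfolding eq
        by (rule smooth_at_vec_add[OF AA smooth_at_vec_diff[OF AA 1 smooth_at_action[OF AA f1 HH[OF w]]] 2])
    qed
  qed
  then show ?thesis by (metis (mono_tags, lifting) UNIV_I mem_Collect_eq surj_pair)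
qed

end

section \<open>The Lie algebra in a chart\<close>

lemma dir_deriv_prod_fst:
  "dir_deriv f (x, y) (v, 0) = dir_deriv (\<lambda>x. f (x, y)) x v"
  unfolding dir_deriv_def by simp

lemma dir_deriv_prod_snd:
  "dir_deriv f (x, y) (0, w) = dir_deriv (\<lambda>y. f (x, y)) y w"
  unfolding dir_deriv_def by simp

context lie_module
begin

abbreviation \<gg> :: "('g, 'e) tangent set" where "\<gg> \<equiv> tangent_space A \<one>"
abbreviation im0 :: "'e set" where "im0 \<equiv> snd c0 ` fst c0"

lemma open_im0: "open im0" and x0_in: "x0 \<in> im0" and inv_x0 [simp]: "chart_inv c0 x0 = \<one>"
  using open_chart_image[OF atlas c0_in] one_in_c0 atlas_chart(3)[OF atlas c0_in one_in_c0] by auto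

text \<open>The left invariant vector field with value w at the identity, read in the chart d.
  Together with \<open>act\<close> and \<open>br\<close> it places the Lie algebra and its
  representation on the model space, through the chart \<open>c0\<close>.\<close>

definition lfield :: "('g, 'e) chart \<Rightarrow> 'e \<Rightarrow> 'e \<Rightarrow> 'e" where
  "lfield d w x = dir_deriv (mult_rep d) (x, x0) (0, w)"

definition act :: "'e \<Rightarrow> 'a \<Rightarrow> 'a" where
  "act w a = dir_deriv (\<lambda>y. \<rho> (chart_inv c0 y) a) x0 w"

definition br :: "'e \<Rightarrow> 'e \<Rightarrow> 'e" where
  "br v w = field_bracket (lfield c0 v) (lfield c0 w) x0"

lemma pair_x0_in_mult_dom: "d \<in> A \<Longrightarrow> x \<in> snd d ` fst d \<Longrightarrow> (x, x0) \<in> mult_dom d"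
  using atlas_chart(4)[OF atlas, of d x] x0_in by (simp add: mult_dom_def)

lemma lfield_eq:
  assumes "c \<in> charts_at A p"
  shows "lfield c w (snd c p) = dir_deriv (local_rep c0 c (\<lambda>q. p \<odot> q)) x0 w"
  unfolding lfield_def dir_deriv_mult_rep atlas_chart(3)[OF atlas charts_atD[OF assms]] ..

lemma linear_lfield:
  assumes "d \<in> A" "x \<in> snd d ` fst d"
  shows "linear (\<lambda>w. lfield d w x)"
proof -
  have "linear (dir_deriv (mult_rep d) (x, x0))"
    by (rule linear_dir_deriv[OF open_mult_dom smooth_on_mult_rep pair_x0_in_mult_dom]) (use assms in auto)
  from linear_add[OF this, of "(0, _)" "(0, _)"] linear_scale[OF this, of _ "(0, _)"]
  show ?thesis unfolding lfield_def by (intro linearI) simp_all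
qed

lemma smooth_on_lfield2:
  assumes d: "d \<in> A"
  shows "smooth_on (snd d ` fst d \<times> UNIV) (\<lambda>z. lfield d (snd z) (fst z))"
proof -
  have o: "open (snd d ` fst d \<times> (UNIV :: 'e set))"
    by (intro open_Times open_chart_image[OF atlas d] open_UNIV)
  show ?thesis unfolding lfield_def
    by (rule smooth_on_dir_deriv_comp[OF o open_mult_dom[OF d] smooth_on_mult_rep[OF d]])
      (use pair_x0_in_mult_dom[OF d] in \<open>auto intro!: smooth_on_Pair o smooth_on_fst smooth_on_snd smooth_on_const\<close>)
qed

lemma smooth_on_lfield:
  assumes d: "d \<in> A"
  shows "smooth_on (snd d ` fst d) (lfield d w)"
proof -
  note o = open_chart_image[OF atlas d]
  have "smooth_on (snd d ` fst d) (\<lambda>x. (\<lambda>z. lfield d (snd z) (fst z)) (x, w))"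
    by (rule smooth_on_compose[OF o _ smooth_on_lfield2[OF d]])
      (auto intro!: open_Times o smooth_on_Pair smooth_on_ident smooth_on_const)
  then show ?thesis by simp
qed

text \<open>Associativity g (p q) = (g p) q, differentiated in q at the identity by the chain
  rule.\<close>

lemma lfield_left_invariant:
  assumes c: "c \<in> charts_at A p" and d: "d \<in> charts_at A (g \<odot> p)"
  shows "lfield d w (snd d (g \<odot> p)) = dir_deriv (local_rep c d (\<lambda>q. g \<odot> q)) (snd c p) (lfield c w (snd c p))"
proof -
  have "c \<in> charts_at A (p \<odot> \<one>)" "d \<in> charts_at A (g \<odot> (p \<odot> \<one>))" using c d by simp_all
  note compose = dir_deriv_local_rep_compose[OF atlas atlas atlas smooth_at_left smooth_at_left c0_in_charts_at this, of w]
  have assoc: "(\<lambda>q. g \<odot> p \<odot> q) = (\<lambda>q. g \<odot> (p \<odot> q))" by (rule ext) (rule g_assoc)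
  show ?thesis unfolding lfield_eq[OF c] lfield_eq[OF d] assoc compose g_one ..
qed

lemma lfield_transition:
  assumes "c \<in> charts_at A p" "d \<in> charts_at A p"
  shows "lfield d w (snd d p) = dir_deriv (local_rep c d (\<lambda>q. q)) (snd c p) (lfield c w (snd c p))"
  using lfield_left_invariant[of c p d \<one> w] assms by simp

lemma lfield_x0 [simp]: "lfield c0 w x0 = w"
  using lfield_eq[OF c0_in_charts_at] dir_deriv_local_rep_id[OF atlas c0_in_charts_at] by simp

lemma left_translate_coordinate:
  assumes "v \<in> \<gg>" "d \<in> charts_at A g"
  shows "left_translate A G g v d = lfield d (v c0) (snd d g)"
  using tangent_map_eq[OF atlas atlas smooth_at_left assms(1) c0_in_charts_at, of d g] assms(2)
  by (simp add: left_translate_def lfield_eq)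

lemma left_translate_one: "v \<in> \<gg> \<Longrightarrow> left_translate A G \<one> v = v"
  using tangent_eqI[OF _ _ c0_in_charts_at, of "left_translate A G \<one> v" v]
    tangent_map_in_tangent_space[OF atlas atlas smooth_at_left, of v \<one> \<one>]
    left_translate_coordinate[OF _ c0_in_charts_at, of v]
  by (simp add: left_translate_def)

lemma lie_bracket_coordinate:
  assumes v: "v \<in> \<gg>" and w: "w \<in> \<gg>" and c: "c \<in> charts_at A \<one>"
  shows "lie_bracket A G v w c = field_bracket (lfield c (v c0)) (lfield c (w c0)) (snd c \<one>)"
proof -
  note cA = charts_atD[OF c]
  have eq: "left_translate A G (chart_inv c y) u c = lfield c (u c0) y" if "u \<in> \<gg>" "y \<in> snd c ` fst c" for u y
    using left_translate_coordinate[OF that(1), of c "chart_inv c y"] atlas_chart(4,5)[OF atlas cA(1) that(2)] cA(1)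
    by (simp add: charts_at_def)
  have D: "dir_deriv (\<lambda>y. left_translate A G (chart_inv c y) u c) (snd c \<one>) z = dir_deriv (lfield c (u c0)) (snd c \<one>) z"
    if "u \<in> \<gg>" for u z
    by (rule dir_deriv_cong[OF open_chart_image[OF atlas cA(1)]]) (use cA(2) eq[OF that] in auto)
  have at: "left_translate A G \<one> u c = lfield c (u c0) (snd c \<one>)" if "u \<in> \<gg>" for u
    by (rule left_translate_coordinate[OF that c])
  show ?thesis
    unfolding lie_bracket_def vf_bracket_def field_bracket_def
    using c by (simp only: D[OF v] D[OF w] at[OF v] at[OF w] if_True)
qed

lemma lie_bracket_c0: "v \<in> \<gg> \<Longrightarrow> w \<in> \<gg> \<Longrightarrow> lie_bracket A G v w c0 = br (v c0) (w c0)"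
  unfolding br_def by (rule lie_bracket_coordinate[OF _ _ c0_in_charts_at])

text \<open>\<open>lie_bracket\<close> is computed in each chart separately. That the results form
  one tangent vector holds because the left invariant fields in two charts are related by the chart
  change.\<close>

lemma lie_bracket_in:
  assumes v: "v \<in> \<gg>" and w: "w \<in> \<gg>"
  shows "lie_bracket A G v w \<in> \<gg>"
proof -
  have "lie_bracket A G v w d = dir_deriv (snd d \<circ> chart_inv c) (snd c \<one>) (lie_bracket A G v w c)"
    if c: "c \<in> charts_at A \<one>" and d: "d \<in> charts_at A \<one>" for c d
  proof -
    note cA = charts_atD[OF c] and dA = charts_atD[OF d]
    let ?\<tau> = "local_rep c d (\<lambda>q. q)" and ?N = "snd c ` (fst c \<inter> fst d)" and ?N' = "snd d ` fst d"
    have \<tau>: "?\<tau> (snd c \<one>) = snd d \<one>" by (simp add: local_rep_def atlas_chart(3)[OF atlas cA])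
    have rel: "lfield d u (?\<tau> z) = dir_deriv ?\<tau> z (lfield c u z)" if "z \<in> ?N" for u z
    proof -
      from that obtain p where p: "p \<in> fst c" "p \<in> fst d" "z = snd c p" by blast
      then show ?thesis
        using lfield_transition[of c p d u] cA(1) dA(1)
        by (simp add: charts_at_def local_rep_def atlas_chart(3)[OF atlas cA(1) p(1)])
    qed
    have "field_bracket (lfield d (v c0)) (lfield d (w c0)) (?\<tau> (snd c \<one>)) =
      dir_deriv ?\<tau> (snd c \<one>) (field_bracket (lfield c (v c0)) (lfield c (w c0)) (snd c \<one>))"
    proof (rule field_bracket_related[where N = ?N and N' = ?N'])
      show "open ?N"
        by (rule open_chart_image_subset[OF atlas cA(1)])
          (auto intro: open_chart_domain[OF atlas cA(1)] open_chart_domain[OF atlas dA(1)])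
      show "open ?N'" by (rule open_chart_image[OF atlas dA(1)])
      show "smooth_on ?N ?\<tau>" using smooth_on_transition[OF atlas cA(1) dA(1)] by (simp add: local_rep_def[abs_def])
      show "?\<tau> ` ?N \<subseteq> ?N'" using atlas_chart(3)[OF atlas cA(1)] by (auto simp: local_rep_def)
      show "smooth_on ?N (lfield c (v c0))" "smooth_on ?N (lfield c (w c0))"
        by (rule smooth_on_subset[OF smooth_on_lfield[OF cA(1)]]; blast)+
      show "smooth_on ?N' (lfield d (v c0))" "smooth_on ?N' (lfield d (w c0))"
        by (rule smooth_on_lfield[OF dA(1)])+
      show "snd c \<one> \<in> ?N" using cA dA by blast
    qed (rule rel, assumption)+
    then show ?thesis
      unfolding lie_bracket_coordinate[OF v w c] lie_bracket_coordinate[OF v w d]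
        local_rep_transition[symmetric] \<tau> .
  qed
  then show ?thesis unfolding tangent_space_def
    by (intro CollectI conjI) (blast, simp add: lie_bracket_def vf_bracket_def)
qed

text \<open>The bracket of left invariant fields is left invariant: translation by the point with
  coordinate x carries the fields to themselves and the identity to that point. This is the closure
  required for the Jacobi identity.\<close>

lemma field_bracket_lfield:
  assumes x: "x \<in> im0"
  shows "field_bracket (lfield c0 v) (lfield c0 w) x = lfield c0 (br v w) x"
proof -
  let ?g = "chart_inv c0 x" and ?N = "{z \<in> im0. chart_inv c0 x \<odot> chart_inv c0 z \<in> fst c0}"
  let ?\<tau> = "local_rep c0 c0 (\<lambda>q. ?g \<odot> q)"
  have g: "?g \<in> fst c0" "snd c0 ?g = x" using atlas_chart(4,5)[OF atlas c0_in x] .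
  then have gc: "c0 \<in> charts_at A ?g" using c0_in by (simp add: charts_at_def)
  have \<tau>: "?\<tau> x0 = x" using g by (simp add: local_rep_def)
  have rel: "lfield c0 u (?\<tau> z) = dir_deriv ?\<tau> z (lfield c0 u z)" if z: "z \<in> ?N" for u z
  proof -
    have p: "chart_inv c0 z \<in> fst c0" "snd c0 (chart_inv c0 z) = z" using z atlas_chart(4,5)[OF atlas c0_in] by auto
    then have "c0 \<in> charts_at A (chart_inv c0 z)" "c0 \<in> charts_at A (?g \<odot> chart_inv c0 z)"
      using z c0_in by (auto simp: charts_at_def)
    from lfield_left_invariant[OF this, of u] p show ?thesis by (simp add: local_rep_def)
  qed
  have "field_bracket (lfield c0 v) (lfield c0 w) (?\<tau> x0) = dir_deriv ?\<tau> x0 (field_bracket (lfield c0 v) (lfield c0 w) x0)"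
  proof (rule field_bracket_related[where N = ?N and N' = im0])
    show "open ?N" by (rule smooth_on_local_rep(1)[OF atlas atlas smooth_at_left c0_in c0_in])
    show "smooth_on ?N ?\<tau>" by (rule smooth_on_local_rep(2)[OF atlas atlas smooth_at_left c0_in c0_in])
    show "?\<tau> ` ?N \<subseteq> im0" by (auto simp: local_rep_def)
    show "smooth_on ?N (lfield c0 v)" "smooth_on ?N (lfield c0 w)"
      by (rule smooth_on_subset[OF smooth_on_lfield[OF c0_in]]; blast)+
    show "x0 \<in> ?N" using x0_in g by simp
  qed (rule rel smooth_on_lfield[OF c0_in] open_im0, assumption?)+
  then show ?thesis
    unfolding \<tau> using lfield_eq[OF gc, of "br v w"] g(2) by (simp add: br_def)
qed

lemma br_eq: "br v w = dir_deriv (lfield c0 w) x0 v - dir_deriv (lfield c0 v) x0 w"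
  by (simp add: br_def field_bracket_def)

lemma br_Jacobi: "br u (br v w) + br v (br w u) + br w (br u v) = 0"
  by (rule field_bracket_Jacobi[where X = "lfield c0" and b = "\<lambda>v w. dir_deriv (lfield c0 w) x0 v",
        OF open_im0 x0_in smooth_on_lfield[OF c0_in] lfield_x0 refl br_eq field_bracket_lfield])

lemma br_swap: "br v w = - br w v"
  by (simp add: br_eq)

lemma linear_br: "linear (br v)"
proof (rule linearI)
  have lin: "linear (dir_deriv (lfield c0 v) x0)"
    by (rule linear_dir_deriv[OF open_im0 smooth_on_lfield[OF c0_in] x0_in])
  note D = smooth_on_has_dir_deriv[OF smooth_on_lfield[OF c0_in] x0_in]
  fix w w' and r :: real
  have "dir_deriv (lfield c0 (w + w')) x0 v = dir_deriv (\<lambda>x. lfield c0 w x + lfield c0 w' x) x0 v"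
    by (rule dir_deriv_cong[OF open_im0 x0_in linear_add[OF linear_lfield[OF c0_in]]])
  then show "br v (w + w') = br v w + br v w'"
    by (simp add: br_eq linear_add[OF lin] dir_deriv_eq[OF has_dir_deriv_add[OF D D]])
  have "dir_deriv (lfield c0 (r *\<^sub>R w)) x0 v = dir_deriv (\<lambda>x. r *\<^sub>R lfield c0 w x) x0 v"
    by (rule dir_deriv_cong[OF open_im0 x0_in linear_scale[OF linear_lfield[OF c0_in]]])
  then show "br v (r *\<^sub>R w) = r *\<^sub>R br v w"
    by (simp add: br_eq linear_scale[OF lin] dir_deriv_eq[OF has_dir_deriv_scaleR[OF D]] scaleR_diff_right)
qed

text \<open>Treating w as a second variable of the left invariant field makes continuity in both
  arguments a property of one joint derivative. The continuity of \<open>act\<close> is obtained in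
  the same way.\<close>

lemma continuous_on_br:
  fixes S :: "'x::topological_space set"
  assumes "continuous_on S v" "continuous_on S w"
  shows "continuous_on S (\<lambda>s. br (v s) (w s))"
proof -
  let ?L = "\<lambda>z. lfield c0 (snd z) (fst z)"
  have D: "continuous_on S (\<lambda>s. dir_deriv (lfield c0 (b s)) x0 (a s))" if "continuous_on S a" "continuous_on S b" for a b
  proof -
    have "continuous_on S (\<lambda>s. (\<lambda>(x, v). dir_deriv ?L x v) ((x0, b s), (a s, 0)))"
      by (rule continuous_on_compose2[OF continuous_on_dir_deriv[OF smooth_on_lfield2[OF c0_in]]])
        (use x0_in that in \<open>auto intro!: continuous_intros\<close>)
    then show ?thesis by (simp add: dir_deriv_prod_fst)
  qed
  show ?thesis unfolding br_eq by (intro continuous_on_diff D assms)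
qed

subsection \<open>The derived representation\<close>

lemma derived_action_eq: "derived_action A G \<rho> x a = act (x c0) a"
  by (simp add: derived_action_def differential_def act_def o_def Let_def)

lemma smooth_on_orbit: "smooth_on im0 (\<lambda>y. \<rho> (chart_inv c0 y) a)"
proof -
  have "smooth_on im0 (\<lambda>y. (\<lambda>z. \<rho> (chart_inv c0 (fst z)) (snd z)) (y, a))"
    by (rule smooth_on_compose[OF open_im0 _ smooth_on_action_chart[OF c0_in]])
      (auto intro!: open_Times open_im0 smooth_on_Pair smooth_on_ident smooth_on_const)
  then show ?thesis by simp
qed

lemma has_dir_deriv_orbit: "has_dir_deriv (\<lambda>y. \<rho> (chart_inv c0 y) a) x0 w (act w a)"
  unfolding act_def by (rule smooth_on_has_dir_deriv[OF smooth_on_orbit x0_in])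

lemma linear_act_left: "linear (\<lambda>w. act w a)"
  using linear_dir_deriv[OF open_im0 smooth_on_orbit x0_in, of a] unfolding act_def[abs_def] .

lemma linear_act: "linear (act w)"
proof (rule linearI)
  fix a b and r :: real
  show "act w (a + b) = act w a + act w b"
    using has_dir_deriv_add[OF has_dir_deriv_orbit[of a w] has_dir_deriv_orbit[of b w]] has_dir_deriv_orbit[of "a + b" w]
    by (simp add: linear_add[OF \<rho>_linear] has_dir_deriv_unique)
  show "act w (r *\<^sub>R a) = r *\<^sub>R act w a"
    using has_dir_deriv_scaleR[OF has_dir_deriv_orbit[of a w], of r] has_dir_deriv_orbit[of "r *\<^sub>R a" w]
    by (simp add: linear_scale[OF \<rho>_linear] has_dir_deriv_unique)
qed

lemma continuous_on_act:
  fixes S :: "'x::topological_space set"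
  assumes "continuous_on S v" "continuous_on S a"
  shows "continuous_on S (\<lambda>s. act (v s) (a s))"
proof -
  let ?R = "\<lambda>z. \<rho> (chart_inv c0 (fst z)) (snd z)"
  have "continuous_on S (\<lambda>s. (\<lambda>(x, v). dir_deriv ?R x v) ((x0, a s), (v s, 0)))"
    by (rule continuous_on_compose2[OF continuous_on_dir_deriv[OF smooth_on_action_chart[OF c0_in]]])
      (use x0_in assms in \<open>auto intro!: continuous_intros\<close>)
  then show ?thesis by (simp add: dir_deriv_prod_fst act_def)
qed

text \<open>The derivative of q -> \<rho>(g q) a at the identity, computed once by the chain rule
  through left translation and once through \<rho>(g q) = \<rho>(g) \<rho>(q).\<close>

lemma dir_deriv_orbit_lfield:
  assumes x: "x \<in> im0"
  shows "dir_deriv (\<lambda>y. \<rho> (chart_inv c0 y) a) x (lfield c0 w x) = \<rho> (chart_inv c0 x) (act w a)"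
proof -
  let ?g = "chart_inv c0 x"
  have g: "?g \<in> fst c0" "snd c0 ?g = x" using atlas_chart(4,5)[OF atlas c0_in x] .
  then have gc: "c0 \<in> charts_at A ?g" and gc': "c0 \<in> charts_at A (?g \<odot> \<one>)" using c0_in by (simp_all add: charts_at_def)
  have s: "smooth_at A vec_atlas (\<lambda>g. \<rho> g a) p" for p
    by (rule smooth_at_action[OF atlas smooth_at_id[OF atlas] smooth_at_const[OF atlas smooth_atlas_vec]])
  have "has_dir_deriv (\<lambda>y. \<rho> (?g \<odot> chart_inv c0 y) a) x0 w
    (dir_deriv (\<lambda>y. \<rho> (chart_inv c0 y) a) (snd c0 (?g \<odot> \<one>)) (dir_deriv (local_rep c0 c0 (\<lambda>q. ?g \<odot> q)) x0 w))"
    by (rule has_dir_deriv_vec_compose[OF atlas atlas smooth_at_left s c0_in_charts_at gc'])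
  moreover have "has_dir_deriv (\<lambda>y. \<rho> (?g \<odot> chart_inv c0 y) a) x0 w (\<rho> ?g (act w a))"
    unfolding \<rho>_mult by (rule has_dir_deriv_\<rho>[OF has_dir_deriv_orbit])
  ultimately show ?thesis
    using has_dir_deriv_unique lfield_eq[OF gc, of w] g(2) by fastforce
qed

text \<open>By the previous lemma \<open>act v (act w a)\<close> is the derivative of the orbit
  map's derivative along a left invariant field. This is a symmetric second derivative plus a term
  in the derivative of that field; antisymmetrizing leaves the bracket.\<close>

lemma act_br: "act (br v w) a = act v (act w a) - act w (act v a)"
proof -
  let ?R = "\<lambda>a y. \<rho> (chart_inv c0 y) a"
  have key: "act v (act w a) = dir_deriv (\<lambda>z. dir_deriv (?R a) z w) x0 v + act (dir_deriv (lfield c0 w) x0 v) a" for v w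
  proof -
    have "has_dir_deriv (\<lambda>z. dir_deriv (?R a) z (lfield c0 w z)) x0 v
      (dir_deriv (\<lambda>z. dir_deriv (?R a) z (lfield c0 w x0)) x0 v + dir_deriv (?R a) x0 (dir_deriv (lfield c0 w) x0 v))"
      by (rule has_dir_deriv_of_dir_deriv[OF open_im0 smooth_on_orbit x0_in has_dir_deriv_ident
            smooth_on_has_dir_deriv[OF smooth_on_lfield[OF c0_in] x0_in]])
    then have "has_dir_deriv (?R (act w a)) x0 v
      (dir_deriv (\<lambda>z. dir_deriv (?R a) z (lfield c0 w x0)) x0 v + dir_deriv (?R a) x0 (dir_deriv (lfield c0 w) x0 v))"
      by (rule has_dir_deriv_cong[OF _ open_im0 x0_in]) (rule dir_deriv_orbit_lfield)
    from has_dir_deriv_unique[OF has_dir_deriv_orbit this] show ?thesis by (simp add: act_def[of _ a])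
  qed
  have "dir_deriv (\<lambda>z. dir_deriv (?R a) z w) x0 v = dir_deriv (\<lambda>z. dir_deriv (?R a) z v) x0 w"
    by (rule dir_deriv_commute[OF open_im0 smooth_on_orbit x0_in])
  then show ?thesis
    unfolding br_eq key[of v w] key[of w v] linear_diff[OF linear_act_left] by simp
qed

section \<open>Cochains\<close>

lemma continuous_on_coordinate [continuous_intros]:
  "continuous_on S u \<Longrightarrow> continuous_on S (\<lambda>s. (u s :: ('g, 'e) tangent) c)"
  by (rule continuous_on_product_then_coordinatewise)

lemma linear_on_spaceI:
  assumes "linear B" "\<And>x. x \<in> \<gg> \<Longrightarrow> f x = B (x c0)"
  shows "linear_on_space \<gg> f"
  unfolding linear_on_space_def
  using tangent_space_closed[OF atlas] by (simp add: assms(2) linear_add[OF assms(1)] linear_scale[OF assms(1)])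

text \<open>\<open>tangent_of A c0 \<one>\<close> identifies the model space with \<gg>, so
  linearity and continuity of a cochain become ordinary statements on the model space.\<close>

definition coord :: "(('g, 'e) tangent \<Rightarrow> 'a) \<Rightarrow> 'e \<Rightarrow> 'a" where
  "coord l u = l (tangent_of A c0 \<one> u)"

lemma coord_eq: "x \<in> \<gg> \<Longrightarrow> l x = coord l (x c0)"
  unfolding coord_def tangent_of_tangent[OF _ c0_in_charts_at] ..

lemma linear_coord:
  assumes "linear_on_space \<gg> l"
  shows "linear (coord l)"
  using assms tangent_of_in_tangent_space[OF atlas c0_in_charts_at]
  by (intro linearI) (simp_all add: coord_def tangent_of_linear[OF atlas c0_in_charts_at] linear_on_space_def)

text \<open>Tangent vectors carry the product topology, so each coordinate is checked on its own: it
  is a derivative of a chart change, or 0.\<close>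

lemma continuous_on_tangent_of: "continuous_on UNIV (tangent_of A c0 \<one>)"
proof (rule continuous_on_coordinatewise_then_product)
  fix d
  show "continuous_on UNIV (\<lambda>u. tangent_of A c0 \<one> u d)"
  proof (cases "d \<in> charts_at A \<one>")
    case True
    obtain N where N: "smooth_near c0 d (\<lambda>q. q) \<one> N"
      using smooth_at_charts[OF atlas atlas smooth_at_id[OF atlas] c0_in_charts_at True] by blast
    have "continuous_on UNIV (\<lambda>u. (\<lambda>(x, v). dir_deriv (local_rep c0 d (\<lambda>q. q)) x v) (x0, u))"
      by (rule continuous_on_compose2[OF continuous_on_dir_deriv[of "snd c0 ` N"]])
        (use N in \<open>auto simp: smooth_near_def intro!: continuous_intros\<close>)
    then show ?thesis by (simp add: tangent_of_eq[OF True])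
  next
    case False
    then show ?thesis by (simp add: tangent_of_def)
  qed
qed

lemma cochain1_coord:
  assumes "l \<in> lie_cochains1 A G"
  shows "linear (coord l)" "continuous_on UNIV (coord l)"
proof -
  show "linear (coord l)" using assms unfolding lie_cochains1_def by (blast intro: linear_coord)
  have "continuous_on UNIV (\<lambda>u. l (tangent_of A c0 \<one> u))"
    by (rule continuous_on_compose2[OF _ continuous_on_tangent_of])
      (use assms tangent_of_in_tangent_space[OF atlas c0_in_charts_at] in \<open>auto simp: lie_cochains1_def\<close>)
  then show "continuous_on UNIV (coord l)" by (simp add: coord_def[abs_def])
qed

lemma cochain1I:
  assumes "linear k" "continuous_on UNIV k" "\<And>x. x \<in> \<gg> \<Longrightarrow> l x = k (x c0)"
  shows "l \<in> lie_cochains1 A G"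
proof -
  have "continuous_on \<gg> (\<lambda>x. k (x c0))"
    by (rule continuous_on_compose2[OF assms(2)]) (auto intro!: continuous_intros)
  then have "continuous_on \<gg> l" by (simp cong: continuous_on_cong add: assms(3))
  then show ?thesis unfolding lie_cochains1_def using linear_on_spaceI[OF assms(1), of l, OF assms(3)] by blast
qed

definition cob :: "('e \<Rightarrow> 'a) \<Rightarrow> 'e \<Rightarrow> 'e \<Rightarrow> 'a" where
  "cob k v w = act v (k w) - act w (k v) - k (br v w)"

lemma lie_coboundary1_eq:
  assumes "x \<in> \<gg>" "y \<in> \<gg>"
  shows "lie_coboundary1 A G \<rho> l x y = cob (coord l) (x c0) (y c0)"
  unfolding lie_coboundary1_def cob_def derived_action_eq coord_eq[of _ l, OF assms(1)] coord_eq[of _ l, OF assms(2)]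
    coord_eq[of _ l, OF lie_bracket_in[OF assms]] lie_bracket_c0[OF assms] ..

lemma linear_cob:
  assumes k: "linear k"
  shows "linear (cob k v)"
  by (rule linearI)
    (simp_all add: cob_def linear_add[OF k] linear_scale[OF k] linear_add[OF linear_act] linear_scale[OF linear_act]
      linear_add[OF linear_act_left] linear_scale[OF linear_act_left] linear_add[OF linear_br] linear_scale[OF linear_br]
      algebra_simps)

lemma cob_swap: "linear k \<Longrightarrow> cob k v w = - cob k w v"
  using br_swap[of v w] by (simp add: cob_def linear_neg)

text \<open>The square of the differential is 0. The terms with two actions cancel against
  \<open>act_br\<close>, the mixed terms cancel in pairs, and the Jacobi identity removes the terms
  with two brackets.\<close>

lemma cob_closed:
  assumes k: "linear k"
  shows "act u (cob k v w) + act v (cob k w u) + act w (cob k u v)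
    - cob k (br u v) w - cob k (br v w) u - cob k (br w u) v = 0"
proof -
  have "k (br (br u v) w) + k (br (br v w) u) + k (br (br w u) v) = - k (br u (br v w) + br v (br w u) + br w (br u v))"
    using br_swap[of "br u v" w] br_swap[of "br v w" u] br_swap[of "br w u" v]
    by (simp add: linear_neg[OF k] linear_add[OF k])
  then have J: "k (br (br u v) w) + k (br (br v w) u) + k (br (br w u) v) = 0"
    unfolding br_Jacobi by (simp add: linear_0[OF k])
  show ?thesis
    unfolding cob_def act_br linear_diff[OF linear_act] using J by (simp add: algebra_simps)
qed

text \<open>Needed since \<open>lie_cohomologous\<close> relates cocycles only: D f is known as
  \<omega> minus a coboundary, and from this it inherits the cocycle property.\<close>

lemma lie_coboundary1_cocycle:
  assumes l: "l \<in> lie_cochains1 A G"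
  shows "lie_coboundary1 A G \<rho> l \<in> lie_cocycles2 A G \<rho>"
proof -
  note k = cochain1_coord[OF l]
  let ?d = "lie_coboundary1 A G \<rho> l" and ?k = "coord l"
  have neg: "linear (\<lambda>v. cob ?k v w)" for w
  proof -
    have "linear (\<lambda>v. - cob ?k w v)"
      using linear_cob[OF k(1), of w] by (simp add: linear_iff)
    then show ?thesis using cob_swap[OF k(1), of _ w] by simp
  qed
  have "alternating_on_space \<gg> ?d" unfolding alternating_on_space_def
  proof (intro conjI ballI)
    fix v assume v: "v \<in> \<gg>"
    show "linear_on_space \<gg> (?d v)"
      by (rule linear_on_spaceI[OF linear_cob[OF k(1), of "v c0"]]) (rule lie_coboundary1_eq[OF v])
    show "linear_on_space \<gg> (\<lambda>u. ?d u v)"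
      by (rule linear_on_spaceI[OF neg[of "v c0"]]) (rule lie_coboundary1_eq[OF _ v])
    have "br (v c0) (v c0) = 0" by (simp add: br_eq)
    then show "?d v v = 0" using lie_coboundary1_eq[OF v v] by (simp add: cob_def linear_0[OF k(1)])
  qed
  moreover have "continuous_on (\<gg> \<times> \<gg>) (\<lambda>(x, y). ?d x y)"
  proof -
    have kc: "continuous_on S (\<lambda>s. ?k (u s))" if "continuous_on S u" for S :: "(('g, 'e) tangent \<times> ('g, 'e) tangent) set" and u
      by (rule continuous_on_compose2[OF k(2) that]) simp
    have "continuous_on (\<gg> \<times> \<gg>) (\<lambda>z. cob ?k (fst z c0) (snd z c0))"
      unfolding cob_def by (intro continuous_on_diff continuous_on_act kc continuous_on_br continuous_intros)
    moreover have "cob ?k (fst z c0) (snd z c0) = (\<lambda>(x, y). ?d x y) z" if "z \<in> \<gg> \<times> \<gg>" for z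
      using that lie_coboundary1_eq by auto
    ultimately show ?thesis by (simp cong: continuous_on_cong)
  qed
  moreover have "derived_action A G \<rho> x (?d y z) + derived_action A G \<rho> y (?d z x) + derived_action A G \<rho> z (?d x y)
     - ?d (lie_bracket A G x y) z - ?d (lie_bracket A G y z) x - ?d (lie_bracket A G z x) y = 0"
    if x: "x \<in> \<gg>" and y: "y \<in> \<gg>" and z: "z \<in> \<gg>" for x y z
    using cob_closed[OF k(1), of "x c0" "y c0" "z c0"] x y z
    by (simp add: derived_action_eq lie_coboundary1_eq lie_bracket_in lie_bracket_c0)
  ultimately show ?thesis unfolding lie_cocycles2_def by (simp add: Let_def)
qed

lemma cocycle_diff:
  assumes \<omega>: "\<omega> \<in> lie_cocycles2 A G \<rho>" and \<zeta>: "\<zeta> \<in> lie_cocycles2 A G \<rho>"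
    and \<eta>: "\<And>x y. x \<in> \<gg> \<Longrightarrow> y \<in> \<gg> \<Longrightarrow> \<eta> x y = \<omega> x y - \<zeta> x y"
  shows "\<eta> \<in> lie_cocycles2 A G \<rho>"
proof -
  note c\<omega> = \<omega>[unfolded lie_cocycles2_def Let_def mem_Collect_eq] and c\<zeta> = \<zeta>[unfolded lie_cocycles2_def Let_def mem_Collect_eq]
  have "alternating_on_space \<gg> \<eta>"
    using c\<omega> c\<zeta> tangent_space_closed[OF atlas]
    unfolding alternating_on_space_def linear_on_space_def
    by (simp add: \<eta> algebra_simps)
  moreover have "continuous_on (\<gg> \<times> \<gg>) (\<lambda>(x, y). \<eta> x y)"
  proof -
    have "continuous_on (\<gg> \<times> \<gg>) (\<lambda>z. (\<lambda>(x, y). \<omega> x y) z - (\<lambda>(x, y). \<zeta> x y) z)"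
      using c\<omega> c\<zeta> by (intro continuous_on_diff) blast+
    moreover have "(\<lambda>(x, y). \<omega> x y) z - (\<lambda>(x, y). \<zeta> x y) z = (\<lambda>(x, y). \<eta> x y) z" if "z \<in> \<gg> \<times> \<gg>" for z
      using that \<eta> by auto
    ultimately show ?thesis by (simp cong: continuous_on_cong)
  qed
  moreover have "derived_action A G \<rho> x (\<eta> y z) + derived_action A G \<rho> y (\<eta> z x) + derived_action A G \<rho> z (\<eta> x y)
     - \<eta> (lie_bracket A G x y) z - \<eta> (lie_bracket A G y z) x - \<eta> (lie_bracket A G z x) y = 0"
    if x: "x \<in> \<gg>" and y: "y \<in> \<gg>" and z: "z \<in> \<gg>" for x y z
  proof -
    let ?c = "\<lambda>\<omega>. derived_action A G \<rho> x (\<omega> y z) + derived_action A G \<rho> y (\<omega> z x) + derived_action A G \<rho> z (\<omega> x y)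
     - \<omega> (lie_bracket A G x y) z - \<omega> (lie_bracket A G y z) x - \<omega> (lie_bracket A G z x) y"
    have "?c \<omega> = 0" "?c \<zeta> = 0" using c\<omega> c\<zeta> x y z by blast+
    moreover have "?c \<eta> = ?c \<omega> - ?c \<zeta>"
      using x y z by (simp add: \<eta> lie_bracket_in derived_action_eq linear_diff[OF linear_act])
    ultimately show ?thesis by simp
  qed
  ultimately show ?thesis unfolding lie_cocycles2_def by (simp add: Let_def)
qed

text \<open>A class is the image of a relation, so equality of classes needs both inclusions. The
  scalar r is 1 for one and -1 for the other.\<close>

lemma lie_cohomologous_shift:
  assumes \<omega>: "\<omega> \<in> lie_cocycles2 A G \<rho>" and l: "l \<in> lie_cochains1 A G"
    and d: "\<And>x y. x \<in> \<gg> \<Longrightarrow> y \<in> \<gg> \<Longrightarrow> \<omega> x y - \<eta> x y = r *\<^sub>R lie_coboundary1 A G \<rho> l x y"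
    and \<eta>: "(\<eta>, \<omega>') \<in> lie_cohomologous A G \<rho>"
  shows "(\<omega>, \<omega>') \<in> lie_cohomologous A G \<rho>"
proof -
  obtain l' where *: "\<omega>' \<in> lie_cocycles2 A G \<rho>" "l' \<in> lie_cochains1 A G"
    "\<And>x y. x \<in> \<gg> \<Longrightarrow> y \<in> \<gg> \<Longrightarrow> \<omega>' x y - \<eta> x y = lie_coboundary1 A G \<rho> l' x y"
    using \<eta> unfolding lie_cohomologous_def by blast
  note kl = cochain1_coord[OF l] and kl' = cochain1_coord[OF *(2)]
  let ?l = "\<lambda>x. l' x - r *\<^sub>R l x" and ?k = "\<lambda>u. coord l' u - r *\<^sub>R coord l u"
  have c: "coord ?l = ?k" by (simp add: coord_def fun_eq_iff)
  have lin: "linear ?k" using kl(1) kl'(1) by (simp add: linear_iff algebra_simps)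
  have "?l \<in> lie_cochains1 A G"
    by (rule cochain1I[OF lin]) (use kl(2) kl'(2) coord_eq in \<open>auto intro!: continuous_intros\<close>)
  moreover have "\<omega>' x y - \<omega> x y = lie_coboundary1 A G \<rho> ?l x y" if xy: "x \<in> \<gg>" "y \<in> \<gg>" for x y
  proof -
    have "lie_coboundary1 A G \<rho> ?l x y = lie_coboundary1 A G \<rho> l' x y - r *\<^sub>R lie_coboundary1 A G \<rho> l x y"
      by (simp add: lie_coboundary1_eq xy c cob_def linear_diff[OF linear_act] linear_scale[OF linear_act] algebra_simps)
    then show ?thesis unfolding *(3)[OF xy, symmetric] d[OF xy, symmetric] by simp
  qed
  ultimately show ?thesis using *(1) \<omega> unfolding lie_cohomologous_def by blast
qed

lemma lie_class_eq:
  assumes "\<eta> \<in> lie_cocycles2 A G \<rho>" "\<omega> \<in> lie_cocycles2 A G \<rho>" and l: "l \<in> lie_cochains1 A G"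
    and d: "\<And>x y. x \<in> \<gg> \<Longrightarrow> y \<in> \<gg> \<Longrightarrow> \<omega> x y - \<eta> x y = lie_coboundary1 A G \<rho> l x y"
  shows "lie_class A G \<rho> \<eta> = lie_class A G \<rho> \<omega>"
proof -
  have "\<eta> x y - \<omega> x y = (- 1) *\<^sub>R lie_coboundary1 A G \<rho> l x y" if "x \<in> \<gg>" "y \<in> \<gg>" for x y
    using d[OF that] by (metis minus_diff_eq scaleR_minus1_left)
  then have "(\<omega>, \<omega>') \<in> lie_cohomologous A G \<rho> \<Longrightarrow> (\<eta>, \<omega>') \<in> lie_cohomologous A G \<rho>" for \<omega>'
    by (rule lie_cohomologous_shift[OF assms(1) l])
  moreover have "(\<eta>, \<omega>') \<in> lie_cohomologous A G \<rho> \<Longrightarrow> (\<omega>, \<omega>') \<in> lie_cohomologous A G \<rho>" for \<omega>'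
    using lie_cohomologous_shift[OF assms(2) l, of \<eta> 1 \<omega>'] d by simp
  ultimately show ?thesis unfolding lie_class_def by blast
qed

end

section \<open>The derivative of the group cocycle\<close>

lemma curve_through_smooth_at:
  assumes A: "smooth_atlas A" and \<gamma>: "curve_through A p v \<gamma>"
  shows "smooth_at vec_atlas A \<gamma> 0" "\<gamma> 0 = p"
    and "c \<in> charts_at A p \<Longrightarrow> has_dir_deriv (\<lambda>t. snd c (\<gamma> t)) 0 1 (v c)"
proof -
  obtain e where e: "e > 0" "mfd_smooth_on vec_atlas A {-e<..<e} \<gamma>"
    using \<gamma> unfolding curve_through_def by blast
  show s: "smooth_at vec_atlas A \<gamma> 0"
    using e(2)[unfolded mfd_smooth_on_iff[OF smooth_atlas_vec A]] e(1) by simp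
  show \<gamma>0: "\<gamma> 0 = p" using \<gamma> unfolding curve_through_def by blast
  assume c: "c \<in> charts_at A p"
  obtain N where N: "smooth_near (UNIV, id) c \<gamma> 0 N"
    using smooth_at_charts[OF smooth_atlas_vec A s, of "(UNIV, id)" c] c \<gamma>0 by (auto simp: charts_at_vec)
  have "dir_deriv (\<lambda>t. snd c (\<gamma> t)) 0 1 = v c"
    using \<gamma> c unfolding curve_through_def by (simp add: o_def)
  then show "has_dir_deriv (\<lambda>t. snd c (\<gamma> t)) 0 1 (v c)"
    using smooth_near_has_dir_deriv[OF N, of 1] by (simp add: local_rep_def[abs_def] chart_inv_UNIV_id)
qed

text \<open>A straight line in a chart. Without such curves the description in
  \<open>second_deriv_one\<close> would be satisfied vacuously by every value.\<close>

lemma curve_through_exists: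
  assumes A: "smooth_atlas A" and v: "v \<in> tangent_space A p"
  shows "\<exists>\<gamma>. curve_through A p v \<gamma>"
proof -
  let ?c = "chart_at A p"
  note c = chart_at_in_charts_at[OF A, of p] and cA = charts_atD[OF chart_at_in_charts_at[OF A, of p]]
  let ?x = "snd ?c p"
  define \<gamma> where "\<gamma> t = chart_inv ?c (snd ?c p + t *\<^sub>R v ?c)" for t :: real
  have vec: "(UNIV, id) \<in> vec_atlas" by (simp add: vec_atlas_def)
  have "?x \<in> snd ?c ` fst ?c" using cA by blast
  from eventually_add_scaleR_in[OF open_chart_image[OF A cA(1)] this, of "v ?c"]
  obtain e where e: "e > 0" "\<forall>t. \<bar>t\<bar> < e \<longrightarrow> ?x + t *\<^sub>R v ?c \<in> snd ?c ` fst ?c"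
    unfolding eventually_nhds_metric dist_real_def by auto
  let ?I = "{-e<..<e}"
  have im: "?x + t *\<^sub>R v ?c \<in> snd ?c ` fst ?c" if "t \<in> ?I" for t using e(2) that by (auto simp: abs_less_iff)
  have line: "smooth_on S (\<lambda>t. ?x + t *\<^sub>R v ?c)" if "open S" for S :: "real set"
    by (intro smooth_on_add smooth_on_scaleR smooth_on_const smooth_on_ident that)
  have near: "smooth_near (UNIV, id) ?c \<gamma> t ?I" if t: "t \<in> ?I" for t
  proof (rule smooth_nearI[OF smooth_atlas_vec vec A cA(1)])
    show "\<gamma> ` ?I \<subseteq> fst ?c" using im atlas_chart(4)[OF A cA(1)] unfolding \<gamma>_def by blast
    have "smooth_on ?I (local_rep (UNIV, id) ?c \<gamma>)"
    proof (rule smooth_on_cong[OF line])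
      show "?x + t *\<^sub>R v ?c = local_rep (UNIV, id) ?c \<gamma> t" if "t \<in> ?I" for t
        using atlas_chart(5)[OF A cA(1) im[OF that]] by (simp add: local_rep_def chart_inv_UNIV_id \<gamma>_def)
    qed simp_all
    then show "smooth_on (snd (UNIV, id) ` ?I) (local_rep (UNIV, id) ?c \<gamma>)" by simp
  qed (use t in auto)
  have s: "smooth_at vec_atlas A \<gamma> t" if "t \<in> ?I" for t
    by (rule smooth_atI[OF vec cA(1) near[OF that]])
  have s0: "smooth_at vec_atlas A \<gamma> 0" using s e(1) by simp
  have \<gamma>0: "\<gamma> 0 = p" using atlas_chart(3)[OF A cA] by (simp add: \<gamma>_def)
  have D0: "dir_deriv (local_rep (UNIV, id) ?c \<gamma>) 0 1 = v ?c"
  proof -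
    have "dir_deriv (local_rep (UNIV, id) ?c \<gamma>) 0 1 = dir_deriv (\<lambda>t. ?x + t *\<^sub>R v ?c) 0 1"
    proof (rule dir_deriv_cong[of ?I])
      show "local_rep (UNIV, id) ?c \<gamma> t = ?x + t *\<^sub>R v ?c" if "t \<in> ?I" for t
        using atlas_chart(5)[OF A cA(1) im[OF that]] by (simp add: local_rep_def chart_inv_UNIV_id \<gamma>_def)
    qed (use e(1) in simp_all)
    also have "has_dir_deriv (\<lambda>t::real. ?x + t *\<^sub>R v ?c) 0 1 (0 + (1 *\<^sub>R v ?c + 0 *\<^sub>R 0))"
      by (intro has_dir_deriv_add has_dir_deriv_const has_dir_deriv_prod_scaleR has_dir_deriv_ident)
    then have "dir_deriv (\<lambda>t::real. ?x + t *\<^sub>R v ?c) 0 1 = v ?c" using dir_deriv_eq by fastforce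
    finally show ?thesis .
  qed
  have "dir_deriv (snd d \<circ> \<gamma>) 0 1 = v d" if d: "d \<in> charts_at A p" for d
  proof -
    have vec0: "(UNIV, id) \<in> charts_at vec_atlas (0::real)" by (simp add: charts_at_vec)
    have ch: "?c \<in> charts_at A (\<gamma> 0)" "d \<in> charts_at A (\<gamma> 0)"
      unfolding \<gamma>0 by (rule c, rule d)
    have "dir_deriv (local_rep (UNIV, id) d \<gamma>) 0 1 =
      dir_deriv (local_rep ?c d (\<lambda>q. q)) (snd ?c (\<gamma> 0)) (dir_deriv (local_rep (UNIV, id) ?c \<gamma>) 0 1)"
      using dir_deriv_local_rep_compose[OF smooth_atlas_vec A A s0 smooth_at_id[OF A] vec0 ch, of 1]
      unfolding snd_conv id_apply .
    then have "dir_deriv (local_rep (UNIV, id) d \<gamma>) 0 1 = v d"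
      unfolding \<gamma>0 using D0 tangent_coordinate[OF v c d] by simp
    then show ?thesis by (simp add: local_rep_def[abs_def] chart_inv_UNIV_id o_def)
  qed
  moreover have "mfd_smooth_on vec_atlas A ?I \<gamma>"
    unfolding mfd_smooth_on_iff[OF smooth_atlas_vec A] using s by simp
  ultimately have "curve_through A p v \<gamma>" unfolding curve_through_def using e(1) \<gamma>0 by blast
  then show ?thesis by blast
qed

context integrated_form
begin

text \<open>The inner derivative in the definition of D f is \<theta>(g.w) - g.\<theta>(w). Points g
  in the domain of \<open>c0\<close> suffice, since the outer derivative is taken at the
  identity.\<close>

lemma dir_deriv_H_curve:
  assumes \<gamma>: "curve_through A \<one> w \<gamma>" and g: "g \<in> fst c0"
  shows "dir_deriv (\<lambda>t. H g (\<gamma> t)) 0 1 =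
    \<Theta> c0 (snd c0 g, lfield c0 (w c0) (snd c0 g)) - \<rho> g (\<Theta> c0 (x0, w c0))"
proof -
  note * = curve_through_smooth_at[OF atlas \<gamma>]
  have vec: "(UNIV, id) \<in> charts_at vec_atlas (0::real)" by (simp add: charts_at_vec)
  have gc: "c0 \<in> charts_at A (g \<odot> \<one>)" and gc': "c0 \<in> charts_at A g" using g c0_in by (simp_all add: charts_at_def)
  have c0: "c0 \<in> charts_at A (\<gamma> 0)" using c0_in_charts_at *(2) by simp
  have "dir_deriv (local_rep (UNIV, id) c0 \<gamma>) 0 1 = w c0"
    using dir_deriv_eq[OF *(3)[OF c0_in_charts_at]] by (simp add: local_rep_def[abs_def] chart_inv_UNIV_id)
  then have "has_dir_deriv (\<lambda>t. H g (\<gamma> t)) 0 1 (dir_deriv (\<lambda>y. H g (chart_inv c0 y)) x0 (w c0))"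
    using has_dir_deriv_vec_compose[OF smooth_atlas_vec atlas *(1) smooth_at_H vec c0, of g 1] *(2)
    by (simp add: chart_inv_UNIV_id)
  then have "dir_deriv (\<lambda>t. H g (\<gamma> t)) 0 1 = dir_deriv (\<lambda>y. H g (chart_inv c0 y)) x0 (w c0)" by (rule dir_deriv_eq)
  also have "\<dots> = \<Theta> c0 (snd c0 g, lfield c0 (w c0) (snd c0 g)) - \<rho> g (\<Theta> c0 (x0, w c0))"
    using dir_deriv_eq[OF has_dir_deriv_H[OF c0_in_charts_at gc]] by (simp add: lfield_eq[OF gc'])
  finally show ?thesis .
qed

lemma smooth_on_\<Theta>_lfield: "smooth_on im0 (\<lambda>z. \<Theta> c0 (z, lfield c0 w z))"
  by (rule smooth_on_compose[OF open_im0 _ smooth_on_form_rep[OF theta c0_in]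
        smooth_on_Pair[OF open_im0 smooth_on_ident[OF open_im0] smooth_on_lfield[OF c0_in]]])
    (auto intro!: open_Times open_im0)

lemma second_deriv_one_H:
  assumes v: "v \<in> \<gg>" and w: "w \<in> \<gg>"
  shows "second_deriv_one A G H v w =
    dir_deriv (\<lambda>z. \<Theta> c0 (z, lfield c0 (w c0) z)) x0 (v c0) - act (v c0) (\<Theta> c0 (x0, w c0))"
    (is "_ = ?D")
proof -
  have val: "dir_deriv (\<lambda>s. dir_deriv (\<lambda>t. H (\<gamma>x s) (\<gamma>y t)) 0 1) 0 1 = ?D"
    if \<gamma>: "curve_through A \<one> v \<gamma>x" "curve_through A \<one> w \<gamma>y" for \<gamma>x \<gamma>y :: "real \<Rightarrow> 'g"
  proof -
    let ?k = "\<lambda>z. \<Theta> c0 (z, lfield c0 (w c0) z) - \<rho> (chart_inv c0 z) (\<Theta> c0 (x0, w c0))"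
    note * = curve_through_smooth_at[OF atlas \<gamma>(1)]
    have k: "smooth_on im0 ?k" by (rule smooth_on_diff[OF open_im0 smooth_on_\<Theta>_lfield smooth_on_orbit])
    have "c0 \<in> charts_at A (\<gamma>x 0)" using c0_in_charts_at *(2) by simp
    then obtain N where "smooth_near (UNIV, id) c0 \<gamma>x 0 N"
      using smooth_at_charts[OF smooth_atlas_vec atlas *(1), of "(UNIV, id)" c0] by (auto simp: charts_at_vec)
    then have N: "open N" "0 \<in> N" "\<gamma>x ` N \<subseteq> fst c0" by (auto simp: smooth_near_def)
    have inner: "?k (snd c0 (\<gamma>x s)) = dir_deriv (\<lambda>t. H (\<gamma>x s) (\<gamma>y t)) 0 1" if "s \<in> N" for s
    proof -
      have "\<gamma>x s \<in> fst c0" using N that by blast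
      then show ?thesis by (simp add: dir_deriv_H_curve[OF \<gamma>(2)] atlas_chart(3)[OF atlas c0_in])
    qed
    have "has_dir_deriv (\<lambda>s. ?k (snd c0 (\<gamma>x s))) 0 1 (dir_deriv ?k (snd c0 (\<gamma>x 0)) (v c0))"
      by (rule has_dir_deriv_compose[OF open_im0 k _ *(3)[OF c0_in_charts_at]]) (use *(2) x0_in in simp)
    then have "has_dir_deriv (\<lambda>s. dir_deriv (\<lambda>t. H (\<gamma>x s) (\<gamma>y t)) 0 1) 0 1 (dir_deriv ?k (snd c0 (\<gamma>x 0)) (v c0))"
      by (rule has_dir_deriv_cong[OF _ N(1,2) inner])
    then have "dir_deriv (\<lambda>s. dir_deriv (\<lambda>t. H (\<gamma>x s) (\<gamma>y t)) 0 1) 0 1 = dir_deriv ?k x0 (v c0)"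
      using *(2) dir_deriv_eq by fastforce
    also have "\<dots> = ?D"
      by (rule dir_deriv_eq[OF has_dir_deriv_diff[OF smooth_on_has_dir_deriv[OF smooth_on_\<Theta>_lfield x0_in] has_dir_deriv_orbit]])
    finally show ?thesis .
  qed
  obtain \<gamma>x \<gamma>y where \<gamma>: "curve_through A \<one> v \<gamma>x" "curve_through A \<one> w \<gamma>y"
    using curve_through_exists[OF atlas v] curve_through_exists[OF atlas w] by blast
  \<comment> \<open>All pairs of curves give the same value by \<open>val\<close>; the pair just
    obtained forces any other candidate to be equal to it.\<close>
  show ?thesis unfolding second_deriv_one_def
  proof (rule the_equality)
    show "\<forall>\<gamma>x \<gamma>y. curve_through A \<one> v \<gamma>x \<and> curve_through A \<one> w \<gamma>y \<longrightarrow>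
        ?D = dir_deriv (\<lambda>s. dir_deriv (\<lambda>t. H (\<gamma>x s) (\<gamma>y t)) 0 1) 0 1"
      by (intro allI impI, elim conjE, rule val[symmetric])
    fix z assume "\<forall>\<gamma>x \<gamma>y. curve_through A \<one> v \<gamma>x \<and> curve_through A \<one> w \<gamma>y \<longrightarrow>
        z = dir_deriv (\<lambda>s. dir_deriv (\<lambda>t. H (\<gamma>x s) (\<gamma>y t)) 0 1) 0 1"
    from this[rule_format, OF conjI[OF \<gamma>]] show "z = ?D" unfolding val[OF \<gamma>] .
  qed
qed

text \<open>The product rule for \<theta> on a left invariant field: a derivative of the
  coefficients, as in the exterior derivative, plus \<theta> on a derivative of the field, which
  becomes half of a bracket term.\<close>

lemma dir_deriv_\<Theta>_lfield:
  "dir_deriv (\<lambda>z. \<Theta> c0 (z, lfield c0 w z)) x0 v =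
    dir_deriv (\<lambda>z. \<Theta> c0 (z, w)) x0 v + \<Theta> c0 (x0, dir_deriv (lfield c0 w) x0 v)"
proof -
  let ?b = "dir_deriv (lfield c0 w) x0 v"
  have o: "open (im0 \<times> (UNIV :: 'e set))" by (intro open_Times open_im0 open_UNIV)
  have mem: "(x0, w) \<in> im0 \<times> UNIV" using x0_in by simp
  note s = smooth_on_form_rep[OF theta c0_in]
  have "has_dir_deriv (\<lambda>z. \<Theta> c0 (z, lfield c0 w z)) x0 v (dir_deriv (\<Theta> c0) (x0, lfield c0 w x0) (v, ?b))"
    by (rule has_dir_deriv_compose[OF o s _ has_dir_deriv_Pair[OF has_dir_deriv_ident
          smooth_on_has_dir_deriv[OF smooth_on_lfield[OF c0_in] x0_in]]]) (use x0_in in simp)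
  then have "dir_deriv (\<lambda>z. \<Theta> c0 (z, lfield c0 w z)) x0 v = dir_deriv (\<Theta> c0) (x0, w) ((v, 0) + (0, ?b))"
    using dir_deriv_eq by fastforce
  also have "\<dots> = dir_deriv (\<lambda>z. \<Theta> c0 (z, w)) x0 v + dir_deriv (\<lambda>u. \<Theta> c0 (x0, u)) w ?b"
    unfolding dir_deriv_add_dir[OF o s mem] dir_deriv_prod_fst dir_deriv_prod_snd ..
  also have "dir_deriv (\<lambda>u. \<Theta> c0 (x0, u)) w ?b = \<Theta> c0 (x0, ?b)"
    by (rule dir_deriv_eq[OF has_dir_deriv_linear[OF linear_form_rep[OF atlas theta c0_in_charts_at]]])
  finally show ?thesis .
qed

lemma theta_one_cochain: "\<theta> \<one> \<in> lie_cochains1 A G"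
proof (rule cochain1I)
  show "linear (\<lambda>u. \<Theta> c0 (x0, u))" by (rule linear_form_rep[OF atlas theta c0_in_charts_at])
  show "continuous_on UNIV (\<lambda>u. \<Theta> c0 (x0, u))"
    by (rule continuous_on_compose2[OF smooth_on_imp_continuous_on[OF smooth_on_form_rep[OF theta c0_in]]])
      (use x0_in in \<open>auto intro!: continuous_intros\<close>)
qed (rule form_rep_eq[OF atlas c0_in_charts_at])

text \<open>Antisymmetrizing the second derivative gives d\<theta>(v, w) + \<theta>([v, w]) -
  v.\<theta>(w) + w.\<theta>(v) at the identity, that is, d\<theta> minus the Lie algebra coboundary
  of \<theta> at 1.\<close>

lemma cocycle_deriv_H:
  assumes v: "v \<in> \<gg>" and w: "w \<in> \<gg>"
  shows "ext_deriv A \<theta> \<one> v w - cocycle_deriv A G H v w = lie_coboundary1 A G \<rho> (\<theta> \<one>) v w"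
proof -
  have ext: "ext_deriv A \<theta> \<one> v w = dir_deriv (\<lambda>z. \<Theta> c0 (z, w c0)) x0 (v c0) - dir_deriv (\<lambda>z. \<Theta> c0 (z, v c0)) x0 (w c0)"
    by (simp add: ext_deriv_def form_rep_def Let_def)
  have coord: "coord (\<theta> \<one>) u = \<Theta> c0 (x0, u)" for u
    unfolding coord_def form_rep_tangent_of[OF atlas c0_in_charts_at] ..
  show ?thesis
    unfolding ext cocycle_deriv_def second_deriv_one_H[OF v w] second_deriv_one_H[OF w v] dir_deriv_\<Theta>_lfield
      lie_coboundary1_eq[OF v w] cob_def coord br_eq
      linear_diff[OF linear_form_rep[OF atlas theta c0_in_charts_at]]
    by (simp add: algebra_simps)
qed

end

theorem mainTheorem6:
  fixes G :: "'g::t2_space monoid"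
    and A :: "('g, 'e::locally_convex) chart set"
    and \<rho> :: "'g \<Rightarrow> 'a::locally_convex \<Rightarrow> 'a"
    and \<omega> :: "('g, 'e) tangent \<Rightarrow> ('g, 'e) tangent \<Rightarrow> 'a"
    and \<omega>_eq :: "'g \<Rightarrow> ('g, 'e) tangent \<Rightarrow> ('g, 'e) tangent \<Rightarrow> 'a"
    and \<theta> :: "'g \<Rightarrow> ('g, 'e) tangent \<Rightarrow> 'a"
  assumes lie: "lie_group A G"
    and conn: "connected (UNIV :: 'g set)"
    and complete: "sequentially_complete (UNIV :: 'a set)"
    and module: "smooth_module A G \<rho>"
    and cocycle: "\<omega> \<in> lie_cocycles2 A G \<rho>"
    and equivariant: "equivariant_form A G \<rho> \<omega> \<omega>_eq"
    and theta: "\<theta> \<in> one_forms A"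
    and d_theta: "\<And>p v w. v \<in> tangent_space A p \<Longrightarrow> w \<in> tangent_space A p \<Longrightarrow>
      \<omega>_eq p v w = ext_deriv A \<theta> p v w"
    and exact: "\<And>g. exact_form A
      (\<lambda>p v. pullback A A (\<lambda>x. g \<otimes>\<^bsub>G\<^esub> x) \<theta> p v - \<rho> g (\<theta> p v))"
  shows "\<exists>f\<in>smooth_cocycles2 A G \<rho>.
    mfd_smooth_on (prod_atlas A A) vec_atlas UNIV (\<lambda>(g, h). f g h) \<and>
    lie_class A G \<rho> (cocycle_deriv A G f) = lie_class A G \<rho> \<omega> \<and>
    lie_group (prod_atlas vec_atlas A) (extension_group G \<rho> f)"
proof -
  interpret integrated_form G A \<rho> \<theta>
    by unfold_locales (fact lie module conn complete theta exact)+
  have pair: "(\<lambda>(g, h). H g h) = (\<lambda>z. H (fst z) (snd z))" by (simp add: case_prod_beta')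
  have smooth: "mfd_smooth_on (prod_atlas A A) vec_atlas UNIV (\<lambda>(g, h). H g h)"
    unfolding pair mfd_smooth_on_iff[OF smooth_atlas_prod[OF atlas atlas] smooth_atlas_vec]
    using smooth_at_H_pair by simp
  have "H \<in> smooth_cocycles2 A G \<rho>"
    unfolding smooth_cocycles2_def using smooth H_cocycle by (auto intro!: exI[of _ UNIV])
  moreover have "lie_class A G \<rho> (cocycle_deriv A G H) = lie_class A G \<rho> \<omega>"
  proof (rule lie_class_eq[OF _ cocycle theta_one_cochain])
    show d: "\<omega> v w - cocycle_deriv A G H v w = lie_coboundary1 A G \<rho> (\<theta> \<one>) v w"
      if v: "v \<in> \<gg>" and w: "w \<in> \<gg>" for v w
    proof -
      \<comment> \<open>At the identity left translation is trivial, so equivariance identifies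
        \<omega> with d\<theta> there.\<close>
      have "\<omega>_eq \<one> (left_translate A G \<one> v) (left_translate A G \<one> w) = \<rho> \<one> (\<omega> v w)"
        using equivariant v w unfolding equivariant_form_def by blast
      then have "\<omega> v w = ext_deriv A \<theta> \<one> v w"
        using d_theta[OF v w] by (simp add: left_translate_one[OF v] left_translate_one[OF w])
      then show ?thesis using cocycle_deriv_H[OF v w] by simp
    qed
    show "cocycle_deriv A G H \<in> lie_cocycles2 A G \<rho>"
    \<comment> \<open>The cocycle property of D f is read off from \<omega> and the coboundary
      rather than from the group cocycle.\<close>
    proof (rule cocycle_diff[OF cocycle lie_coboundary1_cocycle[OF theta_one_cochain]])
      show "cocycle_deriv A G H v w = \<omega> v w - lie_coboundary1 A G \<rho> (\<theta> \<one>) v w" if "v \<in> \<gg>" "w \<in> \<gg>" for v w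
        using d[OF that] by (simp add: algebra_simps)
    qed
  qed
  moreover have "lie_group (prod_atlas vec_atlas A) (extension_group G \<rho> H)"
    by (rule extension_lie_group) (use H_cocycle smooth_at_H_pair in \<open>simp_all add: pair\<close>)
  ultimately show ?thesis using smooth by blast
qed

end
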